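(* Let $p\ge 3$, $G=SL(3)$, and let $\lambda=(\lambda_1,\lambda_2)$ be a dominant weight. Let $M(\lambda)=H^0(s_\alpha s_\beta,\lambda)$. Consider the conditions (A) $p\nmid\lambda_1+1$, $p\nmid\lambda_2+1$ and $p\nmid\lambda_1+\lambda_2+2$; (B) $p\nmid\lambda_2+1$ and $p\nmid 2\lambda_1+\lambda_2+2$. If (A) or (B) holds, then $\mathcal{V}_{B_1}(M(\lambda))=\mathfrak{u}$. Otherwise $\mathcal{V}_{B_1}(M(\lambda))$ is a proper subvariety of $\mathfrak{u}$ given by $$\mathcal{V}_{B_1}(M(\lambda))=\begin{cases}\mathfrak{u}_\alpha, & \text{if } \lambda=(np-1,0)\ \ (n\ge1),\\ \mathfrak{u}_\alpha\cup\mathfrak{u}_\beta, & \text{if }\lambda_2\neq0\text{ and neither (A) nor (B) holds.}\end{cases}$$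
   Context: Setting: $k$ is an algebraically closed field of characteristic $p$, $G=SL(3)$ over $k$ with maximal torus $T$, simple roots $\Delta=\{\alpha,\beta\}$, Weyl group $W$, and $B\supset T$ the Borel subgroup corresponding to the negative roots. A weight is written $\lambda=(\lambda_1,\lambda_2)$ with $\lambda_1=(\lambda,\alpha^\vee)$, $\lambda_2=(\lambda,\beta^\vee)$. $\mathfrak{u}$ is the Lie algebra of the unipotent radical of $B$. $P_\alpha\supset B$ is the minimal parabolic subgroup whose Levi factor containing $T$ has roots $\pm\alpha$, and $\mathfrak{u}_\alpha$ is the Lie algebra of its unipotent radical; similarly $P_\beta$, $\mathfrak{u}_\beta$. For $w\in W$, $X(w)$ is the closure of $B\dot wB/B$ in $G/B$; $\mathcal{L}(\lambda)$ is the line bundle on $G/B$ with $H^0(G/B,\mathcal{L}(\lambda))=\operatorname{ind}_B^G\lambda$; $H^0(w,\lambda)=H^0(X(w),\mathcal{L}(\lambda))$. One has $M(\lambda)\cong\operatorname{ind}_B^{P_\alpha}\operatorname{ind}_B^{P_\beta}\lambda$ as $B$-modules. Support varieties over the first Frobenius kernel $B_1$: for a finite-dimensional $B_1$-module $M$, $\mathcal{V}_{B_1}(M)$ is the closed subvariety of $\mathrm{Maxspec}\,H^{2\bullet}(B_1,k)$ defined by the annihilator of $\mathrm{Ext}^\bullet_{B_1}(M,M)$. It is identified with $\{x\in\mathcal{N}_1(\mathfrak{u}) : M\text{ is not projective over the restricted enveloping algebra } k[x]/(x^p)\text{ of }\langle x\rangle\}\cup\{0\}$, where $\mathcal{N}_1(\mathfrak{u})=\{x\in\mathfrak{u}:x^{[p]}=0\}=\mathfrak{u}$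 since $p\ge3$. *)

theory Defs
  imports
    "HOL-Analysis.Analysis"
    "HOL-Algebra.Module"
    "HOL-Library.FuncSet"
begin

section \<open>The group and its subgroups\<close>

type_synonym 'k mat3 = "'k ^ 3 ^ 3"

definition SL3 :: "'k::field mat3 set" where
  "SL3 = {g. det g = 1}"

text \<open>
  \<open>T\<close> is the diagonal torus, \<open>\<alpha> = \<epsilon>\<^sub>1 - \<epsilon>\<^sub>2\<close> and \<open>\<beta> = \<epsilon>\<^sub>2 - \<epsilon>\<^sub>3\<close>, so the root
  \<open>\<epsilon>\<^sub>i - \<epsilon>\<^sub>j\<close> sits in matrix position \<open>(i, j)\<close> and the Borel subgroup of the
  negative roots is lower triangular.  The order of the index type \<open>3\<close> is
  avoided, because there \<open>3 = 0\<close>.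
\<close>

definition borel3 :: "'k::field mat3 set" where
  "borel3 = {g \<in> SL3. g $ 1 $ 2 = 0 \<and> g $ 1 $ 3 = 0 \<and> g $ 2 $ 3 = 0}"

definition lie_u :: "'k::field mat3 set" where
  "lie_u = {x. x $ 1 $ 1 = 0 \<and> x $ 2 $ 2 = 0 \<and> x $ 3 $ 3 = 0 \<and>
               x $ 1 $ 2 = 0 \<and> x $ 1 $ 3 = 0 \<and> x $ 2 $ 3 = 0}"

text \<open>
  \<open>P\<^sub>\<alpha>\<close> is the block triangular subgroup with blocks \<open>{1, 2}, {3}\<close>; the roots of its
  unipotent radical are \<open>-\<beta>\<close> and \<open>-\<alpha> - \<beta>\<close>.  Similarly \<open>P\<^sub>\<beta>\<close> has blocks \<open>{1}, {2, 3}\<close>.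
\<close>

definition lie_u_alpha :: "'k::field mat3 set" where
  "lie_u_alpha = {x \<in> lie_u. x $ 2 $ 1 = 0}"

definition lie_u_beta :: "'k::field mat3 set" where
  "lie_u_beta = {x \<in> lie_u. x $ 3 $ 2 = 0}"

definition s_alpha :: "'k::field mat3" where
  "s_alpha = vector [vector [0, 1, 0], vector [-1, 0, 0], vector [0, 0, 1]]"

definition s_beta :: "'k::field mat3" where
  "s_beta = vector [vector [1, 0, 0], vector [0, 0, 1], vector [0, -1, 0]]"

text \<open>
  The character \<open>\<lambda>\<close> of \<open>T\<close> with \<open>(\<lambda>, \<alpha>\<^sup>\<or>) = \<lambda>\<^sub>1\<close> and \<open>(\<lambda>, \<beta>\<^sup>\<or>) = \<lambda>\<^sub>2\<close>, extended
  to \<open>B\<close>; here \<open>\<alpha>\<^sup>\<or>(t) = diag(t, 1/t, 1)\<close> and \<open>\<beta>\<^sup>\<or>(t) = diag(1, t, 1/t)\<close>.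
\<close>

definition weight_char :: "int \<Rightarrow> int \<Rightarrow> 'k::field mat3 \<Rightarrow> 'k" where
  "weight_char l1 l2 b = (b $ 1 $ 1) powi (l1 + l2) * (b $ 2 $ 2) powi l2"

section \<open>Polynomial functions and the Zariski topology\<close>

inductive_set poly_funs :: "('k::field mat3 \<Rightarrow> 'k) set" where
  const: "(\<lambda>_. c) \<in> poly_funs"
| entry: "(\<lambda>g. g $ i $ j) \<in> poly_funs"
| add: "F \<in> poly_funs \<Longrightarrow> H \<in> poly_funs \<Longrightarrow> (\<lambda>g. F g + H g) \<in> poly_funs"
| mult: "F \<in> poly_funs \<Longrightarrow> H \<in> poly_funs \<Longrightarrow> (\<lambda>g. F g * H g) \<in> poly_funs"

definition zariski_closure :: "'k::field mat3 set \<Rightarrow> 'k mat3 set" where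
  "zariski_closure S = {g. \<forall>F \<in> poly_funs. (\<forall>s \<in> S. F s = 0) \<longrightarrow> F g = 0}"

section \<open>Sections of line bundles on Schubert varieties\<close>

text \<open>
  The preimage in \<open>G\<close> of the Schubert variety \<open>X(w)\<close>, i.e. the closure of \<open>B w B\<close>.  It is
  already contained in \<open>SL3\<close>, which is closed in the space of all matrices.
\<close>

definition schubert_cone :: "'k::field mat3 \<Rightarrow> 'k mat3 set" where
  "schubert_cone w = zariski_closure {a ** w ** b | a b. a \<in> borel3 \<and> b \<in> borel3}"

text \<open>
  \<open>H\<^sup>0(X(w), L(\<lambda>))\<close>: by definition of the associated bundle \<open>L(\<lambda>)\<close>, a section over \<open>X(w)\<close>
  is a regular function \<open>f\<close> on the preimage of \<open>X(w)\<close> with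
  \<open>f(g b) = \<lambda>(b)\<^sup>-\<^sup>1 f(g)\<close> for \<open>b\<close> in \<open>B\<close>.  That preimage is an affine variety, so its
  regular functions are the restrictions of polynomial functions.  The values of \<open>f\<close>
  outside are set to \<open>0\<close> to make \<open>f\<close> unique.
\<close>

definition H0 :: "'k::field mat3 \<Rightarrow> int \<Rightarrow> int \<Rightarrow> ('k mat3 \<Rightarrow> 'k) set" where
  "H0 w l1 l2 = {f.
     (\<exists>F \<in> poly_funs. \<forall>g \<in> schubert_cone w. f g = F g) \<and>
     (\<forall>g. g \<notin> schubert_cone w \<longrightarrow> f g = 0) \<and>
     (\<forall>g \<in> schubert_cone w. \<forall>b \<in> borel3. f (g ** b) = inverse (weight_char l1 l2 b) * f g)}"

definition left_translate :: "'k::field mat3 \<Rightarrow> ('k mat3 \<Rightarrow> 'k) \<Rightarrow> 'k mat3 \<Rightarrow> 'k" where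
  "left_translate b f = (\<lambda>g. f (matrix_inv b ** g))"

text \<open>
  The differential of the rational \<open>B\<close>-action by left translation: for \<open>x\<close> in \<open>\<uu>\<close> the
  polynomial curve \<open>t \<mapsto> 1 + t x\<close> in \<open>B\<close> has tangent vector \<open>x\<close> at \<open>t = 0\<close>, and
  \<open>x\<close> sends \<open>f\<close> to the coefficient of \<open>t\<close> in the polynomial
  \<open>t \<mapsto> (1 + t x) f\<close> (the polynomial is unique because \<open>k\<close> is infinite).
\<close>

definition lie_act :: "'k::field mat3 \<Rightarrow> ('k mat3 \<Rightarrow> 'k) \<Rightarrow> 'k mat3 \<Rightarrow> 'k" where
  "lie_act x f = (\<lambda>g. coeff (THE q. \<forall>t. poly q t = left_translate (mat 1 + mat t ** x) f g) 1)"

section \<open>Projective modules\<close>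

definition free_module :: "'i set \<Rightarrow> ('r, 'm) ring_scheme \<Rightarrow> ('r, 'i \<Rightarrow> 'r) module" where
  "free_module I R = \<lparr>
     carrier = {v \<in> I \<rightarrow>\<^sub>E carrier R. finite {i \<in> I. v i \<noteq> \<zero>\<^bsub>R\<^esub>}},
     monoid.mult = undefined, one = undefined,
     zero = (\<lambda>i\<in>I. \<zero>\<^bsub>R\<^esub>),
     add = (\<lambda>v w. \<lambda>i\<in>I. v i \<oplus>\<^bsub>R\<^esub> w i),
     smult = (\<lambda>r v. \<lambda>i\<in>I. r \<otimes>\<^bsub>R\<^esub> v i)\<rparr>"

definition module_hom_set ::
  "('r, 'm) ring_scheme \<Rightarrow> ('r, 'a, 'c) module_scheme \<Rightarrow> ('r, 'b, 'd) module_scheme \<Rightarrow> ('a \<Rightarrow> 'b) set" where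
  "module_hom_set R M N = {h \<in> carrier M \<rightarrow> carrier N.
     (\<forall>v \<in> carrier M. \<forall>w \<in> carrier M. h (v \<oplus>\<^bsub>M\<^esub> w) = h v \<oplus>\<^bsub>N\<^esub> h w) \<and>
     (\<forall>r \<in> carrier R. \<forall>v \<in> carrier M. h (r \<odot>\<^bsub>M\<^esub> v) = r \<odot>\<^bsub>N\<^esub> h v)}"

text \<open>
  A module is projective if it is a direct summand of a free module.  Index sets inside the
  type of \<open>M\<close> suffice, since the free module on the set \<open>carrier M\<close> surjects onto \<open>M\<close>.
\<close>

definition projective_module :: "('r, 'm) ring_scheme \<Rightarrow> ('r, 'a, 'c) module_scheme \<Rightarrow> bool" where
  "projective_module R M \<longleftrightarrow>
     (\<exists>(I :: 'a set) \<iota> \<pi>. \<iota> \<in> module_hom_set R M (free_module I R) \<and>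
        \<pi> \<in> module_hom_set R (free_module I R) M \<and>
        (\<forall>v \<in> carrier M. \<pi> (\<iota> v) = v))"

section \<open>Support varieties\<close>

text \<open>
  The algebra \<open>k[X]/(X\<^sup>p)\<close> on the representatives of degree less than \<open>p\<close>: the restricted
  enveloping algebra of the line spanned by a nonzero \<open>x\<close> with \<open>x\<^sup>[\<^sup>p\<^sup>] = 0\<close>.
\<close>

definition truncated_poly_ring :: "nat \<Rightarrow> 'k::field poly ring" where
  "truncated_poly_ring p = \<lparr>
     carrier = {f. degree f < p},
     monoid.mult = (\<lambda>f h. (f * h) mod monom 1 p), one = 1,
     zero = 0, add = (+)\<rparr>"

text \<open>The space \<open>V\<close> of functions, with \<open>X\<close> acting as the operator \<open>N\<close>.\<close>

definition operator_module ::
  "('a \<Rightarrow> 'k::field) set \<Rightarrow> (('a \<Rightarrow> 'k) \<Rightarrow> 'a \<Rightarrow> 'k) \<Rightarrow> ('k poly, 'a \<Rightarrow> 'k) module" where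
  "operator_module V N = \<lparr>
     carrier = V,
     monoid.mult = undefined, one = undefined,
     zero = (\<lambda>_. 0), add = (\<lambda>f h a. f a + h a),
     smult = (\<lambda>q f a. \<Sum>i\<le>degree q. coeff q i * (N ^^ i) f a)\<rparr>"

definition restricted_nullcone :: "'k::field mat3 set" where
  "restricted_nullcone = {x \<in> lie_u. ((**) x ^^ CHAR('k)) (mat 1) = 0}"

text \<open>
  The support variety over \<open>B\<^sub>1\<close> of a space \<open>V\<close> of functions on which \<open>\<uu>\<close> acts by \<open>act\<close>, as
  a subset of \<open>\<uu>\<close>.  The closed subset of \<open>Maxspec H\<^sup>2\<^sup>\<bullet>(B\<^sub>1, k)\<close> cut out by the annihilator of
  \<open>Ext\<^sub>B\<^sub>1(V, V)\<close> is taken in its standard identification with a subset of the restricted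
  nullcone: the points \<open>x\<close> over whose restricted enveloping algebra \<open>V\<close> is not projective,
  together with \<open>0\<close>.
\<close>

definition support_variety ::
  "('k::field mat3 \<Rightarrow> ('a \<Rightarrow> 'k) \<Rightarrow> 'a \<Rightarrow> 'k) \<Rightarrow> ('a \<Rightarrow> 'k) set \<Rightarrow> 'k mat3 set" where
  "support_variety act V =
     {x \<in> restricted_nullcone.
        \<not> projective_module (truncated_poly_ring CHAR('k)) (operator_module V (act x))} \<union> {0}"

end

theory Submission
  imports Defs "HOL-Library.Function_Algebras" "HOL-Computational_Algebra.Primes"
begin

text \<open>
  Why the theorem holds.  The preimage in \<open>G\<close> of the Schubert surface is the closure of the
  cell \<open>B w B\<close> with \<open>w = s\<^sub>\<alpha> s\<^sub>\<beta>\<close>, and this cell is a plane with coordinates \<open>(x, y)\<close> times \<open>B\<close>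
  (lemma \<open>cell_eq\<close>).  A section is determined by its restriction to the plane.
  This restriction is a polynomial, and the poles that it may have along the two curves at
  infinity bound its monomials: with \<open>N = \<lambda>\<^sub>1 + \<lambda>\<^sub>2\<close>, the module \<open>M(\<lambda>)\<close> becomes the span of
  the monomials \<open>x\<^sup>i y\<^sup>n\<close> with \<open>n \<le> \<lambda>\<^sub>2\<close> and \<open>i + n \<le> N\<close>, a trapezoid of monomials
  (lemma \<open>section_of_bij\<close>).  An element of \<open>\<uu>\<close> with entries \<open>x\<^sub>2\<^sub>1 = -a\<close>, \<open>x\<^sub>3\<^sub>2 = -b\<close>, \<open>x\<^sub>3\<^sub>1 = -c\<close>
  acts as the vector field \<open>D = a \<partial>\<^sub>x + (b x + c) \<partial>\<^sub>y\<close> (lemma \<open>lie_act_section_of\<close>), and \<open>D\<^sup>p = 0\<close>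
  because \<open>p \<ge> 3\<close>.

  Over \<open>k[X]/(X\<^sup>p)\<close> a finite-dimensional module is projective if and only if
  \<open>ker D \<subseteq> im D\<^sup>p\<^sup>-\<^sup>1\<close>, and then there is a linear \<open>E\<close> with \<open>\<Sum>\<^sub>j D\<^sup>j E D\<^sup>p\<^sup>-\<^sup>1\<^sup>-\<^sup>j = 1\<close>
  (lemmas \<open>projective_of_kernel_subset_image\<close>, \<open>higman_of_projective\<close>).

  If \<open>a = 0\<close> and \<open>D \<noteq> 0\<close>, then \<open>D\<close> is a multiple of \<open>\<partial>\<^sub>y\<close> and some polynomial in \<open>x\<close> is in its kernel but not in
  its image.  If \<open>b = 0 \<noteq> a\<close>, then \<open>D\<close> lowers the total degree, and a kernel element of degree
  larger than \<open>N - (p - 1)\<close> exists except when \<open>\<lambda>\<^sub>2 = 0\<close> and \<open>p\<close> divides \<open>\<lambda>\<^sub>1 + 1\<close>.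

  The interesting case is \<open>a \<noteq> 0 \<noteq> b\<close>.  Two filtrations give projectivity.  By degree in
  \<open>y\<close>, the strip of all monomials with \<open>n < r\<close> has subquotients \<open>k[x]\<close> with \<open>a \<partial>\<^sub>x\<close>, so it is exact.
  By total degree, the strip modulo the trapezoid has subquotients on which \<open>D\<close> acts as \<open>b x \<partial>\<^sub>y\<close> on
  a diagonal of \<open>r\<close> monomials, and this is free if \<open>p\<close> divides \<open>r\<close>.  Hence the trapezoid with
  \<open>r = \<lambda>\<^sub>2 + 1\<close> rows is free if \<open>p\<close> divides \<open>\<lambda>\<^sub>2 + 1\<close>.  Adding or removing one row whose length is
  divisible by \<open>p\<close> covers the cases \<open>\<lambda>\<^sub>2 \<equiv> 0\<close>, \<open>\<lambda>\<^sub>1 \<equiv> -1\<close> and \<open>\<lambda>\<^sub>2 \<equiv> -2\<close>, \<open>\<lambda>\<^sub>1 \<equiv> 0\<close>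
  (lemma \<open>trapezoid_kernel_exact\<close>).  Conversely, the operator \<open>E\<close> makes two traces vanish: that of
  the identity and that of an Euler field \<open>\<Theta>\<close> with \<open>[D, \<Theta>] = D\<close>.  In terms of monomials they are the number
  of points of the trapezoid and the sum of \<open>i + 2 n\<close> over it, and these two numbers are divisible by
  \<open>p\<close> only in the three cases above (lemmas \<open>higman_divisibility\<close> and
  \<open>weight_condition_of_divisibility\<close>).  The three cases together are the failure of both (A) and (B).
\<close>

section \<open>Projective modules over truncated polynomial rings\<close>

text \<open>
  Modules are spaces of functions, as in \<open>operator_module\<close>.  The pointwise scalar multiplication
  makes the vector space library available for them.
\<close>

definition fscale :: "'k::field \<Rightarrow> ('a \<Rightarrow> 'k) \<Rightarrow> 'a \<Rightarrow> 'k" (infixr "*f" 75) where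
  "c *f v = (\<lambda>a. c * v a)"

lemma fscale_apply [simp]: "(c *f v) a = c * v a"
  by (simp add: fscale_def)

interpretation fun_space: vector_space "fscale :: 'k::field \<Rightarrow> ('a \<Rightarrow> 'k) \<Rightarrow> 'a \<Rightarrow> 'k"
  by unfold_locales (auto simp: fun_eq_iff algebra_simps)

lemma sum_fun_apply: "(\<Sum>i\<in>A. f i) x = (\<Sum>i\<in>A. f i x)"
  for f :: "'i \<Rightarrow> 'a \<Rightarrow> 'k::field"
  by (induction A rule: infinite_finite_induct) auto

lemma coeff_mod_monom:
  fixes f :: "'k::field poly"
  shows "coeff (f mod monom 1 p) j = (if j < p then coeff f j else 0)"
proof -
  let ?m = "monom 1 p :: 'k poly"
  have f: "f = ?m * (f div ?m) + f mod ?m"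
    by (simp add: mult_div_mod_eq)
  have nz: "?m \<noteq> 0" by (simp add: monom_eq_0_iff)
  have "coeff (f mod ?m) j = 0" if "j \<ge> p"
    using degree_mod_less[OF nz, of f] that by (auto simp: degree_monom_eq coeff_eq_0)
  moreover have "coeff f j = coeff (f mod ?m) j" if "j < p"
  proof -
    have "coeff f j = coeff (?m * (f div ?m)) j + coeff (f mod ?m) j"
      unfolding coeff_add[symmetric] using f by (rule arg_cong)
    then show ?thesis using that by (simp add: coeff_monom_mult)
  qed
  ultimately show ?thesis by auto
qed

text \<open>
  The operator is only required to be linear on \<open>V\<close>, because an operator such as \<open>lie_act x\<close> is
  defined on all functions but has no meaning outside the module.
\<close>

locale nilpotent_operator =
  fixes V :: "('a \<Rightarrow> 'k::field) set" and N :: "('a \<Rightarrow> 'k) \<Rightarrow> 'a \<Rightarrow> 'k" and p :: nat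
  assumes subspace: "fun_space.subspace V"
    and finitely_spanned: "\<exists>S. finite S \<and> S \<subseteq> V \<and> V \<subseteq> fun_space.span S"
    and N_closed: "v \<in> V \<Longrightarrow> N v \<in> V"
    and N_add: "v \<in> V \<Longrightarrow> w \<in> V \<Longrightarrow> N (v + w) = N v + N w"
    and N_scale: "v \<in> V \<Longrightarrow> N (c *f v) = c *f N v"
    and N_nilpotent: "v \<in> V \<Longrightarrow> (N ^^ p) v = 0"
    and two_le_p: "2 \<le> p"
begin

lemmas V_simps = fun_space.subspace_add[OF subspace] fun_space.subspace_diff[OF subspace]
  fun_space.subspace_scale[OF subspace] fun_space.subspace_0[OF subspace]
  fun_space.subspace_sum[OF subspace]

lemma N_0: "N 0 = 0"
  using N_scale[OF V_simps(4), of 0] by simp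

lemma N_pow_closed: "v \<in> V \<Longrightarrow> (N ^^ i) v \<in> V"
  by (induction i) (auto intro: N_closed)

lemma N_pow_add: "v \<in> V \<Longrightarrow> w \<in> V \<Longrightarrow> (N ^^ i) (v + w) = (N ^^ i) v + (N ^^ i) w"
  by (induction i) (auto simp: N_add N_pow_closed)

lemma N_pow_scale: "v \<in> V \<Longrightarrow> (N ^^ i) (c *f v) = c *f (N ^^ i) v"
  by (induction i) (auto simp: N_scale N_pow_closed)

lemma N_pow_0: "(N ^^ i) 0 = 0"
  using N_pow_scale[OF V_simps(4), of i 0] by simp

lemma N_pow_diff: "v \<in> V \<Longrightarrow> w \<in> V \<Longrightarrow> (N ^^ i) (v - w) = (N ^^ i) v - (N ^^ i) w"
  using N_pow_add[of "v - w" w i] by (simp add: V_simps)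

lemma N_pow_sum:
  assumes "\<And>s. s \<in> S \<Longrightarrow> f s \<in> V"
  shows "(N ^^ i) (\<Sum>s\<in>S. f s) = (\<Sum>s\<in>S. (N ^^ i) (f s))"
  using assms
  by (induction S rule: infinite_finite_induct) (auto simp: N_pow_0 N_pow_add V_simps)

lemma N_pow_ge: "v \<in> V \<Longrightarrow> p \<le> i \<Longrightarrow> (N ^^ i) v = 0"
proof -
  assume "v \<in> V" "p \<le> i"
  then have "(N ^^ i) v = (N ^^ (i - p)) ((N ^^ p) v)"
    by (metis comp_apply funpow_add le_add_diff_inverse2)
  then show ?thesis using \<open>v \<in> V\<close> by (simp add: N_nilpotent N_pow_0)
qed

definition act :: "'k poly \<Rightarrow> ('a \<Rightarrow> 'k) \<Rightarrow> 'a \<Rightarrow> 'k" where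
  "act f v = (\<Sum>i\<le>degree f. coeff f i *f (N ^^ i) v)"

lemma smult_operator_module: "f \<odot>\<^bsub>operator_module V N\<^esub> v = act f v"
  by (auto simp: operator_module_def act_def fun_eq_iff sum_fun_apply)

lemma act_bound: "degree f \<le> m \<Longrightarrow> act f v = (\<Sum>i\<le>m. coeff f i *f (N ^^ i) v)"
  unfolding act_def
  by (rule sum.mono_neutral_left) (auto simp: coeff_eq_0)

lemma act_less: 
  assumes "degree f < m" shows "act f v = (\<Sum>i<m. coeff f i *f (N ^^ i) v)"
  unfolding act_def using assms
  by (intro sum.mono_neutral_left) (auto simp: coeff_eq_0)

lemma act_closed: "v \<in> V \<Longrightarrow> act f v \<in> V"
  by (simp add: act_def V_simps N_pow_closed)

lemma act_add_right: "v \<in> V \<Longrightarrow> w \<in> V \<Longrightarrow> act f (v + w) = act f v + act f w"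
  by (simp add: act_def N_pow_add fun_space.scale_right_distrib sum.distrib)

lemma act_0_right: "act f 0 = 0"
  by (simp add: act_def N_pow_0)

lemma act_0_left: "act 0 v = 0"
  by (simp add: act_def)

lemma act_sum_right:
  assumes "\<And>s. s \<in> S \<Longrightarrow> g s \<in> V"
  shows "act f (\<Sum>s\<in>S. g s) = (\<Sum>s\<in>S. act f (g s))"
  using assms
  by (induction S rule: infinite_finite_induct) (auto simp: act_0_right act_add_right V_simps)

lemma act_add_left: "act (f + g) v = act f v + act g v"
proof -
  define m where "m = max (degree f) (degree g)"
  have "degree (f + g) \<le> m" "degree f \<le> m" "degree g \<le> m"
    by (auto simp: m_def degree_add_le)
  then show ?thesis
    by (simp add: act_bound fun_space.scale_left_distrib sum.distrib)
qed

lemma act_smult_left: "act (Polynomial.smult c f) v = c *f act f v"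
  by (subst act_bound[of _ "degree f"])
    (auto simp: act_def fun_space.scale_sum_right degree_smult_le)

lemma act_pCons:
  assumes "v \<in> V" shows "act (pCons c f) v = c *f v + N (act f v)"
proof -
  have "act (pCons c f) v = (\<Sum>i\<le>Suc (degree f). coeff (pCons c f) i *f (N ^^ i) v)"
    by (rule act_bound) (simp add: degree_pCons_le)
  also have "\<dots> = c *f v + (\<Sum>i\<le>degree f. coeff f i *f (N ^^ Suc i) v)"
    by (simp add: sum.atMost_Suc_shift del: sum.atMost_Suc)
  also have "(\<Sum>i\<le>degree f. coeff f i *f (N ^^ Suc i) v) = (N ^^ 1) (act f v)"
    unfolding act_def
    by (subst N_pow_sum) (auto simp: assms N_scale N_pow_closed V_simps)
  finally show ?thesis by (simp only: One_nat_def funpow.simps comp_id)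
qed

lemma act_mult:
  assumes "v \<in> V" shows "act (f * g) v = act f (act g v)"
proof (induction f)
  case (pCons c f)
  then show ?case using assms
    by (simp add: act_pCons act_closed act_add_left act_smult_left)
qed (simp add: act_0_left)

text \<open>
  Reduction modulo \<open>X\<^sup>p\<close> does not change the action, so the multiplication of the truncated ring
  may be replaced by that of polynomials.
\<close>

lemma act_mod:
  assumes "v \<in> V" shows "act (f mod monom 1 p) v = act f v"
proof -
  have "act (monom 1 p) v = 0"
    by (simp add: act_def degree_monom_eq coeff_monom if_distrib[of "\<lambda>c. c *f _"] N_nilpotent assms
        cong: if_cong)
  then have "act (f div monom 1 p * monom 1 p) v = 0"
    using assms by (simp add: act_mult act_0_right)
  moreover have "act f v = act (f div monom 1 p * monom 1 p) v + act (f mod monom 1 p) v"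
    by (subst act_add_left[symmetric]) (simp add: div_mult_mod_eq)
  ultimately show ?thesis by simp
qed

abbreviation "R \<equiv> truncated_poly_ring p :: 'k poly ring"

lemma carrier_R: "carrier R = {f. degree f < p}"
  by (simp add: truncated_poly_ring_def)

lemma carrier_operator_module: "carrier (operator_module V N) = V"
  by (simp add: operator_module_def)

lemma add_operator_module: "v \<oplus>\<^bsub>operator_module V N\<^esub> w = v + w"
  by (auto simp: operator_module_def fun_eq_iff)

lemma add_free: "v \<oplus>\<^bsub>free_module I R\<^esub> w = (\<lambda>i\<in>I. v i + w i)"
  by (simp add: free_module_def truncated_poly_ring_def)

lemma smult_free: "r \<odot>\<^bsub>free_module I R\<^esub> w = (\<lambda>i\<in>I. (r * w i) mod monom 1 p)"
  by (simp add: free_module_def truncated_poly_ring_def)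

lemma carrier_free: 
  "carrier (free_module I R) = {v \<in> I \<rightarrow>\<^sub>E {f. degree f < p}. finite {i \<in> I. v i \<noteq> 0}}"
  by (simp add: free_module_def truncated_poly_ring_def)

lemma degree_mod_monom: "degree (f mod monom 1 p :: 'k poly) < p"
proof -
  have "degree (f mod monom 1 p :: 'k poly) \<le> p - 1"
    by (rule degree_le) (auto simp: coeff_mod_monom)
  then show ?thesis using two_le_p by linarith
qed

text \<open>
  Higman's criterion.  A direct summand of a free module inherits the operator \<open>E\<close> that reads off
  the coefficient of \<open>X\<^sup>p\<^sup>-\<^sup>1\<close> in each coordinate and puts it back as the coefficient of \<open>1\<close>.
  The maps \<open>\<iota>\<close> and \<open>\<pi>\<close> transport it to \<open>V\<close>.
\<close>

lemma higman_of_projective: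
  assumes proj: "projective_module R (operator_module V N)"
  obtains E where "\<And>v. v \<in> V \<Longrightarrow> E v \<in> V"
    and "\<And>v w. v \<in> V \<Longrightarrow> w \<in> V \<Longrightarrow> E (v + w) = E v + E w"
    and "\<And>c v. v \<in> V \<Longrightarrow> E (c *f v) = c *f E v"
    and "\<And>v. v \<in> V \<Longrightarrow> v = (\<Sum>j<p. (N ^^ j) (E ((N ^^ (p - 1 - j)) v)))"
proof -
  obtain I :: "('a \<Rightarrow> 'k) set" and \<iota> \<pi> where
    \<iota>: "\<iota> \<in> module_hom_set R (operator_module V N) (free_module I R)" and
    \<pi>: "\<pi> \<in> module_hom_set R (free_module I R) (operator_module V N)" and
    \<pi>\<iota>: "\<And>v. v \<in> V \<Longrightarrow> \<pi> (\<iota> v) = v"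
    using proj unfolding projective_module_def carrier_operator_module by blast
  let ?F = "free_module I R"
  have \<iota>_closed: "\<iota> v \<in> carrier ?F" if "v \<in> V" for v
    using \<iota> that by (auto simp: module_hom_set_def carrier_operator_module)
  have \<iota>_add: "\<iota> (v + w) = (\<lambda>i\<in>I. \<iota> v i + \<iota> w i)" if "v \<in> V" "w \<in> V" for v w
    using \<iota> that by (auto simp: module_hom_set_def carrier_operator_module add_operator_module add_free)
  have \<iota>_act: "\<iota> (act r v) = (\<lambda>i\<in>I. (r * \<iota> v i) mod monom 1 p)"
    if "degree r < p" "v \<in> V" for r v
    using \<iota> that
    by (auto simp: module_hom_set_def carrier_operator_module smult_operator_module
        smult_free carrier_R)
  have \<pi>_closed: "\<pi> u \<in> V" if "u \<in> carrier ?F" for u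
    using \<pi> that by (auto simp: module_hom_set_def carrier_operator_module)
  have \<pi>_add: "\<pi> (\<lambda>i\<in>I. u i + w i) = \<pi> u + \<pi> w" if "u \<in> carrier ?F" "w \<in> carrier ?F" for u w
    using \<pi> that by (auto simp: module_hom_set_def add_operator_module add_free)
  have \<pi>_act: "\<pi> (\<lambda>i\<in>I. (r * u i) mod monom 1 p) = act r (\<pi> u)"
    if "degree r < p" "u \<in> carrier ?F" for r u
    using \<pi> that
    by (auto simp: module_hom_set_def smult_operator_module smult_free carrier_R)
  define e where "e b = (\<lambda>i\<in>I. if i = b then 1 else (0 :: 'k poly))" for b
  define w where "w b = \<pi> (e b)" for b
  have e_closed: "e b \<in> carrier ?F" for b
    using two_le_p by (auto simp: carrier_free e_def)
  have w_closed: "w b \<in> V" for b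
    by (simp add: w_def \<pi>_closed e_closed)
  have zero_closed: "(\<lambda>i\<in>I. 0) \<in> carrier ?F"
    using two_le_p by (auto simp: carrier_free)
  have \<pi>_zero: "\<pi> (\<lambda>i\<in>I. 0) = 0"
    using \<pi>_add[OF zero_closed zero_closed] by (simp cong: restrict_cong)
  have expand: "\<pi> u = (\<Sum>b\<in>J. act (u b) (w b))"
    if "finite J" "J \<subseteq> I" "u \<in> carrier ?F" "\<And>i. i \<in> I - J \<Longrightarrow> u i = 0" for J u
    using that
  proof (induction J arbitrary: u rule: finite_induct)
    case empty
    then have "u = (\<lambda>i\<in>I. 0)"
      by (auto simp: carrier_free fun_eq_iff PiE_iff extensional_def)
    then show ?case using \<pi>_zero by (simp only: sum.empty)
  next
    case (insert b J)
    define u' where "u' = (\<lambda>i\<in>I. if i = b then 0 else u i)"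
    have "{i \<in> I. u' i \<noteq> 0} \<subseteq> {i \<in> I. u i \<noteq> 0}"
      by (auto simp: u'_def)
    then have u': "u' \<in> carrier ?F"
    proof -
      have "finite {i \<in> I. u' i \<noteq> 0}"
        using \<open>{i \<in> I. u' i \<noteq> 0} \<subseteq> _\<close> insert.prems(2)
        unfolding carrier_free by (blast intro: finite_subset)
      moreover have "u' \<in> I \<rightarrow>\<^sub>E {f. degree f < p}"
        using insert.prems(2) two_le_p unfolding carrier_free u'_def
        by (auto simp: PiE_iff)
      ultimately show ?thesis unfolding carrier_free by blast
    qed
    have b: "b \<in> I" "degree (u b) < p"
      using insert.prems by (auto simp: carrier_free)
    have "u b mod monom 1 p = u b"
      using b by (intro mod_poly_less) (simp add: degree_monom_eq)
    then have "u i = (\<lambda>i\<in>I. (\<lambda>i\<in>I. (u b * e b i) mod monom 1 p) i + u' i) i" for i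
      using insert.prems(2) b
      by (cases "i \<in> I"; cases "i = b")
        (auto simp: u'_def e_def carrier_free PiE_iff extensional_def)
    then have "u = (\<lambda>i\<in>I. (\<lambda>i\<in>I. (u b * e b i) mod monom 1 p) i + u' i)" ..
    moreover have "(\<lambda>i\<in>I. (u b * e b i) mod monom 1 p) \<in> carrier ?F"
      by (auto simp: carrier_free e_def degree_mod_monom intro!: rev_finite_subset[of "{b}"])
    ultimately have "\<pi> u = \<pi> (\<lambda>i\<in>I. (u b * e b i) mod monom 1 p) + \<pi> u'"
      using \<pi>_add[OF _ u'] by metis
    also have "\<pi> (\<lambda>i\<in>I. (u b * e b i) mod monom 1 p) = act (u b) (w b)"
      unfolding w_def by (rule \<pi>_act[OF b(2) e_closed])
    also have "\<pi> u' = (\<Sum>b\<in>J. act (u' b) (w b))"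
    proof (rule insert.IH[OF _ u'])
      show "u' i = 0" if "i \<in> I - J" for i
        using insert.prems(3)[of i] that by (auto simp: u'_def)
    qed (use insert.prems in auto)
    also have "\<dots> = (\<Sum>b\<in>J. act (u b) (w b))"
      using insert by (intro sum.cong) (auto simp: u'_def)
    finally show ?case using insert by simp
  qed
  define cf where "cf v i = coeff (\<iota> v i) (p - 1)" for v i
  have \<iota>_zero: "\<iota> 0 i = 0" if "i \<in> I" for i
  proof -
    have "\<iota> 0 i = \<iota> 0 i + \<iota> 0 i"
      using fun_cong[OF \<iota>_add[OF V_simps(4) V_simps(4)], of i] that by (simp only: restrict_apply' add_0)
    then show ?thesis by (simp only: add_cancel_right_right)
  qed
  have coeff_\<iota>: "coeff (\<iota> v i) j = cf ((N ^^ (p - 1 - j)) v) i"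
    if "v \<in> V" "i \<in> I" "j < p" for v i j
  proof -
    have "coeff (\<iota> ((N ^^ k) v) i) (j + k) = coeff (\<iota> v i) j" if "j + k < p" for k
      using that
    proof (induction k)
      case (Suc k)
      have "act [:0, 1:] ((N ^^ k) v) = (N ^^ Suc k) v"
        using \<open>v \<in> V\<close> by (simp add: act_pCons act_0_left N_pow_closed N_0)
      then have "\<iota> ((N ^^ Suc k) v) i = ([:0, 1:] * \<iota> ((N ^^ k) v) i) mod monom 1 p"
        using \<iota>_act[of "[:0, 1:]" "(N ^^ k) v"] two_le_p \<open>i \<in> I\<close> \<open>v \<in> V\<close>
        by (simp add: N_pow_closed)
      then show ?case using Suc by (simp add: coeff_mod_monom)
    qed simp
    from this[of "p - 1 - j"] show ?thesis using that by (simp add: cf_def)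
  qed
  obtain S where S: "finite S" "S \<subseteq> V" "V \<subseteq> fun_space.span S"
    using finitely_spanned by blast
  \<comment> \<open>Finitely many coordinates suffice for all of \<open>V\<close>, which makes \<open>E\<close> a finite sum.\<close>
  define J where "J = (\<Union>s\<in>S. {i \<in> I. \<iota> s i \<noteq> 0})"
  have J: "finite J" "J \<subseteq> I"
    using S \<iota>_closed by (auto simp: J_def carrier_free subset_iff)
  have \<iota>_scale: "\<iota> (c *f v) i = Polynomial.smult c (\<iota> v i)" if "v \<in> V" "i \<in> I" for c v i
  proof -
    have "act [:c:] v = c *f v"
      using that by (simp add: act_pCons act_0_left N_0)
    moreover have "\<iota> v i mod monom 1 p = \<iota> v i"
      using \<iota>_closed[OF that(1)] that by (intro mod_poly_less) (auto simp: carrier_free degree_monom_eq)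
    ultimately show ?thesis
      using fun_cong[OF \<iota>_act[of "[:c:]" v], of i] that two_le_p by (simp add: mod_smult_left)
  qed
  have supp: "\<iota> v i = 0" if "v \<in> V" "i \<in> I - J" for v i
  proof -
    have "v \<in> fun_space.span S" using S that by blast
    then have "v \<in> V \<and> \<iota> v i = 0"
    proof (induction rule: fun_space.span_induct_alt)
      case base
      show ?case using V_simps(4) \<iota>_zero that by blast
    next
      case (step c x y)
      then have "x \<in> V" "\<iota> x i = 0" using S that by (auto simp: J_def)
      moreover have "y \<in> V" "\<iota> y i = 0" using step by auto
      ultimately have "\<iota> (c *f x + y) i = 0"
        using that by (subst \<iota>_add) (auto simp: V_simps \<iota>_scale)
      moreover have "c *f x + y \<in> V"
        using \<open>x \<in> V\<close> \<open>y \<in> V\<close> by (intro V_simps)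
      ultimately show ?case by blast
    qed
    then show ?thesis by simp
  qed
  show ?thesis
  proof (rule that[of "\<lambda>v. \<Sum>b\<in>J. cf v b *f w b"], goal_cases)
    case (1 v)
    then show ?case by (simp add: V_simps w_closed)
  next
    case (2 v v')
    have "cf (v + v') b = cf v b + cf v' b" if "b \<in> J" for b
      using 2 J that by (auto simp: cf_def \<iota>_add)
    then show ?case by (simp add: fun_space.scale_left_distrib sum.distrib)
  next
    case (3 c v)
    have "cf (c *f v) b = c * cf v b" if "b \<in> J" for b
      using 3 J that by (auto simp: cf_def \<iota>_scale)
    then show ?case by (simp add: fun_space.scale_sum_right)
  next
    case (4 v)
    have "v = (\<Sum>b\<in>J. act (\<iota> v b) (w b))"
      using expand[OF J \<iota>_closed[OF 4] supp[OF 4]] unfolding \<pi>\<iota>[OF 4] .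
    also have "\<dots> = (\<Sum>b\<in>J. \<Sum>j<p. coeff (\<iota> v b) j *f (N ^^ j) (w b))"
    proof (rule sum.cong[OF refl])
      fix b assume "b \<in> J"
      then have "degree (\<iota> v b) < p" using \<iota>_closed[OF 4] J by (auto simp: carrier_free)
      then show "act (\<iota> v b) (w b) = (\<Sum>j<p. coeff (\<iota> v b) j *f (N ^^ j) (w b))"
        by (rule act_less)
    qed
    also have "\<dots> = (\<Sum>j<p. \<Sum>b\<in>J. cf ((N ^^ (p - 1 - j)) v) b *f (N ^^ j) (w b))"
      using 4 J by (subst sum.swap) (auto intro!: sum.cong simp: coeff_\<iota>)
    also have "\<dots> = (\<Sum>j<p. (N ^^ j) (\<Sum>b\<in>J. cf ((N ^^ (p - 1 - j)) v) b *f w b))"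
      by (simp add: N_pow_sum N_pow_scale V_simps w_closed)
    finally show ?case .
  qed
qed

text \<open>
  On the kernel of \<open>N\<close> only the term \<open>N\<^sup>p\<^sup>-\<^sup>1 E\<close> of Higman's identity survives.
\<close>

lemma kernel_subset_image_of_projective:
  assumes "projective_module R (operator_module V N)" "v \<in> V" "N v = 0"
  shows "\<exists>w\<in>V. (N ^^ (p - 1)) w = v"
proof -
  obtain E where E: "\<And>v. v \<in> V \<Longrightarrow> E v \<in> V"
    "\<And>v w. v \<in> V \<Longrightarrow> w \<in> V \<Longrightarrow> E (v + w) = E v + E w"
    "\<And>c v. v \<in> V \<Longrightarrow> E (c *f v) = c *f E v"
    "\<And>v. v \<in> V \<Longrightarrow> v = (\<Sum>j<p. (N ^^ j) (E ((N ^^ (p - 1 - j)) v)))"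
    by (rule higman_of_projective[OF assms(1)]) (rule that)
  have E0: "E 0 = 0" using E(3)[OF V_simps(4), of 0] by simp
  have zero: "(N ^^ j) (E ((N ^^ (p - 1 - j)) v)) = 0" if "j < p - 1" for j
  proof -
    define k where "k = p - 2 - j"
    have "p - 1 - j = Suc k" using that by (simp add: k_def)
    then have "(N ^^ (p - 1 - j)) v = (N ^^ k) (N v)" by (simp add: funpow_swap1)
    then show ?thesis by (simp add: assms E0 N_pow_0)
  qed
  have "v = (\<Sum>j<Suc (p - 1). (N ^^ j) (E ((N ^^ (p - 1 - j)) v)))"
    using E(4)[OF assms(2)] two_le_p by simp
  also have "\<dots> = (\<Sum>j<p - 1. 0) + (N ^^ (p - 1)) (E ((N ^^ (p - 1 - (p - 1))) v))"
    unfolding sum.lessThan_Suc using zero by (intro arg_cong2[of _ _ _ _ "(+)"] sum.cong) auto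
  also have "\<dots> = (N ^^ (p - 1)) (E v)"
    by simp
  finally show ?thesis using E(1)[OF assms(2)] by (intro bexI[of _ "E v"]) auto
qed

text \<open>
  Preimages under \<open>N\<^sup>p\<^sup>-\<^sup>1\<close> of a basis of the kernel freely generate \<open>V\<close>.  They are independent
  because the lowest coefficient of a relation can be pushed into the kernel by a power of \<open>N\<close>, and
  they generate because a vector killed by \<open>N\<^sup>m\<^sup>+\<^sup>1\<close> can be corrected to one killed by \<open>N\<^sup>m\<close>.
\<close>

lemma projective_of_kernel_subset_image:
  assumes exact: "\<And>v. v \<in> V \<Longrightarrow> N v = 0 \<Longrightarrow> \<exists>w\<in>V. (N ^^ (p - 1)) w = v"
  shows "projective_module R (operator_module V N)"
proof -
  define K where "K = {v \<in> V. N v = 0}"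
  obtain B where B: "B \<subseteq> K" "fun_space.independent B" "K \<subseteq> fun_space.span B"
    using fun_space.maximal_independent_subset by blast
  obtain S where S: "finite S" "S \<subseteq> V" "V \<subseteq> fun_space.span S"
    using finitely_spanned by blast
  have finB: "finite B"
    using fun_space.independent_span_bound[OF S(1) B(2)] B S by (auto simp: K_def)
  have "\<forall>b\<in>B. \<exists>w\<in>V. (N ^^ (p - 1)) w = b"
    using exact B by (auto simp: K_def)
  then obtain w where w: "\<And>b. b \<in> B \<Longrightarrow> w b \<in> V" "\<And>b. b \<in> B \<Longrightarrow> (N ^^ (p - 1)) (w b) = b"
    by metis
  let ?F = "free_module B R"
  have carrier_F: "carrier ?F = B \<rightarrow>\<^sub>E {f. degree f < p}"
    using finB by (auto simp: carrier_free)
  define \<pi> where "\<pi> u = (\<Sum>b\<in>B. act (u b) (w b))" for u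
  have \<pi>_closed: "\<pi> u \<in> V" for u
    by (simp add: \<pi>_def V_simps act_closed w)
  have \<pi>_add: "\<pi> (u \<oplus>\<^bsub>?F\<^esub> u') = \<pi> u + \<pi> u'" for u u'
    by (simp add: \<pi>_def add_free act_add_left sum.distrib)
  have \<pi>_act: "\<pi> (r \<odot>\<^bsub>?F\<^esub> u) = act r (\<pi> u)" for r u
    by (simp add: \<pi>_def smult_free act_mod w act_mult act_sum_right act_closed)
  have kernel: "u b = 0" if u: "u \<in> carrier ?F" "\<pi> u = 0" and b: "b \<in> B" for u b
  proof -
    have deg: "degree (u b) < p" if "b \<in> B" for b
      using u that by (auto simp: carrier_F)
    have "\<forall>b\<in>B. coeff (u b) j = 0" if "j < p" for j
      using that
    proof (induction j rule: less_induct)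
      case (less j)
      have "coeff (u b) i *f (N ^^ (p - 1 - j + i)) (w b) = (if i = j then coeff (u b) j *f b else 0)"
        if "b \<in> B" "i < p" for b i
      proof -
        consider "i < j" | "i = j" | "i > j" by linarith
        then show ?thesis
        proof cases
          case 1
          then show ?thesis using less that by simp
        next
          case 2
          then show ?thesis using less w that by simp
        next
          case 3
          then show ?thesis using N_pow_ge[of "w b" "p - 1 - j + i"] less w that by simp
        qed
      qed
      note summand = this
      have "0 = (N ^^ (p - 1 - j)) (\<pi> u)"
        by (simp add: u N_pow_0)
      also have "\<dots> = (\<Sum>b\<in>B. \<Sum>i<p. coeff (u b) i *f (N ^^ (p - 1 - j + i)) (w b))"
        by (simp add: \<pi>_def act_less[OF deg] N_pow_sum N_pow_scale V_simps w N_pow_closed funpow_add)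
      also have "\<dots> = (\<Sum>b\<in>B. coeff (u b) j *f b)"
      proof (rule sum.cong[OF refl])
        fix b assume "b \<in> B"
        then have "(\<Sum>i<p. coeff (u b) i *f (N ^^ (p - 1 - j + i)) (w b))
            = (\<Sum>i<p. if i = j then coeff (u b) j *f b else 0)"
          using summand by (intro sum.cong refl) blast
        then show "(\<Sum>i<p. coeff (u b) i *f (N ^^ (p - 1 - j + i)) (w b)) = coeff (u b) j *f b"
          using less by simp
      qed
      finally have "(\<Sum>b\<in>B. coeff (u b) j *f b) = 0" by simp
      then show ?case
        using fun_space.independentD[OF B(2) finB subset_refl, of "\<lambda>b. coeff (u b) j"] by blast
    qed
    then show ?thesis
      using deg b by (metis leading_coeff_0_iff)
  qed
  have F_diff: "(\<lambda>i\<in>B. u i - u' i) \<in> carrier ?F" if "u \<in> carrier ?F" "u' \<in> carrier ?F" for u u'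
    using that by (auto simp: carrier_F intro!: degree_diff_less)
  have inj: "inj_on \<pi> (carrier ?F)"
  proof (rule inj_onI)
    fix u u' assume u: "u \<in> carrier ?F" "u' \<in> carrier ?F" "\<pi> u = \<pi> u'"
    have "u = (\<lambda>i\<in>B. u i - u' i) \<oplus>\<^bsub>?F\<^esub> u'"
      using u by (auto simp: add_free carrier_F fun_eq_iff PiE_iff extensional_def)
    then have "\<pi> (\<lambda>i\<in>B. u i - u' i) = 0"
      using \<pi>_add[of "\<lambda>i\<in>B. u i - u' i" u'] u by simp
    then have "u i = u' i" if "i \<in> B" for i
      using kernel[OF F_diff[OF u(1,2)] _ that] that by simp
    then show "u = u'"
      using u by (auto simp: carrier_F intro: PiE_ext)
  qed
  have F_add: "u \<oplus>\<^bsub>?F\<^esub> u' \<in> carrier ?F" if "u \<in> carrier ?F" "u' \<in> carrier ?F" for u u'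
    using that by (auto simp: carrier_F add_free intro!: degree_add_less)
  have F_smult: "r \<odot>\<^bsub>?F\<^esub> u \<in> carrier ?F" for r u
    by (auto simp: carrier_F smult_free degree_mod_monom)
  have surj: "v \<in> \<pi> ` carrier ?F" if "v \<in> V" "(N ^^ m) v = 0" "m \<le> p" for v m
    using that
  proof (induction m arbitrary: v)
    case 0
    have "(\<lambda>i\<in>B. 0) \<in> carrier ?F" using two_le_p by (auto simp: carrier_F)
    moreover have "\<pi> (\<lambda>i\<in>B. 0) = 0" by (simp add: \<pi>_def act_0_left)
    ultimately show ?case using 0 by (auto intro!: rev_image_eqI[of "\<lambda>i\<in>B. 0"])
  next
    case (Suc m)
    have "(N ^^ m) v \<in> fun_space.span B"
    proof -
      have "(N ^^ m) v \<in> K"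
        unfolding K_def using Suc.prems(2) N_pow_closed[OF Suc.prems(1)] by (simp add: zero_fun_def)
      then show ?thesis using B(3) by blast
    qed
    then obtain c where c: "(N ^^ m) v = (\<Sum>b\<in>B. c b *f b)"
      using fun_space.span_finite[OF finB] by auto
    define u where "u = (\<lambda>b\<in>B. monom (c b) (p - 1 - m))"
    have u: "u \<in> carrier ?F"
      using Suc.prems by (auto simp: carrier_F u_def intro!: le_less_trans[OF degree_monom_le])
    have "(N ^^ m) (\<pi> u) = (\<Sum>b\<in>B. (N ^^ m) (c b *f (N ^^ (p - 1 - m)) (w b)))"
    proof -
      have "act (monom (c b) k) x = c b *f (N ^^ k) x" for b k x
        by (subst act_bound[OF degree_monom_le])
          (simp add: coeff_monom if_distrib[of "\<lambda>c. c *f _"] cong: if_cong)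
      then show ?thesis
        by (simp add: \<pi>_def u_def N_pow_sum V_simps w N_pow_closed)
    qed
    also have "\<dots> = (\<Sum>b\<in>B. c b *f b)"
    proof (rule sum.cong[OF refl])
      fix b assume b: "b \<in> B"
      have "(N ^^ m) ((N ^^ (p - 1 - m)) (w b)) = (N ^^ (m + (p - 1 - m))) (w b)"
        by (simp add: funpow_add)
      also have "\<dots> = b" using w(2)[OF b] Suc.prems by simp
      finally show "(N ^^ m) (c b *f (N ^^ (p - 1 - m)) (w b)) = c b *f b"
        using b by (simp add: N_pow_scale N_pow_closed w)
    qed
    finally have "(N ^^ m) (v - \<pi> u) = 0"
      using c Suc.prems by (simp add: N_pow_diff \<pi>_closed)
    moreover have "v - \<pi> u \<in> V"
      using Suc.prems(1) \<pi>_closed by (rule V_simps(2))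
    moreover have "m \<le> p" using Suc.prems(3) by simp
    ultimately obtain u' where "u' \<in> carrier ?F" "v - \<pi> u = \<pi> u'"
      using Suc.IH[of "v - \<pi> u"] by blast
    then have "v = \<pi> (u' \<oplus>\<^bsub>?F\<^esub> u)" "u' \<oplus>\<^bsub>?F\<^esub> u \<in> carrier ?F"
      using \<pi>_add u F_add by (auto simp: algebra_simps)
    then show ?case by blast
  qed
  have image: "\<pi> ` carrier ?F = V"
    using surj[of _ p] \<pi>_closed by (auto simp: N_nilpotent)
  define \<iota> where "\<iota> = inv_into (carrier ?F) \<pi>"
  have \<iota>: "\<iota> v \<in> carrier ?F" "\<pi> (\<iota> v) = v" if "v \<in> V" for v
    using that image inv_into_into[of v \<pi> "carrier ?F"] f_inv_into_f[of v \<pi> "carrier ?F"]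
    by (auto simp: \<iota>_def)
  have \<iota>_eq: "\<iota> v = u" if "u \<in> carrier ?F" "\<pi> u = v" for u v
    using that inj by (auto simp: \<iota>_def)
  have "\<iota> \<in> module_hom_set R (operator_module V N) ?F"
    by (auto simp: module_hom_set_def carrier_operator_module add_operator_module
        smult_operator_module V_simps \<iota> \<pi>_add \<pi>_act F_add F_smult intro!: \<iota>_eq)
  moreover have "\<pi> \<in> module_hom_set R ?F (operator_module V N)"
    by (auto simp: module_hom_set_def carrier_operator_module add_operator_module
        smult_operator_module \<pi>_closed \<pi>_add \<pi>_act)
  ultimately show ?thesis
    unfolding projective_module_def carrier_operator_module using \<iota>(2) by blast
qed

end

section \<open>Vector fields on a trapezoid of monomials\<close>

text \<open>
  The vector field \<open>a \<partial>\<^sub>x + (b x + c) \<partial>\<^sub>y\<close> on polynomials in \<open>x\<close> and \<open>y\<close>.  A polynomial is given by its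
  coefficients: the value at \<open>(i, n)\<close> is the coefficient of \<open>x\<^sup>i y\<^sup>n\<close>.
\<close>

definition plane_field :: "'k::field \<Rightarrow> 'k \<Rightarrow> 'k \<Rightarrow> (nat \<times> nat \<Rightarrow> 'k) \<Rightarrow> nat \<times> nat \<Rightarrow> 'k" where
  "plane_field a b c v = (\<lambda>(i, n). a * of_nat (Suc i) * v (Suc i, n)
     + (if i = 0 then 0 else b * of_nat (Suc n) * v (i - 1, Suc n))
     + c * of_nat (Suc n) * v (i, Suc n))"

text \<open>
  The strict bound on \<open>n\<close> makes \<open>r\<close> the number of rows, so that \<open>r = 0\<close> gives the zero module, where
  the inductions over rows start.
\<close>

definition trapezoid :: "nat \<Rightarrow> nat \<Rightarrow> (nat \<times> nat) set" where
  "trapezoid N r = {(i, n). n < r \<and> i + n \<le> N}"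

definition trapezoid_polys :: "nat \<Rightarrow> nat \<Rightarrow> (nat \<times> nat \<Rightarrow> 'k::field) set" where
  "trapezoid_polys N r = {v. \<forall>t. t \<notin> trapezoid N r \<longrightarrow> v t = 0}"

definition strip_polys :: "nat \<Rightarrow> (nat \<times> nat \<Rightarrow> 'k::field) set" where
  "strip_polys r = (\<Union>N. trapezoid_polys N r)"

definition basis_monomial :: "'b \<Rightarrow> 'b \<Rightarrow> 'k::field" where
  "basis_monomial t = (\<lambda>s. if s = t then 1 else 0)"

lemma finite_trapezoid: "finite (trapezoid N r)"
  by (rule finite_subset[of _ "{..N} \<times> {..N}"]) (auto simp: trapezoid_def)

lemma trapezoid_polysD: "v \<in> trapezoid_polys N r \<Longrightarrow> v (i, n) \<noteq> 0 \<Longrightarrow> n < r \<and> i + n \<le> N"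
  by (auto simp: trapezoid_polys_def trapezoid_def)

lemma trapezoid_polysI: "(\<And>i n. v (i, n) \<noteq> 0 \<Longrightarrow> n < r \<and> i + n \<le> N) \<Longrightarrow> v \<in> trapezoid_polys N r"
  by (fastforce simp: trapezoid_polys_def trapezoid_def)

lemma trapezoid_polys_zero: "v \<in> trapezoid_polys N r \<Longrightarrow> r \<le> n \<or> N < i + n \<Longrightarrow> v (i, n) = 0"
  by (auto simp: trapezoid_polys_def trapezoid_def)

lemma subspace_trapezoid_polys: "fun_space.subspace (trapezoid_polys N r)"
  by (auto simp: fun_space.subspace_def trapezoid_polys_def)

lemmas trapezoid_polys_closed = fun_space.subspace_add[OF subspace_trapezoid_polys]
  fun_space.subspace_diff[OF subspace_trapezoid_polys]
  fun_space.subspace_scale[OF subspace_trapezoid_polys]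
  fun_space.subspace_0[OF subspace_trapezoid_polys]
  fun_space.subspace_sum[OF subspace_trapezoid_polys]

lemma trapezoid_polys_mono: "N \<le> N' \<Longrightarrow> r \<le> r' \<Longrightarrow> trapezoid_polys N r \<subseteq> trapezoid_polys N' r'"
  by (force simp: trapezoid_polys_def trapezoid_def)

lemma unit_poly_in: "t \<in> trapezoid N r \<Longrightarrow> basis_monomial t \<in> trapezoid_polys N r"
  by (auto simp: trapezoid_polys_def basis_monomial_def)

lemma expand_unit_polys:
  assumes "v \<in> trapezoid_polys N r"
  shows "v = (\<Sum>t\<in>trapezoid N r. v t *f basis_monomial t)"
proof
  fix s
  have "(\<Sum>t\<in>trapezoid N r. v t *f basis_monomial t) s = (\<Sum>t\<in>trapezoid N r. if s = t then v t else 0)"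
    by (auto simp: sum_fun_apply basis_monomial_def intro!: sum.cong)
  also have "\<dots> = v s"
    unfolding sum.delta'[OF finite_trapezoid] using assms by (cases s) (auto simp: trapezoid_polys_def)
  finally show "v s = (\<Sum>t\<in>trapezoid N r. v t *f basis_monomial t) s" by simp
qed

locale plane_vector_field =
  fixes p :: nat and a b c :: "'k::field"
  assumes char: "CHAR('k) = p" and p3: "p \<ge> 3"
begin

lemma prime_p: "prime p"
  using prime_CHAR_semidom[where ?'a = 'k] char p3 by simp

lemma of_nat_zero_iff: "(of_nat n :: 'k) = 0 \<longleftrightarrow> p dvd n"
  using of_nat_eq_0_iff_char_dvd[where ?'a = 'k] char by simp

text \<open>
  The integers \<open>i + 1, \<dots>, i + p - 1\<close> contain no multiple of \<open>p\<close> exactly if \<open>p\<close> divides \<open>i\<close>.  This coefficient governs \<open>D\<^sup>p\<^sup>-\<^sup>1\<close> on rows and on diagonals.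
\<close>

lemma pochhammer_nonzero_iff: "pochhammer (of_nat (Suc i) :: 'k) (p - 1) \<noteq> 0 \<longleftrightarrow> p dvd i"
proof -
  have "pochhammer (of_nat (Suc i) :: 'k) (p - 1) = (\<Prod>j = 0..<p - 1. of_nat (Suc i + j))"
    by (simp add: pochhammer_prod algebra_simps)
  then have "pochhammer (of_nat (Suc i) :: 'k) (p - 1) = 0 \<longleftrightarrow> (\<exists>j<p - 1. p dvd Suc i + j)"
    by (auto simp: prod_zero_iff of_nat_zero_iff simp del: of_nat_add of_nat_Suc)
  also have "\<dots> \<longleftrightarrow> \<not> p dvd i"
  proof
    assume "\<exists>j<p - 1. p dvd Suc i + j"
    then obtain j where j: "j < p - 1" "p dvd i + Suc j" by auto
    show "\<not> p dvd i"
    proof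
      assume "p dvd i"
      then have "p dvd Suc j" using j(2) dvd_add_right_iff[of p i "Suc j"] by simp
      then show False using j(1) by (auto dest!: dvd_imp_le)
    qed
  next
    assume "\<not> p dvd i"
    then have mod: "0 < i mod p" "i mod p < p" using p3 by (auto simp: dvd_eq_mod_eq_0)
    have "Suc i + (p - i mod p - 1) = p * (i div p) + p"
      using mult_div_mod_eq[of p i] mod by linarith
    then have "p dvd Suc i + (p - i mod p - 1)" by (simp only: dvd_add_triv_right_iff dvd_triv_left)
    moreover have "p - i mod p - 1 < p - 1" using mod by linarith
    ultimately show "\<exists>j<p - 1. p dvd Suc i + j" by blast
  qed
  finally show ?thesis by blast
qed

abbreviation "D \<equiv> plane_field a b c"

lemma D_add: "D (v + w) = D v + D w"
  by (auto simp: plane_field_def fun_eq_iff algebra_simps)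

lemma D_diff: "D (v - w) = D v - D w"
  by (auto simp: plane_field_def fun_eq_iff algebra_simps)

lemma D_scale: "D (x *f v) = x *f D v"
  by (auto simp: plane_field_def fun_eq_iff algebra_simps)

lemma D_0: "D 0 = 0"
  by (auto simp: plane_field_def fun_eq_iff)

lemma D_pow_add: "(D ^^ j) (v + w) = (D ^^ j) v + (D ^^ j) w"
  by (induction j) (simp_all only: D_add funpow.simps id_apply comp_apply)

lemma D_pow_diff: "(D ^^ j) (v - w) = (D ^^ j) v - (D ^^ j) w"
  by (induction j) (simp_all only: D_diff funpow.simps id_apply comp_apply)

lemma D_pow_scale: "(D ^^ j) (x *f v) = x *f (D ^^ j) v"
  by (induction j) (simp_all only: D_scale funpow.simps id_apply comp_apply)

lemma D_pow_0: "(D ^^ j) 0 = 0"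
  by (induction j) (simp_all only: D_0 funpow.simps id_apply comp_apply)

lemma D_pow_sum: "(D ^^ j) (\<Sum>s\<in>S. f s) = (\<Sum>s\<in>S. (D ^^ j) (f s))"
  by (induction S rule: infinite_finite_induct) 
    (simp_all only: D_pow_0 D_pow_add sum.infinite sum.empty sum.insert simp_thms)

lemma D_closed: "v \<in> trapezoid_polys N r \<Longrightarrow> D v \<in> trapezoid_polys N r"
proof (rule trapezoid_polysI)
  fix i n assume v: "v \<in> trapezoid_polys N r" and "D v (i, n) \<noteq> 0"
  then have "v (Suc i, n) \<noteq> 0 \<or> i \<noteq> 0 \<and> v (i - 1, Suc n) \<noteq> 0 \<or> v (i, Suc n) \<noteq> 0"
    by (auto simp: plane_field_def split: if_splits)
  then show "n < r \<and> i + n \<le> N"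
    using trapezoid_polysD[OF v] by fastforce
qed

lemma D_pow_closed: "v \<in> trapezoid_polys N r \<Longrightarrow> (D ^^ j) v \<in> trapezoid_polys N r"
  by (induction j) (auto intro: D_closed)

definition mult_x :: "(nat \<times> nat \<Rightarrow> 'k) \<Rightarrow> nat \<times> nat \<Rightarrow> 'k" where
  "mult_x v = (\<lambda>(i, n). if i = 0 then 0 else v (i - 1, n))"

definition mult_y :: "(nat \<times> nat \<Rightarrow> 'k) \<Rightarrow> nat \<times> nat \<Rightarrow> 'k" where
  "mult_y v = (\<lambda>(i, n). if n = 0 then 0 else v (i, n - 1))"

lemma D_mult_x: "D (mult_x v) = mult_x (D v) + a *f v"
proof
  fix t :: "nat \<times> nat"
  obtain i n where t: "t = (i, n)" by (cases t)
  show "D (mult_x v) t = (mult_x (D v) + a *f v) t"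
    by (cases i; cases "i - 1") (auto simp: plane_field_def mult_x_def t algebra_simps)
qed

lemma D_mult_y: "D (mult_y v) = mult_y (D v) + (b *f mult_x v + c *f v)"
proof
  fix t :: "nat \<times> nat"
  obtain i n where t: "t = (i, n)" by (cases t)
  show "D (mult_y v) t = (mult_y (D v) + (b *f mult_x v + c *f v)) t"
    by (cases i; cases n) (auto simp: plane_field_def mult_x_def mult_y_def t algebra_simps)
qed

lemma D_pow_mult_x: "(D ^^ Suc j) (mult_x v) = mult_x ((D ^^ Suc j) v) + (of_nat (Suc j) * a) *f (D ^^ j) v"
proof (induction j)
  case (Suc j)
  have "(D ^^ Suc (Suc j)) (mult_x v) = D ((D ^^ Suc j) (mult_x v))" by simp
  also have "\<dots> = mult_x ((D ^^ Suc (Suc j)) v) + (of_nat (Suc (Suc j)) * a) *f (D ^^ Suc j) v"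
    unfolding Suc D_add D_scale D_mult_x by (simp add: fun_eq_iff algebra_simps)
  finally show ?case .
qed (simp add: D_mult_x)

lemma D_pow_mult_y:
  "(D ^^ Suc (Suc j)) (mult_y v) = mult_y ((D ^^ Suc (Suc j)) v)
     + of_nat (Suc (Suc j)) *f (b *f mult_x ((D ^^ Suc j) v) + c *f (D ^^ Suc j) v)
     + (of_nat (Suc (Suc j) choose 2) * (a * b)) *f (D ^^ j) v"
proof (induction j)
  case 0
  show ?case
    unfolding funpow.simps comp_apply id_apply D_mult_y D_mult_x D_add D_scale
    by (simp add: fun_eq_iff algebra_simps numeral_2_eq_2)
next
  case (Suc j)
  have "(D ^^ Suc (Suc (Suc j))) (mult_y v) = D ((D ^^ Suc (Suc j)) (mult_y v))" by simp
  also have "\<dots> = mult_y ((D ^^ Suc (Suc (Suc j))) v)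
     + of_nat (Suc (Suc (Suc j))) *f (b *f mult_x ((D ^^ Suc (Suc j)) v) + c *f (D ^^ Suc (Suc j)) v)
     + (of_nat (Suc (Suc (Suc j)) choose 2) * (a * b)) *f (D ^^ Suc j) v"
  proof -
    have choose: "Suc (Suc (Suc j)) choose 2 = Suc (Suc j) + (Suc (Suc j) choose 2)"
      by (simp add: numeral_2_eq_2)
    show ?thesis
      unfolding Suc D_add D_scale D_mult_x D_mult_y choose
      by (simp add: fun_eq_iff algebra_simps)
  qed
  finally show ?case .
qed

text \<open>
  The commutators of \<open>D\<^sup>p\<close> with the multiplications by \<open>x\<close> and \<open>y\<close> have the coefficients \<open>p\<close> and
  \<open>p (p - 1) / 2\<close>, which vanish for odd \<open>p\<close>.  So \<open>D\<^sup>p\<close> is determined by its value at \<open>1\<close>.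
\<close>

lemma D_nilpotent_basis_monomial: "(D ^^ p) (basis_monomial (i, n)) = 0"
proof (induction n)
  case 0
  show ?case
  proof (induction i)
    case 0
    obtain q where q: "p = Suc q" using p3 by (cases p) auto
    have "D (basis_monomial (0, 0)) = 0"
      by (auto simp: plane_field_def basis_monomial_def fun_eq_iff)
    then have "(D ^^ Suc q) (basis_monomial (0, 0)) = 0"
      unfolding funpow_Suc_right comp_apply by (simp only: D_pow_0)
    then show ?case by (simp only: q)
  next
    case (Suc i)
    obtain q where q: "p = Suc q" using p3 by (cases p) auto
    have unit: "basis_monomial (Suc i, 0) = mult_x (basis_monomial (i, 0) :: _ \<Rightarrow> 'k)"
      by (auto simp: basis_monomial_def mult_x_def fun_eq_iff)
    have "mult_x 0 = 0" by (auto simp: mult_x_def fun_eq_iff)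
    moreover have "(of_nat p :: 'k) = 0" by (simp add: of_nat_zero_iff)
    ultimately show ?case
      using D_pow_mult_x[of q "basis_monomial (i, 0)"] Suc.IH
      unfolding q[symmetric] unit by (simp only: mult_zero_left fun_space.scale_zero_left add_0)
  qed
next
  case (Suc n)
  obtain q where q: "p = Suc (Suc q)" using p3 by (cases p; cases "p - 1") auto
  have unit: "basis_monomial (i, Suc n) = mult_y (basis_monomial (i, n) :: _ \<Rightarrow> 'k)"
    by (auto simp: basis_monomial_def mult_y_def fun_eq_iff)
  have "mult_y 0 = 0" by (auto simp: mult_y_def fun_eq_iff)
  moreover have "(of_nat p :: 'k) = 0" by (simp add: of_nat_zero_iff)
  moreover have "(of_nat (p choose 2) :: 'k) = 0"
    using dvd_choose_prime[OF _ _ _ prime_p, of 2] p3 by (simp add: of_nat_zero_iff)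
  ultimately show ?case
    using D_pow_mult_y[of q "basis_monomial (i, n)"] Suc.IH
    unfolding q[symmetric] unit by (simp only: mult_zero_left fun_space.scale_zero_left add_0)
qed

lemma D_nilpotent: "v \<in> trapezoid_polys N r \<Longrightarrow> (D ^^ p) v = 0"
proof -
  assume "v \<in> trapezoid_polys N r"
  then have "(D ^^ p) v = (\<Sum>t\<in>trapezoid N r. v t *f (D ^^ p) (basis_monomial t))"
    using expand_unit_polys D_pow_sum D_pow_scale by (metis (no_types, lifting) sum.cong)
  also have "\<dots> = 0"
    using D_nilpotent_basis_monomial by (auto intro!: sum.neutral)
  finally show ?thesis .
qed

end

section \<open>Exactness along rows and diagonals\<close>

context plane_vector_field
begin

text \<open>
  For \<open>S \<subseteq> V\<close>, this and the next definition say that the two homology groups \<open>ker D / im D\<^sup>p\<^sup>-\<^sup>1\<close> and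
  \<open>ker D\<^sup>p\<^sup>-\<^sup>1 / im D\<close> of \<open>V / S\<close> vanish.  Both are formulated without quotient spaces.
\<close>

definition kernel_exact :: "(nat \<times> nat \<Rightarrow> 'k) set \<Rightarrow> (nat \<times> nat \<Rightarrow> 'k) set \<Rightarrow> bool" where
  "kernel_exact V S \<longleftrightarrow> (\<forall>v\<in>V. D v \<in> S \<longrightarrow> (\<exists>w\<in>V. v - (D ^^ (p - 1)) w \<in> S))"

definition power_kernel_exact :: "(nat \<times> nat \<Rightarrow> 'k) set \<Rightarrow> (nat \<times> nat \<Rightarrow> 'k) set \<Rightarrow> bool" where
  "power_kernel_exact V S \<longleftrightarrow> (\<forall>v\<in>V. (D ^^ (p - 1)) v \<in> S \<longrightarrow> (\<exists>w\<in>V. v - D w \<in> S))"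

lemma D_pow_D: "D ((D ^^ (p - 1)) v) = (D ^^ p) v" "(D ^^ (p - 1)) (D v) = (D ^^ p) v"
proof -
  obtain q where "p = Suc q" using p3 by (cases p) auto
  then show "D ((D ^^ (p - 1)) v) = (D ^^ p) v" by simp
  then show "(D ^^ (p - 1)) (D v) = (D ^^ p) v" by (simp add: funpow_swap1)
qed

lemma D_nilpotent_strip: "v \<in> strip_polys r \<Longrightarrow> (D ^^ p) v = 0"
  by (auto simp: strip_polys_def D_nilpotent)

lemma trapezoid_subset_strip: "r \<le> r' \<Longrightarrow> trapezoid_polys N r \<subseteq> strip_polys r'"
  using trapezoid_polys_mono[of N N r r'] by (auto simp: strip_polys_def)

lemma strip_polys_closed_add: "v \<in> strip_polys r \<Longrightarrow> w \<in> strip_polys r \<Longrightarrow> v + w \<in> strip_polys r"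
proof -
  assume "v \<in> strip_polys r" "w \<in> strip_polys r"
  then obtain N M where "v \<in> trapezoid_polys N r" "w \<in> trapezoid_polys M r"
    by (auto simp: strip_polys_def)
  then have "v \<in> trapezoid_polys (max N M) r" "w \<in> trapezoid_polys (max N M) r"
    using trapezoid_polys_mono[of _ "max N M" r r] by (meson max.cobounded1 max.cobounded2 order_refl subsetD)+
  then show ?thesis unfolding strip_polys_def using trapezoid_polys_closed(1) by blast
qed

lemma kernel_exact_trans:
  assumes V: "\<And>v w. v \<in> V \<Longrightarrow> w \<in> V \<Longrightarrow> v + w \<in> V" "V \<subseteq> strip_polys r"
    and "R \<subseteq> S" "S \<subseteq> V" "kernel_exact V S" "kernel_exact S R"
  shows "kernel_exact V R"
  unfolding kernel_exact_def
proof (intro ballI impI)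
  fix v assume v: "v \<in> V" "D v \<in> R"
  then obtain w where w: "w \<in> V" "v - (D ^^ (p - 1)) w \<in> S"
    using assms unfolding kernel_exact_def by blast
  have "D (v - (D ^^ (p - 1)) w) = D v"
    unfolding D_diff D_pow_D D_nilpotent_strip[OF subsetD[OF V(2) w(1)]] by (rule diff_zero)
  then obtain w' where w': "w' \<in> S" "v - (D ^^ (p - 1)) w - (D ^^ (p - 1)) w' \<in> R"
    using assms(6) w v unfolding kernel_exact_def by metis
  then have "v - (D ^^ (p - 1)) (w + w') \<in> R"
    by (simp only: D_pow_add diff_diff_add)
  then show "\<exists>w\<in>V. v - (D ^^ (p - 1)) w \<in> R"
    using w w' V assms(4) by blast
qed

text \<open>
  The part of the long exact homology sequence that passes exactness from \<open>V\<close> and \<open>V / S\<close> to \<open>S\<close>.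
  It shifts degree, which is why the second homology group of \<open>V / S\<close> enters.
\<close>

lemma kernel_exact_subspace:
  assumes "V \<subseteq> strip_polys r" "S \<subseteq> V" "kernel_exact V R" "power_kernel_exact V S"
    and R: "R \<subseteq> S" and S: "fun_space.subspace S"
  shows "kernel_exact S R"
  unfolding kernel_exact_def
proof (intro ballI impI)
  fix s assume s: "s \<in> S" "D s \<in> R"
  then obtain v where v: "v \<in> V" "s - (D ^^ (p - 1)) v \<in> R"
    using assms unfolding kernel_exact_def by blast
  have "s - (s - (D ^^ (p - 1)) v) \<in> S"
    by (rule fun_space.subspace_diff[OF S s(1) subsetD[OF R v(2)]])
  then have "(D ^^ (p - 1)) v \<in> S" by (simp only: diff_diff_eq2 add_diff_cancel_left')
  then obtain u where u: "u \<in> V" "v - D u \<in> S"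
    using assms v unfolding power_kernel_exact_def by blast
  have "(D ^^ (p - 1)) (v - D u) = (D ^^ (p - 1)) v"
    unfolding D_pow_diff D_pow_D D_nilpotent_strip[OF subsetD[OF assms(1) u(1)]] by (rule diff_zero)
  then show "\<exists>w\<in>S. s - (D ^^ (p - 1)) w \<in> R"
    using u v by metis
qed

lemma D_pow_rows: "(\<And>i n. n > r \<Longrightarrow> v (i, n) = 0) \<Longrightarrow> n > r \<Longrightarrow> (D ^^ j) v (i, n) = 0"
  by (induction j arbitrary: i n) (auto simp: plane_field_def)

text \<open>
  Modulo lower rows, \<open>D\<close> acts on a row as \<open>a \<partial>\<^sub>x\<close>.
\<close>

lemma D_pow_top_row:
  assumes "\<And>i n. n > r \<Longrightarrow> v (i, n) = 0"
  shows "(D ^^ j) v (i, r) = a ^ j * pochhammer (of_nat (Suc i)) j * v (i + j, r)"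
proof (induction j arbitrary: i)
  case (Suc j)
  have "(D ^^ Suc j) v (i, r) = a * of_nat (Suc i) * (D ^^ j) v (Suc i, r)"
    using D_pow_rows[of r v] assms by (simp add: plane_field_def del: of_nat_Suc)
  then show ?case by (simp add: Suc pochhammer_rec algebra_simps)
qed simp

text \<open>
  Modulo lower total degree, \<open>D\<close> acts on a diagonal as \<open>b x \<partial>\<^sub>y\<close>.  For \<open>j > i\<close> the truncated
  difference \<open>i - j = 0\<close> does no harm: the point \<open>(0, n + j)\<close> lies above the diagonal.
\<close>

lemma D_pow_top_diagonal:
  assumes v: "v \<in> trapezoid_polys N r" and "i + n = N"
  shows "(D ^^ j) v (i, n) = b ^ j * pochhammer (of_nat (Suc n)) j * v (i - j, n + j)"
  using assms(2)
proof (induction j arbitrary: i n)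
  case (Suc j)
  have "(D ^^ Suc j) v (i, n) = (if i = 0 then 0 else b * of_nat (Suc n) * (D ^^ j) v (i - 1, Suc n))"
    using Suc.prems trapezoid_polys_zero[OF D_pow_closed[OF v]]
    by (simp add: plane_field_def del: of_nat_Suc)
  also have "\<dots> = b ^ Suc j * pochhammer (of_nat (Suc n)) (Suc j) * v (i - Suc j, n + Suc j)"
  proof (cases i)
    case 0
    then show ?thesis using Suc.prems trapezoid_polys_zero[OF v] by simp
  next
    case (Suc i')
    then show ?thesis using Suc.IH[of i' "Suc n"] Suc.prems
      by (simp add: pochhammer_rec algebra_simps)
  qed
  finally show ?case .
qed simp

text \<open>
  In the kernel of \<open>\<partial>\<^sub>x\<close> only the powers \<open>x\<^sup>i\<close> with \<open>p\<close> dividing \<open>i\<close> occur, and \<open>x\<^sup>i\<close> is a multiple of the image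
  of \<open>x\<^sup>i\<^sup>+\<^sup>p\<^sup>-\<^sup>1\<close> under \<open>\<partial>\<^sub>x\<^sup>p\<^sup>-\<^sup>1\<close>.  The bound \<open>M\<close> leaves room for these preimages: it is \<open>N\<close> itself
  when the row has a length divisible by \<open>p\<close>, and larger in the strip.
\<close>

lemma row_kernel_lift:
  assumes a: "a \<noteq> 0" and v: "v \<in> trapezoid_polys N (Suc r)" and Dv: "\<And>i. D v (i, r) = 0"
    and M: "N \<le> M" "\<And>i. p dvd i \<Longrightarrow> i + r \<le> N \<Longrightarrow> i + (p - 1) + r \<le> M"
  shows "\<exists>w\<in>trapezoid_polys M (Suc r). v - (D ^^ (p - 1)) w \<in> trapezoid_polys M r"
proof -
  have zero: "v (i, r) = 0" if "\<not> p dvd i" for i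
  proof -
    obtain i' where i: "i = Suc i'" using \<open>\<not> p dvd i\<close> by (cases i) auto
    have "D v (i', r) = a * of_nat i * v (i, r)"
      using trapezoid_polys_zero[OF v] by (simp add: plane_field_def i)
    then show ?thesis using Dv a that by (simp add: of_nat_zero_iff)
  qed
  \<comment> \<open>Termwise inverse of \<open>(a \<partial>\<^sub>x)\<^sup>p\<^sup>-\<^sup>1\<close>; the division by zero for \<open>p\<close> not dividing
    \<open>i - (p - 1)\<close> is harmless since \<open>v\<close> vanishes there.\<close>
  define w where "w = (\<lambda>(i, n). if n = r \<and> p - 1 \<le> i
    then v (i - (p - 1), r) / (a ^ (p - 1) * pochhammer (of_nat (Suc (i - (p - 1)))) (p - 1)) else 0)"
  have w: "w \<in> trapezoid_polys M (Suc r)"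
  proof (rule trapezoid_polysI)
    fix i n assume "w (i, n) \<noteq> 0"
    then have n: "n = r" "p - 1 \<le> i" and "v (i - (p - 1), r) \<noteq> 0"
      by (auto simp: w_def split: if_splits)
    then show "n < Suc r \<and> i + n \<le> M"
      using zero[of "i - (p - 1)"] trapezoid_polysD[OF v, of "i - (p - 1)" r] M(2)[of "i - (p - 1)"] by auto
  qed
  have row: "(D ^^ (p - 1)) w (i, r) = v (i, r)" for i
  proof -
    have "(D ^^ (p - 1)) w (i, r) = a ^ (p - 1) * pochhammer (of_nat (Suc i)) (p - 1) * w (i + (p - 1), r)"
      by (rule D_pow_top_row) (simp add: w_def)
    then show ?thesis
      using zero[of i] a pochhammer_nonzero_iff[of i]
      by (cases "p dvd i") (simp_all add: w_def del: One_nat_def of_nat_Suc)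
  qed
  have "v - (D ^^ (p - 1)) w \<in> trapezoid_polys M (Suc r)"
    using D_pow_closed[OF w] v trapezoid_polys_mono[OF M(1), of "Suc r" "Suc r"]
    by (intro trapezoid_polys_closed) auto
  then have "v - (D ^^ (p - 1)) w \<in> trapezoid_polys M r"
    using row by (intro trapezoid_polysI) (metis diff_self less_SucE minus_apply trapezoid_polysD)
  then show ?thesis using w by blast
qed

lemma row_kernel_exact:
  assumes "a \<noteq> 0" "p dvd N + 1 - r"
  shows "kernel_exact (trapezoid_polys N (Suc r)) (trapezoid_polys N r)"
  unfolding kernel_exact_def
proof (intro ballI impI)
  fix v assume v: "v \<in> trapezoid_polys N (Suc r)" "D v \<in> trapezoid_polys N r"
  have "i + (p - 1) + r \<le> N" if "p dvd i" "i + r \<le> N" for i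
  proof -
    have "p dvd N + 1 - r - i" using dvd_diff_nat[OF assms(2) that(1)] .
    then have "p \<le> N + 1 - r - i" using that by (intro dvd_imp_le) auto
    then show ?thesis using that by linarith
  qed
  then show "\<exists>w\<in>trapezoid_polys N (Suc r). v - (D ^^ (p - 1)) w \<in> trapezoid_polys N r"
    using v assms trapezoid_polys_zero[OF v(2)] by (intro row_kernel_lift[of v N]) auto
qed

text \<open>
  In the strip no upper bound on \<open>i\<close> obstructs the preimages, so every row is exact.
\<close>

lemma strip_kernel_exact:
  assumes a: "a \<noteq> 0" shows "kernel_exact (strip_polys r) {0}"
proof (induction r)
  case 0
  have "strip_polys 0 = {0 :: nat \<times> nat \<Rightarrow> 'k}"
    by (auto simp: strip_polys_def trapezoid_polys_def trapezoid_def fun_eq_iff)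
  moreover have "0 - (D ^^ (p - 1)) 0 = 0" unfolding D_pow_0 by simp
  ultimately show ?case
    unfolding kernel_exact_def by (metis singletonD singletonI)
next
  case (Suc r)
  have "kernel_exact (strip_polys (Suc r)) (strip_polys r)"
    unfolding kernel_exact_def
  proof (intro ballI impI)
    fix v assume v: "v \<in> strip_polys (Suc r)" "D v \<in> strip_polys r"
    then obtain N where N: "v \<in> trapezoid_polys N (Suc r)" by (auto simp: strip_polys_def)
    have "D v (i, r) = 0" for i using v(2) by (auto simp: strip_polys_def trapezoid_polys_zero)
    then show "\<exists>w\<in>strip_polys (Suc r). v - (D ^^ (p - 1)) w \<in> strip_polys r"
      using row_kernel_lift[OF a N, of "N + (p - 1)"] unfolding strip_polys_def by fastforce
  qed
  moreover have "strip_polys r \<subseteq> strip_polys (Suc r)"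
    unfolding strip_polys_def using trapezoid_polys_mono[of _ _ r "Suc r"] by fastforce
  moreover have "{0} \<subseteq> strip_polys r"
    unfolding strip_polys_def using trapezoid_polys_closed(4) by blast
  ultimately show ?case
    using kernel_exact_trans[OF strip_polys_closed_add subset_refl _ _ _ Suc] by blast
qed

lemma row_power_kernel_exact:
  assumes a: "a \<noteq> 0" and N: "p dvd N + 1 - r"
  shows "power_kernel_exact (trapezoid_polys N (Suc r)) (trapezoid_polys N r)"
  unfolding power_kernel_exact_def
proof (intro ballI impI)
  fix v assume v: "v \<in> trapezoid_polys N (Suc r)" "(D ^^ (p - 1)) v \<in> trapezoid_polys N r"
  have zero: "v (i, r) = 0" if "p dvd Suc i" for i
  proof -
    define i' where "i' = i - (p - 1)"
    have i: "i = i' + (p - 1)" using that p3 by (auto simp: i'_def dest!: dvd_imp_le)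
    have "(D ^^ (p - 1)) v (i', r) = a ^ (p - 1) * pochhammer (of_nat (Suc i')) (p - 1) * v (i, r)"
      unfolding i using trapezoid_polys_zero[OF v(1)] by (intro D_pow_top_row) auto
    moreover have "p dvd i'"
    proof -
      have "Suc i = i' + p" using i p3 by simp
      then show ?thesis using that by simp
    qed
    ultimately show ?thesis
      using pochhammer_nonzero_iff[of i'] a trapezoid_polys_zero[OF v(2), of r i'] by auto
  qed
  \<comment> \<open>Termwise inverse of \<open>a \<partial>\<^sub>x\<close>; where \<open>p\<close> divides \<open>i\<close>, the coefficient of \<open>v\<close> is zero.\<close>
  define w where "w = (\<lambda>(i, n). if n = r \<and> 0 < i then v (i - 1, r) / (a * of_nat i) else 0)"
  have w: "w \<in> trapezoid_polys N (Suc r)"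
  proof (rule trapezoid_polysI)
    fix i n assume "w (i, n) \<noteq> 0"
    then have n: "n = r" "0 < i" and "v (i - 1, r) \<noteq> 0"
      by (auto simp: w_def split: if_splits)
    then have "\<not> p dvd i" "i - 1 + r \<le> N"
      using zero[of "i - 1"] trapezoid_polysD[OF v(1), of "i - 1" r] by auto
    moreover from this have "i \<noteq> N + 1 - r" using N by blast
    ultimately show "n < Suc r \<and> i + n \<le> N" using n by auto
  qed
  have "D w (i, r) = v (i, r)" for i
    using zero[of i] a of_nat_zero_iff[of "Suc i"]
    by (auto simp: w_def plane_field_def simp del: of_nat_Suc)
  moreover have "v - D w \<in> trapezoid_polys N (Suc r)"
    using D_closed[OF w] v by (intro trapezoid_polys_closed) auto
  ultimately have "v - D w \<in> trapezoid_polys N r"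
    by (intro trapezoid_polysI) (metis diff_self less_SucE minus_apply trapezoid_polysD)
  then show "\<exists>w\<in>trapezoid_polys N (Suc r). v - D w \<in> trapezoid_polys N r"
    using w by blast
qed

text \<open>
  A diagonal with \<open>r\<close> monomials and \<open>p\<close> dividing \<open>r\<close> splits into blocks of size \<open>p\<close> for \<open>x \<partial>\<^sub>y\<close>.  The bound
  \<open>r \<le> N + 2\<close> ensures that the diagonal \<open>i + n = N + 1\<close> meets all \<open>r\<close> rows.
\<close>

lemma diagonal_power_kernel_exact:
  assumes b: "b \<noteq> 0" and r: "p dvd r" "r \<le> N + 2"
  shows "power_kernel_exact (trapezoid_polys (Suc N) r) (trapezoid_polys N r)"
  unfolding power_kernel_exact_def
proof (intro ballI impI)
  fix v assume v: "v \<in> trapezoid_polys (Suc N) r" "(D ^^ (p - 1)) v \<in> trapezoid_polys N r"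
  have zero: "v (i, n) = 0" if "p dvd Suc n" "i + n = Suc N" for i n
  proof -
    define n' where "n' = n - (p - 1)"
    have n: "n = n' + (p - 1)" using that p3 by (auto simp: n'_def dest!: dvd_imp_le)
    have "(D ^^ (p - 1)) v (i + (p - 1), n')
        = b ^ (p - 1) * pochhammer (of_nat (Suc n')) (p - 1) * v (i + (p - 1) - (p - 1), n' + (p - 1))"
      using n that by (intro D_pow_top_diagonal[OF v(1)]) auto
    moreover have "p dvd n'"
    proof -
      have "Suc n = n' + p" using n p3 by simp
      then show ?thesis using that by simp
    qed
    ultimately show ?thesis
      using pochhammer_nonzero_iff[of n'] b trapezoid_polys_zero[OF v(2), of n' "i + (p - 1)"] n that
      by auto
  qed
  \<comment> \<open>Termwise inverse of \<open>b x \<partial>\<^sub>y\<close>.\<close>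
  define w where
    "w = (\<lambda>(i, n). if i + n = Suc N \<and> 0 < n then v (Suc i, n - 1) / (b * of_nat n) else 0)"
  have w: "w \<in> trapezoid_polys (Suc N) r"
  proof (rule trapezoid_polysI)
    fix i n assume "w (i, n) \<noteq> 0"
    then have n: "i + n = Suc N" "0 < n" and nz: "v (Suc i, n - 1) \<noteq> 0"
      by (auto simp: w_def split: if_splits)
    then have "\<not> p dvd n" using zero[of "n - 1" "Suc i"] by auto
    moreover have "n - 1 < r" using trapezoid_polysD[OF v(1) nz] by simp
    ultimately show "n < r \<and> i + n \<le> Suc N" using n r by (cases "n = r") auto
  qed
  have "D w (i, n) = v (i, n)" if "i + n = Suc N" for i n
  proof -
    have "D w (i, n) = (if i = 0 then 0 else b * of_nat (Suc n) * w (i - 1, Suc n))"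
      using that by (simp add: plane_field_def w_def)
    also have "\<dots> = v (i, n)"
    proof (cases "p dvd Suc n")
      case True
      then show ?thesis using zero[OF True that] that by (auto simp: w_def)
    next
      case False
      then have "v (0, n) = 0" if "i = 0"
      proof -
        have "r \<noteq> Suc n" using False r by blast
        then have "r \<le> n" using r \<open>i + n = Suc N\<close> that by simp
        then show ?thesis using trapezoid_polys_zero[OF v(1)] by blast
      qed
      then show ?thesis
        using False that b of_nat_zero_iff[of "Suc n"] by (auto simp: w_def simp del: of_nat_Suc)
    qed
    finally show ?thesis .
  qed
  moreover have "v - D w \<in> trapezoid_polys (Suc N) r"
    using D_closed[OF w] v by (intro trapezoid_polys_closed) auto
  ultimately have "v - D w \<in> trapezoid_polys N r"
    by (intro trapezoid_polysI) (metis diff_self le_SucE minus_apply trapezoid_polysD)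
  then show "\<exists>w\<in>trapezoid_polys (Suc N) r. v - D w \<in> trapezoid_polys N r"
    using w by blast
qed

lemma strip_power_kernel_exact:
  assumes b: "b \<noteq> 0" and r: "p dvd r" "r \<le> N + 2"
  shows "power_kernel_exact (strip_polys r) (trapezoid_polys N r)"
proof -
  have "\<exists>w\<in>strip_polys r. v - D w \<in> trapezoid_polys N r"
    if "v \<in> trapezoid_polys (N + m) r" "(D ^^ (p - 1)) v \<in> trapezoid_polys N r" for m v
    using that
  proof (induction m arbitrary: v)
    case 0
    have "0 \<in> strip_polys r" unfolding strip_polys_def using trapezoid_polys_closed(4) by blast
    moreover have "v - D 0 \<in> trapezoid_polys N r" using 0 by (simp only: D_0 diff_zero add_0_right)
    ultimately show ?case by blast
  next
    case (Suc m)
    have "(D ^^ (p - 1)) v \<in> trapezoid_polys (N + m) r"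
      using Suc.prems(2) trapezoid_polys_mono[of N "N + m" r r] by auto
    then obtain w where w: "w \<in> trapezoid_polys (Suc (N + m)) r" "v - D w \<in> trapezoid_polys (N + m) r"
      using diagonal_power_kernel_exact[OF b r(1), of "N + m"] Suc.prems(1) r(2)
      unfolding power_kernel_exact_def by auto
    have "(D ^^ (p - 1)) (v - D w) = (D ^^ (p - 1)) v"
      unfolding D_pow_diff D_pow_D D_nilpotent[OF w(1)] by simp
    then obtain w' where w': "w' \<in> strip_polys r" "v - D w - D w' \<in> trapezoid_polys N r"
      using Suc.IH[OF w(2)] Suc.prems(2) by metis
    have "v - D (w + w') \<in> trapezoid_polys N r"
      using w'(2) by (simp only: D_add diff_diff_add)
    moreover have "w + w' \<in> strip_polys r"
      using w'(1) w(1) trapezoid_subset_strip[of r r] by (intro strip_polys_closed_add) auto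
    ultimately show ?case by blast
  qed
  moreover have "\<exists>m. v \<in> trapezoid_polys (N + m) r" if "v \<in> strip_polys r" for v
    using that trapezoid_polys_mono[of _ "N + _" r r] unfolding strip_polys_def
    by (metis UN_E le_add2 order_refl subsetD)
  ultimately show ?thesis unfolding power_kernel_exact_def by blast
qed

text \<open>
  For \<open>r = \<lambda>\<^sub>2 + 1\<close>, the case in which \<open>\<lambda>\<^sub>2\<close> is a Steinberg weight for \<open>\<beta>\<close>: the strip and the strip modulo the
  trapezoid are both exact.
\<close>

lemma steinberg_kernel_exact:
  assumes "a \<noteq> 0" "b \<noteq> 0" "p dvd r" "r \<le> N + 2"
  shows "kernel_exact (trapezoid_polys N r) {0}"
proof (rule kernel_exact_subspace[OF subset_refl trapezoid_subset_strip[OF order_refl]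
      strip_kernel_exact[OF assms(1)] strip_power_kernel_exact[OF assms(2-4)] _ subspace_trapezoid_polys])
  show "{0} \<subseteq> trapezoid_polys N r" using trapezoid_polys_closed(4) by blast
qed

text \<open>
  In the second case the top row has \<open>\<lambda>\<^sub>1 + 1\<close> monomials and the rows below it form a trapezoid
  of the first kind.  In the third case one more row, with \<open>\<lambda>\<^sub>1\<close> monomials, completes the
  trapezoid to one of the first kind.
\<close>

lemma trapezoid_kernel_exact:
  assumes "a \<noteq> 0" "b \<noteq> 0"
    and "p dvd l2 + 1 \<or> p dvd l2 \<and> p dvd l1 + 1 \<or> p dvd l2 + 2 \<and> p dvd l1"
  shows "kernel_exact (trapezoid_polys (l1 + l2) (l2 + 1)) {0}"
  using assms(3)
proof (elim disjE conjE)
  assume "p dvd l2 + 1"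
  then show ?thesis using assms by (intro steinberg_kernel_exact) auto
next
  assume l: "p dvd l2" "p dvd l1 + 1"
  have "kernel_exact (trapezoid_polys (l1 + l2) (Suc l2)) {0}"
  proof (rule kernel_exact_trans[where r = "Suc l2"])
    show "kernel_exact (trapezoid_polys (l1 + l2) (Suc l2)) (trapezoid_polys (l1 + l2) l2)"
      using assms l by (intro row_kernel_exact) auto
    show "kernel_exact (trapezoid_polys (l1 + l2) l2) {0}"
      using assms l by (intro steinberg_kernel_exact) auto
    show "{0} \<subseteq> trapezoid_polys (l1 + l2) l2" using trapezoid_polys_closed(4) by blast
  qed (intro trapezoid_polys_closed trapezoid_polys_mono trapezoid_subset_strip; simp)+
  then show ?thesis by simp
next
  assume l: "p dvd l2 + 2" "p dvd l1"
  have "kernel_exact (trapezoid_polys (l1 + l2) (Suc l2)) {0}"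
  proof (rule kernel_exact_subspace[where r = "Suc (Suc l2)"])
    show "power_kernel_exact (trapezoid_polys (l1 + l2) (Suc (Suc l2))) (trapezoid_polys (l1 + l2) (Suc l2))"
      using assms l by (intro row_power_kernel_exact) auto
    show "kernel_exact (trapezoid_polys (l1 + l2) (Suc (Suc l2))) {0}"
      using assms l by (intro steinberg_kernel_exact) auto
    show "{0} \<subseteq> trapezoid_polys (l1 + l2) (Suc l2)" using trapezoid_polys_closed(4) by blast
  qed (intro subspace_trapezoid_polys trapezoid_polys_mono trapezoid_subset_strip; simp)+
  then show ?thesis by simp
qed

lemma single_row_kernel_exact:
  assumes "a \<noteq> 0" "p dvd N + 1"
  shows "kernel_exact (trapezoid_polys N 1) {0}"
proof -
  have "trapezoid_polys N 0 = {0 :: nat \<times> nat \<Rightarrow> 'k}"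
    by (auto simp: trapezoid_polys_def trapezoid_def fun_eq_iff)
  then show ?thesis using row_kernel_exact[of N 0] assms by simp
qed

end

section \<open>Obstructions to projectivity\<close>

context plane_vector_field
begin

text \<open>
  For \<open>b \<noteq> 0\<close> the constant \<open>1\<close> is not divisible by \<open>b x + c\<close>.  For \<open>b = 0\<close> the monomial \<open>x\<^sup>N\<close> could only
  come from \<open>x\<^sup>N y\<close>, which lies outside the trapezoid.
\<close>

lemma kernel_not_image_horizontal:
  assumes a: "a = 0" and bc: "b \<noteq> 0 \<or> c \<noteq> 0" and r: "0 < r"
  shows "\<exists>v\<in>trapezoid_polys N r. D v = 0 \<and> (\<nexists>u. u \<in> trapezoid_polys N r \<and> D u = v)"
proof (cases "b = 0")
  case True
  have "D (basis_monomial (N, 0)) = 0"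
    by (auto simp: plane_field_def basis_monomial_def fun_eq_iff a)
  moreover have "basis_monomial (N, 0) \<in> trapezoid_polys N r"
    using r by (intro unit_poly_in) (auto simp: trapezoid_def)
  moreover have "D u \<noteq> basis_monomial (N, 0)" if u: "u \<in> trapezoid_polys N r" for u
  proof
    assume "D u = basis_monomial (N, 0)"
    then have "D u (N, 0) = 1" by (simp add: basis_monomial_def)
    moreover have "u (N, Suc 0) = 0" using trapezoid_polys_zero[OF u] by simp
    ultimately show False by (simp add: plane_field_def a True split: if_splits)
  qed
  ultimately show ?thesis by blast
next
  case False
  have "D (basis_monomial (0, 0)) = 0"
    by (auto simp: plane_field_def basis_monomial_def fun_eq_iff a)
  moreover have "basis_monomial (0, 0) \<in> trapezoid_polys N r"
    using r by (intro unit_poly_in) (auto simp: trapezoid_def)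
  moreover have "D u \<noteq> basis_monomial (0, 0)" if u: "u \<in> trapezoid_polys N r" for u
  proof
    assume Du: "D u = basis_monomial (0, 0)"
    have start: "c * u (0, Suc 0) = 1"
      using fun_cong[OF Du, of "(0, 0)"] by (simp add: plane_field_def a basis_monomial_def)
    have step: "b * u (i, Suc 0) + c * u (Suc i, Suc 0) = 0" for i
      using fun_cong[OF Du, of "(Suc i, 0)"] by (simp add: plane_field_def a basis_monomial_def)
    have "u (i, Suc 0) \<noteq> 0" for i
    proof (induction i)
      case 0
      then show ?case using start by auto
    next
      case (Suc i)
      then show ?case using step[of i] False by auto
    qed
    moreover have "u (N, Suc 0) = 0" using trapezoid_polys_zero[OF u] by simp
    ultimately show False by blast
  qed
  ultimately show ?thesis by blast
qed

lemma D_pow_degree_drop: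
  assumes b: "b = 0" and u: "u \<in> trapezoid_polys N r" and nz: "(D ^^ j) u (i, n) \<noteq> 0"
  shows "i + n + j \<le> N"
  using nz
proof (induction j arbitrary: i n)
  case 0
  then show ?case using trapezoid_polysD[OF u] by simp
next
  case (Suc j)
  have "D w (i, n) = a * of_nat (Suc i) * w (Suc i, n) + c * of_nat (Suc n) * w (i, Suc n)" for w
    by (simp add: plane_field_def b)
  from this[of "(D ^^ j) u"] have "(D ^^ j) u (Suc i, n) \<noteq> 0 \<or> (D ^^ j) u (i, Suc n) \<noteq> 0"
    using Suc.prems by auto
  then show ?case using Suc.IH by fastforce
qed

text \<open>
  The field now lowers the total degree, so \<open>D\<^sup>p\<^sup>-\<^sup>1\<close> only reaches total degree \<open>N - (p - 1)\<close>.  A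
  power \<open>x\<^sup>m\<close> with \<open>p\<close> dividing \<open>m\<close> is in the kernel, and its degree is larger than this bound for the largest
  such \<open>m \<le> N\<close>, unless \<open>p\<close> divides \<open>N + 1\<close>.  In that case \<open>x\<^sup>m (a y - c x)\<close> with \<open>m = N + 1 - p\<close>
  has the degree \<open>N + 2 - p\<close>, if a second row is available.
\<close>

lemma kernel_not_image_constant:
  assumes a: "a \<noteq> 0" and b: "b = 0" and r: "0 < r" "\<not> (r = 1 \<and> p dvd N + 1)"
  shows "\<exists>v\<in>trapezoid_polys N r. D v = 0 \<and> (\<nexists>u. u \<in> trapezoid_polys N r \<and> (D ^^ (p - 1)) u = v)"
proof (cases "p dvd N + 1")
  case False
  define m where "m = p * (N div p)"
  have m: "m \<le> N" "N < m + (p - 1)" "p dvd m"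
  proof -
    have "N mod p < p" "N mod p \<noteq> p - 1"
    proof -
      show "N mod p < p" using p3 by simp
      show "N mod p \<noteq> p - 1"
      proof
        assume "N mod p = p - 1"
        then have "N + 1 = p * (N div p) + p" using mult_div_mod_eq[of p N] p3 by linarith
        then show False using \<open>\<not> p dvd N + 1\<close> by simp
      qed
    qed
    then show "m \<le> N" "N < m + (p - 1)" "p dvd m"
      using mult_div_mod_eq[of p N] unfolding m_def by linarith+ simp
  qed
  have "D (basis_monomial (m, 0)) = 0"
    using m of_nat_zero_iff[of m]
    by (auto simp: plane_field_def basis_monomial_def fun_eq_iff b simp del: of_nat_Suc)
  moreover have "basis_monomial (m, 0) \<in> trapezoid_polys N r"
    using r m by (intro unit_poly_in) (auto simp: trapezoid_def)
  moreover have "(D ^^ (p - 1)) u \<noteq> basis_monomial (m, 0)" if u: "u \<in> trapezoid_polys N r" for u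
    using D_pow_degree_drop[OF b u, of "p - 1" m 0] m by (auto simp: basis_monomial_def)
  ultimately show ?thesis by blast
next
  case True
  then have N: "p \<le> N + 1" and r2: "2 \<le> r" using r by (auto intro: dvd_imp_le)
  define m where "m = N + 1 - p"
  have m: "p dvd m" "m + p = N + 1" using True N by (auto simp: m_def)
  define v where "v = a *f basis_monomial (m, Suc 0) - c *f basis_monomial (Suc m, 0)"
  have zero: "(of_nat m :: 'k) = 0" using m of_nat_zero_iff by blast
  have "D (basis_monomial (m, Suc 0)) = c *f basis_monomial (m, 0)"
  proof
    fix t :: "nat \<times> nat"
    obtain i n where t: "t = (i, n)" by (cases t)
    have "(1 + of_nat i :: 'k) = 0" if "Suc i = m"
      using zero that by auto
    then show "D (basis_monomial (m, Suc 0)) t = (c *f basis_monomial (m, 0)) t"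
      using zero by (cases "Suc i = m")
        (auto simp: t plane_field_def basis_monomial_def b)
  qed
  moreover have "D (basis_monomial (Suc m, 0)) = a *f basis_monomial (m, 0)"
    using zero by (auto simp: plane_field_def basis_monomial_def b fun_eq_iff)
  ultimately have "D v = 0"
    by (simp add: v_def D_diff D_scale fun_eq_iff)
  moreover have "v \<in> trapezoid_polys N r"
    unfolding v_def using m p3 r2
    by (intro trapezoid_polys_closed unit_poly_in) (auto simp: trapezoid_def)
  moreover have "(D ^^ (p - 1)) u \<noteq> v" if u: "u \<in> trapezoid_polys N r" for u
  proof
    assume "(D ^^ (p - 1)) u = v"
    moreover have "v (m, Suc 0) \<noteq> 0" using a by (simp add: v_def basis_monomial_def)
    ultimately have "m + Suc 0 + (p - 1) \<le> N" using D_pow_degree_drop[OF b u] by blast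
    then show False using m p3 by simp
  qed
  ultimately show ?thesis by blast
qed

definition monomial_trace :: "nat \<Rightarrow> nat \<Rightarrow> ((nat \<times> nat \<Rightarrow> 'k) \<Rightarrow> nat \<times> nat \<Rightarrow> 'k) \<Rightarrow> 'k" where
  "monomial_trace N r L = (\<Sum>t\<in>trapezoid N r. L (basis_monomial t) t)"

definition linear_on_trapezoid :: "nat \<Rightarrow> nat \<Rightarrow> ((nat \<times> nat \<Rightarrow> 'k) \<Rightarrow> nat \<times> nat \<Rightarrow> 'k) \<Rightarrow> bool" where
  "linear_on_trapezoid N r L \<longleftrightarrow>
    (\<forall>v\<in>trapezoid_polys N r. L v \<in> trapezoid_polys N r) \<and>
    (\<forall>v\<in>trapezoid_polys N r. \<forall>w\<in>trapezoid_polys N r. L (v + w) = L v + L w) \<and>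
    (\<forall>x. \<forall>v\<in>trapezoid_polys N r. L (x *f v) = x *f L v)"

lemma linear_on_trapezoid_expand:
  assumes L: "linear_on_trapezoid N r L" and v: "v \<in> trapezoid_polys N r"
  shows "L v s = (\<Sum>t\<in>trapezoid N r. v t * L (basis_monomial t) s)"
proof -
  have L0: "L 0 = 0"
  proof -
    have "L (0 *f 0) = 0 *f L 0" using L trapezoid_polys_closed(4) unfolding linear_on_trapezoid_def by blast
    then show ?thesis by simp
  qed
  have "L (\<Sum>t\<in>S. v t *f basis_monomial t) = (\<Sum>t\<in>S. v t *f L (basis_monomial t))"
    if "S \<subseteq> trapezoid N r" for S
    using finite_subset[OF that finite_trapezoid] that
  proof (induction S rule: finite_induct)
    case empty
    show ?case using L0 by (simp only: sum.empty)
  next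
    case (insert t S)
    have "v t *f basis_monomial t \<in> trapezoid_polys N r" "(\<Sum>t\<in>S. v t *f basis_monomial t) \<in> trapezoid_polys N r"
      using insert.prems by (auto intro!: trapezoid_polys_closed unit_poly_in)
    moreover have "L (v t *f basis_monomial t) = v t *f L (basis_monomial t)"
      using L unit_poly_in insert.prems unfolding linear_on_trapezoid_def by blast
    moreover have "L (\<Sum>t\<in>S. v t *f basis_monomial t) = (\<Sum>t\<in>S. v t *f L (basis_monomial t))"
      using insert by blast
    moreover have "L (u + u') = L u + L u'"
      if "u \<in> trapezoid_polys N r" "u' \<in> trapezoid_polys N r" for u u'
      using L that unfolding linear_on_trapezoid_def by blast
    ultimately show ?case
      unfolding sum.insert[OF insert.hyps] by (simp only:)
  qed
  from this[OF subset_refl] show ?thesis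
    using expand_unit_polys[OF v] by (simp add: sum_fun_apply)
qed

lemma trace_commute:
  assumes "linear_on_trapezoid N r L" "linear_on_trapezoid N r K"
  shows "monomial_trace N r (\<lambda>v. L (K v)) = monomial_trace N r (\<lambda>v. K (L v))"
proof -
  have trace: "monomial_trace N r (\<lambda>v. L (K v)) =
      (\<Sum>t\<in>trapezoid N r. \<Sum>s\<in>trapezoid N r. K (basis_monomial t) s * L (basis_monomial s) t)"
    if "linear_on_trapezoid N r L" "linear_on_trapezoid N r K" for L K
    unfolding monomial_trace_def
  proof (rule sum.cong[OF refl])
    fix t assume "t \<in> trapezoid N r"
    then have "K (basis_monomial t) \<in> trapezoid_polys N r"
      using that(2) unit_poly_in unfolding linear_on_trapezoid_def by blast
    then show "L (K (basis_monomial t)) t = (\<Sum>s\<in>trapezoid N r. K (basis_monomial t) s * L (basis_monomial s) t)"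
      by (rule linear_on_trapezoid_expand[OF that(1)])
  qed
  show ?thesis
    unfolding trace[OF assms] trace[OF assms(2,1)]
    by (subst sum.swap) (simp add: mult.commute)
qed

lemma linear_D_pow: "linear_on_trapezoid N r (D ^^ j)"
  unfolding linear_on_trapezoid_def using D_pow_closed D_pow_add D_pow_scale by blast

lemma linear_compose:
  assumes "linear_on_trapezoid N r L" "linear_on_trapezoid N r K"
  shows "linear_on_trapezoid N r (\<lambda>v. L (K v))"
  using assms unfolding linear_on_trapezoid_def by simp

text \<open>
  Insert Higman's identity into the trace of \<open>\<Theta>\<close> and move \<open>E D\<^sup>p\<^sup>-\<^sup>1\<^sup>-\<^sup>j\<close> around the trace.  Commuting
  \<open>D\<^sup>p\<^sup>-\<^sup>1\<^sup>-\<^sup>j\<close> past \<open>\<Theta> D\<^sup>j\<close> costs \<open>(p - 1 - j) x D\<^sup>p\<^sup>-\<^sup>1\<close>, so the summand with index \<open>j\<close> is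
  \<open>tr (E \<Theta> D\<^sup>p\<^sup>-\<^sup>1) + (p - 1 - j) x tr (E D\<^sup>p\<^sup>-\<^sup>1)\<close>, and both
  \<open>p\<close> and \<open>0 + 1 + \<dots> + (p - 1)\<close> vanish in \<open>k\<close>.
\<close>

lemma trace_eq_0:
  assumes E: "linear_on_trapezoid N r E"
    and id: "\<And>v. v \<in> trapezoid_polys N r \<Longrightarrow>
      v = (\<Sum>j<p. (D ^^ j) (E ((D ^^ (p - 1 - j)) v)))"
    and \<Theta>: "linear_on_trapezoid N r \<Theta>" "\<And>v. D (\<Theta> v) = \<Theta> (D v) + x *f D v"
  shows "monomial_trace N r \<Theta> = 0"
proof -
  have \<Theta>0: "\<Theta> 0 = 0"
  proof -
    have "\<Theta> (0 *f 0) = 0 *f \<Theta> 0" using \<Theta>(1) trapezoid_polys_closed(4) unfolding linear_on_trapezoid_def by blast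
    then show ?thesis by simp
  qed
  have \<Theta>_sum: "\<Theta> (\<Sum>j\<in>S. f j) = (\<Sum>j\<in>S. \<Theta> (f j))"
    if "\<And>j. j \<in> S \<Longrightarrow> f j \<in> trapezoid_polys N r" "finite S" for f :: "nat \<Rightarrow> _" and S
    using that(2,1)
  proof (induction S rule: finite_induct)
    case empty
    show ?case using \<Theta>0 by (simp only: sum.empty)
  next
    case (insert j S)
    then have "f j \<in> trapezoid_polys N r" "(\<Sum>j\<in>S. f j) \<in> trapezoid_polys N r"
      by (auto intro: trapezoid_polys_closed)
    moreover have "\<Theta> (\<Sum>j\<in>S. f j) = (\<Sum>j\<in>S. \<Theta> (f j))"
      using insert by blast
    moreover have "\<Theta> (u + u') = \<Theta> u + \<Theta> u'"
      if "u \<in> trapezoid_polys N r" "u' \<in> trapezoid_polys N r" for u u'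
      using \<Theta>(1) that unfolding linear_on_trapezoid_def by blast
    ultimately show ?case
      unfolding sum.insert[OF insert.hyps] by (simp only:)
  qed
  have comm: "(D ^^ j) (\<Theta> v) = \<Theta> ((D ^^ j) v) + (of_nat j * x) *f (D ^^ j) v" for j v
  proof (induction j)
    case (Suc j)
    have "(D ^^ Suc j) (\<Theta> v) = D ((D ^^ j) (\<Theta> v))" by simp
    also have "\<dots> = \<Theta> ((D ^^ Suc j) v) + (of_nat (Suc j) * x) *f (D ^^ Suc j) v"
      unfolding Suc D_add D_scale \<Theta>(2) by (simp add: fun_eq_iff algebra_simps)
    finally show ?case .
  qed simp
  define F where "F j = (\<lambda>v. E ((D ^^ (p - 1 - j)) v))" for j
  have F: "linear_on_trapezoid N r (F j)" for j
    unfolding F_def by (rule linear_compose[OF E linear_D_pow])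
  have "monomial_trace N r \<Theta> = (\<Sum>t\<in>trapezoid N r. \<Sum>j<p. \<Theta> ((D ^^ j) (F j (basis_monomial t))) t)"
    unfolding monomial_trace_def
  proof (rule sum.cong[OF refl])
    fix t assume t: "t \<in> trapezoid N r"
    have "\<Theta> (basis_monomial t) = \<Theta> (\<Sum>j<p. (D ^^ j) (F j (basis_monomial t)))"
      using id[OF unit_poly_in[OF t]] unfolding F_def by (rule arg_cong)
    also have "\<dots> = (\<Sum>j<p. \<Theta> ((D ^^ j) (F j (basis_monomial t))))"
    proof (rule \<Theta>_sum[OF D_pow_closed finite_lessThan])
      show "F j (basis_monomial t) \<in> trapezoid_polys N r" for j
        using F[of j] unit_poly_in[OF t] unfolding linear_on_trapezoid_def by blast
    qed
    finally show "\<Theta> (basis_monomial t) t = (\<Sum>j<p. \<Theta> ((D ^^ j) (F j (basis_monomial t))) t)"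
      by (simp add: sum_fun_apply)
  qed
  also have "\<dots> = (\<Sum>j<p. monomial_trace N r (\<lambda>v. \<Theta> ((D ^^ j) (F j v))))"
    unfolding monomial_trace_def by (rule sum.swap)
  also have "\<dots> = (\<Sum>j<p. monomial_trace N r (\<lambda>v. F j (\<Theta> ((D ^^ j) v))))"
    using trace_commute[OF linear_compose[OF \<Theta>(1) linear_D_pow] F] by simp
  also have "\<dots> = (\<Sum>j<p. monomial_trace N r (\<lambda>v. E (\<Theta> ((D ^^ (p - 1)) v)))
      + of_nat (p - 1 - j) * (x * monomial_trace N r (\<lambda>v. E ((D ^^ (p - 1)) v))))"
  proof (rule sum.cong[OF refl])
    fix j assume "j \<in> {..<p}"
    then have j: "p - 1 - j + j = p - 1" by auto
    have "F j (\<Theta> ((D ^^ j) v)) = E (\<Theta> ((D ^^ (p - 1)) v)) + (of_nat (p - 1 - j) * x) *f E ((D ^^ (p - 1)) v)"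
      if v: "v \<in> trapezoid_polys N r" for v
    proof -
      have "(D ^^ (p - 1 - j)) ((D ^^ j) v) = (D ^^ (p - 1)) v"
        using j by (metis comp_apply funpow_add)
      then have "F j (\<Theta> ((D ^^ j) v)) = E (\<Theta> ((D ^^ (p - 1)) v) + (of_nat (p - 1 - j) * x) *f (D ^^ (p - 1)) v)"
        unfolding F_def comm by simp
      moreover have "(D ^^ (p - 1)) v \<in> trapezoid_polys N r" by (rule D_pow_closed[OF v])
      moreover from this have "\<Theta> ((D ^^ (p - 1)) v) \<in> trapezoid_polys N r"
        using \<Theta>(1) unfolding linear_on_trapezoid_def by blast
      moreover have "E (u + y *f u') = E u + y *f E u'"
        if "u \<in> trapezoid_polys N r" "u' \<in> trapezoid_polys N r" for u u' y
      proof -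
        have "y *f u' \<in> trapezoid_polys N r" by (rule trapezoid_polys_closed(3)[OF that(2)])
        then show ?thesis using E that unfolding linear_on_trapezoid_def by simp
      qed
      ultimately show ?thesis by (simp only:)
    qed
    then show "monomial_trace N r (\<lambda>v. F j (\<Theta> ((D ^^ j) v))) = monomial_trace N r (\<lambda>v. E (\<Theta> ((D ^^ (p - 1)) v)))
      + of_nat (p - 1 - j) * (x * monomial_trace N r (\<lambda>v. E ((D ^^ (p - 1)) v)))"
      unfolding monomial_trace_def sum_distrib_left sum.distrib[symmetric]
      by (intro sum.cong refl) (simp add: unit_poly_in)
  qed
  also have "\<dots> = of_nat p * monomial_trace N r (\<lambda>v. E (\<Theta> ((D ^^ (p - 1)) v)))
      + of_nat (\<Sum>j<p. p - 1 - j) * (x * monomial_trace N r (\<lambda>v. E ((D ^^ (p - 1)) v)))"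
    by (simp add: sum.distrib sum_distrib_right)
  also have "(\<Sum>j<p. p - 1 - j) = (\<Sum>j<p. j)"
    using sum.nat_diff_reindex[of "\<lambda>j. j" p] by simp
  also have "(of_nat (\<Sum>j<p. j) :: 'k) = 0"
  proof -
    have "2 * (\<Sum>j<p. j) = p * (p - 1)"
      using gauss_sum_nat[of "p - 1"] p3 lessThan_Suc_atMost[of "p - 1"]
      by (simp add: atMost_atLeast0 mult.commute)
    then have "p dvd 2 * (\<Sum>j<p. j)" by simp
    moreover have "\<not> p dvd 2" using p3 by (auto dest!: dvd_imp_le)
    ultimately have "p dvd (\<Sum>j<p. j)" using prime_dvd_mult_iff[OF prime_p] by blast
    then show ?thesis using of_nat_zero_iff by blast
  qed
  finally show ?thesis using of_nat_zero_iff[of p] by simp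
qed

text \<open>
  The field \<open>\<Theta> = (x + c/b) \<partial>\<^sub>x + 2 y \<partial>\<^sub>y\<close> is the Euler field for the weights \<open>1\<close> of \<open>x + c/b\<close> and \<open>2\<close> of \<open>y\<close>.
  With respect to it \<open>D = a \<partial>\<^sub>x + b (x + c/b) \<partial>\<^sub>y\<close> is homogeneous of degree \<open>-1\<close>.  The diagonal entry of
  \<open>\<Theta>\<close> at \<open>x\<^sup>i y\<^sup>n\<close> is \<open>i + 2 n\<close>.
\<close>

lemma higman_divisibility:
  assumes b: "b \<noteq> 0" and E: "linear_on_trapezoid N r E"
    and id: "\<And>v. v \<in> trapezoid_polys N r \<Longrightarrow>
      v = (\<Sum>j<p. (D ^^ j) (E ((D ^^ (p - 1 - j)) v)))"
  shows "p dvd card (trapezoid N r)" "p dvd (\<Sum>(i, n)\<in>trapezoid N r. i + 2 * n)"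
proof -
  have "monomial_trace N r (\<lambda>v. v) = 0"
    using trace_eq_0[OF E id, of "\<lambda>v. v" 0] by (simp add: linear_on_trapezoid_def)
  moreover have "monomial_trace N r (\<lambda>v. v) = of_nat (card (trapezoid N r))"
    by (simp add: monomial_trace_def basis_monomial_def)
  ultimately show "p dvd card (trapezoid N r)" by (simp add: of_nat_zero_iff)
  define \<Theta> :: "(nat \<times> nat \<Rightarrow> 'k) \<Rightarrow> nat \<times> nat \<Rightarrow> 'k" where
    "\<Theta> v = (\<lambda>(i, n). of_nat (i + 2 * n) * v (i, n) + c / b * of_nat (Suc i) * v (Suc i, n))" for v
  have "linear_on_trapezoid N r \<Theta>"
    unfolding linear_on_trapezoid_def
  proof (intro conjI ballI allI)
    fix v :: "nat \<times> nat \<Rightarrow> 'k" assume v: "v \<in> trapezoid_polys N r"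
    show "\<Theta> v \<in> trapezoid_polys N r"
    proof (rule trapezoid_polysI)
      fix i n assume "\<Theta> v (i, n) \<noteq> 0"
      then have "v (i, n) \<noteq> 0 \<or> v (Suc i, n) \<noteq> 0" by (auto simp: \<Theta>_def)
      then show "n < r \<and> i + n \<le> N" using trapezoid_polysD[OF v] by fastforce
    qed
  qed (auto simp: \<Theta>_def fun_eq_iff algebra_simps)
  moreover have "D (\<Theta> v) = \<Theta> (D v) + 1 *f D v" for v
  proof
    fix t :: "nat \<times> nat"
    obtain i n where t: "t = (i, n)" by (cases t)
    show "D (\<Theta> v) t = (\<Theta> (D v) + 1 *f D v) t"
      using b by (cases i) (auto simp: \<Theta>_def plane_field_def t field_simps)
  qed
  ultimately have "monomial_trace N r \<Theta> = 0"
    using trace_eq_0[OF E id, of \<Theta> 1] by blast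
  moreover have "monomial_trace N r \<Theta> = of_nat (\<Sum>(i, n)\<in>trapezoid N r. i + 2 * n)"
    unfolding monomial_trace_def of_nat_sum by (intro sum.cong) (auto simp: \<Theta>_def basis_monomial_def)
  ultimately show "p dvd (\<Sum>(i, n)\<in>trapezoid N r. i + 2 * n)"
    by (simp only: of_nat_zero_iff)
qed

end

section \<open>The numerical condition\<close>

lemma sum_trapezoid:
  assumes "r \<le> N + 1"
  shows "(\<Sum>t\<in>trapezoid N r. f t) = (\<Sum>n<r. \<Sum>i\<le>N - n. f (i, n))"
proof -
  have "(\<Sum>n<r. \<Sum>i\<le>N - n. f (i, n)) = (\<Sum>(n, i)\<in>(SIGMA n:{..<r}. {..N - n}). f (i, n))"
    by (subst sum.Sigma) auto
  also have "\<dots> = (\<Sum>t\<in>trapezoid N r. f t)"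
    using assms
    by (intro sum.reindex_bij_witness[of _ prod.swap prod.swap]) (auto simp: trapezoid_def)
  finally show ?thesis by simp
qed

lemma card_trapezoid:
  assumes "r \<le> N + 1"
  shows "2 * int (card (trapezoid N r)) = int r * (2 * int N + 3 - int r)"
proof -
  have "int (card (trapezoid N r)) = (\<Sum>n<r. int (N - n) + 1)"
    using sum_trapezoid[OF assms, of "\<lambda>_. 1 :: nat"] by (simp add: add.commute)
  moreover have "2 * (\<Sum>n<r. int (N - n) + 1) = int r * (2 * int N + 3 - int r)"
    using assms by (induction r) (auto simp: algebra_simps of_nat_diff)
  ultimately show ?thesis by simp
qed

lemma moment_trapezoid:
  assumes "r \<le> N + 1"
  shows "2 * int (\<Sum>(i, n)\<in>trapezoid N r. i + 2 * n)
    = int r * ((int N + 1) * (int N + int r - 1) - (int r - 1)\<^sup>2)"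
proof -
  have row: "2 * (\<Sum>i\<le>m. int i + 2 * int n) = (int m + 1) * (int m + 4 * int n)" for m n :: nat
    by (induction m) (auto simp: algebra_simps)
  have "2 * int (\<Sum>(i, n)\<in>trapezoid N r. i + 2 * n) = (\<Sum>n<r. 2 * (\<Sum>i\<le>N - n. int i + 2 * int n))"
    using sum_trapezoid[OF assms, of "\<lambda>(i, n). i + 2 * n"] by (simp add: sum_distrib_left)
  also have "\<dots> = (\<Sum>n<r. (int (N - n) + 1) * (int (N - n) + 4 * int n))"
    by (simp only: row)
  also have "\<dots> = int r * ((int N + 1) * (int N + int r - 1) - (int r - 1)\<^sup>2)"
    using assms by (induction r) (auto simp: algebra_simps of_nat_diff power2_eq_square)
  finally show ?thesis .
qed

text \<open>
  If \<open>p\<close> does not divide \<open>\<lambda>\<^sub>2 + 1\<close>, the cardinality gives \<open>2 \<lambda>\<^sub>1 + \<lambda>\<^sub>2 + 2 \<equiv> 0\<close>.  Under this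
  congruence the moment becomes a multiple of \<open>\<lambda>\<^sub>2 (\<lambda>\<^sub>2 + 2)\<close>, and the two factors correspond to \<open>\<lambda>\<^sub>1 + 1 \<equiv> 0\<close> and to
  \<open>\<lambda>\<^sub>1 + \<lambda>\<^sub>2 + 2 \<equiv> 0\<close>.
\<close>

lemma weight_condition_of_divisibility:
  fixes p l1 l2 :: nat
  assumes p: "prime p" "p \<ge> 3"
    and card: "p dvd card (trapezoid (l1 + l2) (l2 + 1))"
    and moment: "p dvd (\<Sum>(i, n)\<in>trapezoid (l1 + l2) (l2 + 1). i + 2 * n)"
  shows "p dvd l2 + 1 \<or> p dvd 2 * l1 + l2 + 2 \<and> (p dvd l1 + 1 \<or> p dvd l1 + l2 + 2)"
proof (cases "p dvd l2 + 1")
  case False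
  have ip: "prime (int p)" using p by simp
  have n1: "\<not> int p dvd int l2 + 1" using False by (metis int_dvd_int_iff of_nat_1 of_nat_add)
  have n2: "\<not> int p dvd 2" using p by (auto dest!: zdvd_imp_le)
  have "int p dvd 2 * int (card (trapezoid (l1 + l2) (l2 + 1)))" using card by simp
  then have "int p dvd (int l2 + 1) * (2 * int l1 + int l2 + 2)"
    by (subst (asm) card_trapezoid) (simp_all add: algebra_simps)
  then have d1: "int p dvd 2 * int l1 + int l2 + 2"
    using prime_dvd_mult_iff[OF ip] n1 by blast
  let ?N = "int l1 + int l2"
  have "int p dvd 2 * int (\<Sum>(i, n)\<in>trapezoid (l1 + l2) (l2 + 1). i + 2 * n)"
    using moment by (intro dvd_mult) (simp only: int_dvd_int_iff)
  then have "int p dvd (int l2 + 1) * ((?N + 1) * (?N + int l2) - (int l2)\<^sup>2)"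
    by (subst (asm) moment_trapezoid) (simp_all add: algebra_simps)
  then have d2: "int p dvd (?N + 1) * (?N + int l2) - (int l2)\<^sup>2"
    using prime_dvd_mult_iff[OF ip] n1 by blast
  have "int l2 * (int l2 + 2) = (2 * int l1 + int l2 + 2) * (2 * int l1 + 5 * int l2)
      - 4 * ((?N + 1) * (?N + int l2) - (int l2)\<^sup>2)"
    by (simp add: algebra_simps power2_eq_square)
  then have "int p dvd int l2 * (int l2 + 2)"
    using d1 d2 by (metis dvd_diff dvd_mult dvd_mult2)
  then consider "int p dvd int l2" | "int p dvd int l2 + 2"
    using prime_dvd_mult_iff[OF ip] by blast
  then have "int p dvd int l1 + 1 \<or> int p dvd int l1 + int l2 + 2"
  proof cases
    case 1
    then have "int p dvd (2 * int l1 + int l2 + 2) - int l2" using d1 by (rule dvd_diff[rotated])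
    then have "int p dvd 2 * (int l1 + 1)" by (simp add: algebra_simps)
    then show ?thesis using prime_dvd_mult_iff[OF ip] n2 by blast
  next
    case 2
    then have "int p dvd (2 * int l1 + int l2 + 2) + (int l2 + 2)" using d1 by (rule dvd_add[rotated])
    then have "int p dvd 2 * (int l1 + int l2 + 2)" by (simp add: algebra_simps)
    then show ?thesis using prime_dvd_mult_iff[OF ip] n2 by blast
  qed
  moreover have "int (2 * l1 + l2 + 2) = 2 * int l1 + int l2 + 2" "int (l1 + 1) = int l1 + 1"
    "int (l1 + l2 + 2) = int l1 + int l2 + 2" by simp_all
  ultimately show ?thesis using d1 by (metis int_dvd_int_iff)
qed simp

lemma weight_condition_cases:
  fixes p l1 l2 :: nat
  assumes p: "prime p" "p \<ge> 3"
    and cond: "p dvd l2 + 1 \<or> p dvd 2 * l1 + l2 + 2 \<and> (p dvd l1 + 1 \<or> p dvd l1 + l2 + 2)"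
  shows "p dvd l2 + 1 \<or> p dvd l2 \<and> p dvd l1 + 1 \<or> p dvd l2 + 2 \<and> p dvd l1"
proof -
  have "p dvd l2" if "p dvd 2 * l1 + l2 + 2" "p dvd l1 + 1"
  proof -
    have "2 * l1 + l2 + 2 = 2 * (l1 + 1) + l2" by simp
    then show ?thesis using that by (metis dvd_add_right_iff dvd_mult)
  qed
  moreover have "p dvd l1 \<and> p dvd l2 + 2" if "p dvd 2 * l1 + l2 + 2" "p dvd l1 + l2 + 2"
  proof -
    have "2 * l1 + l2 + 2 = l1 + (l1 + l2 + 2)" by simp
    then have "p dvd l1" using that by (metis dvd_add_left_iff)
    moreover have "l1 + l2 + 2 = l1 + (l2 + 2)" by simp
    ultimately show ?thesis using that by (metis dvd_add_right_iff)
  qed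
  ultimately show ?thesis using cond by blast
qed

section \<open>Polynomials in two variables\<close>

lemma infinite_alg_closed: "infinite (UNIV :: 'k::alg_closed_field set)"
proof
  assume fin: "finite (UNIV :: 'k set)"
  define q :: "'k poly" where "q = (\<Prod>x\<in>UNIV. [:- x, 1:]) + 1"
  have "degree (\<Prod>x\<in>(UNIV :: 'k set). [:- x, 1:]) = card (UNIV :: 'k set)"
    by (subst degree_prod_eq_sum_degree) auto
  moreover have "card (UNIV :: 'k set) > 0" using fin by (simp add: card_gt_0_iff)
  ultimately have "degree q > 0"
    unfolding q_def by (subst degree_add_eq_left) auto
  then obtain x where "poly q x = 0" using alg_closed_imp_poly_has_root by blast
  moreover have "poly (\<Prod>x\<in>(UNIV :: 'k set). [:- x, 1:]) x = 0"
    using fin by (simp add: poly_prod prod_zero_iff)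
  ultimately show False by (simp add: q_def)
qed

lemma poly_eqI_infinite:
  fixes f g :: "'k::field poly"
  assumes "infinite S" "\<And>x. x \<in> S \<Longrightarrow> poly f x = poly g x"
  shows "f = g"
proof (rule ccontr)
  assume "f \<noteq> g"
  then have "finite {x. poly (f - g) x = 0}" by (intro poly_roots_finite) simp
  moreover have "S \<subseteq> {x. poly (f - g) x = 0}" using assms by auto
  ultimately show False using assms finite_subset by blast
qed

text \<open>
  Multiplied by \<open>y\<^sup>d\<close> with \<open>d = deg g\<close>, the hypothesis becomes an identity of polynomials, in which degrees
  can be compared.
\<close>

lemma degree_le_of_pole_bound:
  fixes f g :: "'k::field poly"
  assumes inf: "infinite (UNIV :: 'k set)"
    and fg: "\<And>y. y \<noteq> 0 \<Longrightarrow> poly f y = y ^ m * poly g (inverse y)"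
  shows "degree f \<le> m"
proof (cases "f = 0")
  case False
  have "f * monom 1 (degree g) = monom 1 m * reflect_poly g"
  proof (rule poly_eqI_infinite)
    show "infinite (UNIV - {0 :: 'k})" using inf by simp
    fix y :: 'k assume "y \<in> UNIV - {0}"
    then show "poly (f * monom 1 (degree g)) y = poly (monom 1 m * reflect_poly g) y"
      by (simp add: poly_monom fg poly_reflect_poly_nz)
  qed
  moreover have "degree (monom 1 m * reflect_poly g) \<le> m + degree g"
    using degree_mult_le[of "monom 1 m" "reflect_poly g"] degree_reflect_poly_le[of g]
    by (simp add: degree_monom_eq)
  moreover have "degree (f * monom 1 (degree g)) = degree f + degree g"
    using False by (simp add: degree_mult_eq degree_monom_eq monom_eq_0_iff)
  ultimately show ?thesis by simp
qed simp

text \<open>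
  Polynomials in \<open>x\<close> and \<open>y\<close> are polynomials in \<open>y\<close> whose coefficients are polynomials in \<open>x\<close>.
\<close>

definition poly2 :: "'k::field poly poly \<Rightarrow> 'k \<Rightarrow> 'k \<Rightarrow> 'k" where
  "poly2 P x y = poly (poly P [:y:]) x"

lemma poly_poly_eq_poly2: "poly (poly P r) x = poly2 P x (poly r x)"
  by (induction P) (auto simp: poly2_def)

lemma poly2_eq_poly_map: "poly2 P x y = poly (map_poly (\<lambda>r. poly r x) P) y"
  by (induction P) (auto simp: poly2_def map_poly_pCons)

lemma coeff_map_eval: "coeff (map_poly (\<lambda>r. poly r x) P) n = poly (coeff P n) x"
  by (simp add: coeff_map_poly)

text \<open>
  On the line \<open>y = z x\<close> the monomials of total degree \<open>m\<close> combine to the coefficient of \<open>x\<^sup>m\<close>.  As a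
  polynomial in the slope \<open>z\<close> it still determines each of their coefficients.
\<close>

lemma coeff_restrict_to_line:
  fixes P :: "'k::field poly poly"
  shows "coeff (poly P [:0, z:]) m = poly (\<Sum>n\<le>m. monom (coeff (coeff P n) (m - n)) n) z"
proof (induction P arbitrary: m)
  case (pCons r P)
  show ?case
  proof (cases m)
    case 0
    then show ?thesis by (simp add: poly_monom)
  next
    case (Suc m')
    have "coeff (poly (pCons r P) [:0, z:]) m = coeff r m + z * coeff (poly P [:0, z:]) m'"
      by (simp add: Suc)
    also have "\<dots> = poly (\<Sum>n\<le>m. monom (coeff (coeff (pCons r P) n) (m - n)) n) z"
      unfolding pCons.IH Suc
      by (simp add: sum.atMost_Suc_shift poly_sum poly_monom sum_distrib_left algebra_simps
          del: sum.atMost_Suc)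
    finally show ?thesis .
  qed
qed simp

lemma poly2_eq_0:
  fixes P :: "'k::field poly poly"
  assumes inf: "infinite (UNIV :: 'k set)" and zero: "\<And>x y. poly2 P x y = 0"
  shows "P = 0"
proof (rule poly_eqI)
  fix n
  have "map_poly (\<lambda>r. poly r x) P = 0" for x
    using zero by (intro poly_eqI_infinite[OF inf]) (simp add: poly2_eq_poly_map[symmetric])
  then have "poly (coeff P n) x = 0" for x by (metis coeff_map_eval coeff_0)
  then show "coeff P n = coeff 0 n"
    by (intro poly_eqI_infinite[OF inf]) simp
qed

definition eval_trapezoid :: "nat \<Rightarrow> nat \<Rightarrow> (nat \<times> nat \<Rightarrow> 'k::field) \<Rightarrow> 'k \<Rightarrow> 'k \<Rightarrow> 'k" where
  "eval_trapezoid N r v x y = (\<Sum>(i, n)\<in>trapezoid N r. v (i, n) * x ^ i * y ^ n)"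

definition trapezoid_poly2 :: "nat \<Rightarrow> nat \<Rightarrow> (nat \<times> nat \<Rightarrow> 'k::field) \<Rightarrow> 'k poly poly" where
  "trapezoid_poly2 N r v = (\<Sum>(i, n)\<in>trapezoid N r. monom (monom (v (i, n)) i) n)"

lemma poly2_trapezoid: "poly2 (trapezoid_poly2 N r v) x y = eval_trapezoid N r v x y"
  by (simp add: poly2_def trapezoid_poly2_def eval_trapezoid_def poly_sum poly_monom case_prod_unfold)

lemma coeff_trapezoid_poly2:
  assumes "v \<in> trapezoid_polys N r"
  shows "coeff (coeff (trapezoid_poly2 N r v) n) i = v (i, n)"
proof -
  have "coeff (coeff (trapezoid_poly2 N r v) n) i
      = (\<Sum>t\<in>trapezoid N r. if (i, n) = t then v t else 0)"
    unfolding trapezoid_poly2_def coeff_sum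
    by (intro sum.cong refl) (auto split: if_splits)
  also have "\<dots> = v (i, n)"
    unfolding sum.delta'[OF finite_trapezoid] using assms by (auto simp: trapezoid_polys_def)
  finally show ?thesis .
qed

lemma eval_trapezoid_inject:
  fixes v w :: "nat \<times> nat \<Rightarrow> 'k::field"
  assumes inf: "infinite (UNIV :: 'k set)"
    and v: "v \<in> trapezoid_polys N r" and w: "w \<in> trapezoid_polys N r"
    and eq: "\<And>x y. eval_trapezoid N r v x y = eval_trapezoid N r w x y"
  shows "v = w"
proof -
  have "trapezoid_poly2 N r v - trapezoid_poly2 N r w = 0"
  proof (rule poly2_eq_0[OF inf])
    fix x y
    have "poly2 (P - Q) x y = poly2 P x y - poly2 Q x y" for P Q :: "'k poly poly"
      by (simp add: poly2_def)
    then show "poly2 (trapezoid_poly2 N r v - trapezoid_poly2 N r w) x y = 0"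
      using eq by (simp add: poly2_trapezoid)
  qed
  then have "trapezoid_poly2 N r v = trapezoid_poly2 N r w" by simp
  then have "v (i, n) = w (i, n)" for i n
    using coeff_trapezoid_poly2[OF v] coeff_trapezoid_poly2[OF w] by metis
  then show ?thesis by auto
qed

text \<open>
  The order of the pole along \<open>y = \<infinity>\<close> for fixed \<open>x\<close> bounds the exponent of \<open>y\<close>, and the order of the pole
  along \<open>x = \<infinity>\<close> for fixed slope \<open>y / x\<close> bounds the total degree.
\<close>

lemma eval_trapezoid_of_pole_bounds:
  fixes P Q1 Q2 :: "'k::field poly poly"
  assumes inf: "infinite (UNIV :: 'k set)"
    and y: "\<And>x y. y \<noteq> 0 \<Longrightarrow> poly2 P x y = y ^ l * poly2 Q1 (inverse y) x"
    and x: "\<And>x y. x \<noteq> 0 \<Longrightarrow> poly2 P x y = x ^ N * poly2 Q2 (inverse x) (y / x)"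
  shows "\<exists>v\<in>trapezoid_polys N (Suc l). \<forall>x y. poly2 P x y = eval_trapezoid N (Suc l) v x y"
proof -
  define v where "v = (\<lambda>(i, n). coeff (coeff P n) i)"
  have rows: "coeff P n = 0" if "l < n" for n
  proof (rule poly_eqI_infinite[OF inf])
    fix x
    have "degree (map_poly (\<lambda>r. poly r x) P) \<le> l"
      using y by (intro degree_le_of_pole_bound[OF inf, of _ _ "poly Q1 [:x:]"])
        (simp add: poly2_eq_poly_map[symmetric] poly2_def)
    then show "poly (coeff P n) x = poly 0 x"
      using that by (metis coeff_eq_0 coeff_map_eval le_less_trans poly_0)
  qed
  have diagonals: "coeff (coeff P n) i = 0" if "N < i + n" for i n
  proof -
    define A where "A = (\<Sum>k\<le>i + n. monom (coeff (coeff P k) (i + n - k)) k)"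
    have "A = 0"
    proof (rule poly_eqI_infinite[OF inf])
      fix z
      have "degree (poly P [:0, z:]) \<le> N"
        using x by (intro degree_le_of_pole_bound[OF inf, of _ _ "poly Q2 [:z:]"])
          (simp add: poly_poly_eq_poly2)
      then have "coeff (poly P [:0, z:]) (i + n) = 0"
        using that by (intro coeff_eq_0) simp
      then show "poly A z = poly 0 z"
        by (simp add: A_def coeff_restrict_to_line)
    qed
    then have "coeff A n = 0" by simp
    moreover have "coeff A n = (\<Sum>k\<le>i + n. if k = n then coeff (coeff P k) (i + n - k) else 0)"
      unfolding A_def coeff_sum by (intro sum.cong) auto
    ultimately show ?thesis by simp
  qed
  have v: "v \<in> trapezoid_polys N (Suc l)"
  proof (rule trapezoid_polysI)
    fix i n assume "v (i, n) \<noteq> 0"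
    then show "n < Suc l \<and> i + n \<le> N"
      using rows[of n] diagonals[of i n] by (fastforce simp: v_def not_less)
  qed
  have "P = trapezoid_poly2 N (Suc l) v"
    by (intro poly_eqI) (simp add: coeff_trapezoid_poly2[OF v], simp add: v_def)
  then show ?thesis
    using v by (metis poly2_trapezoid)
qed

section \<open>The Schubert surface and its big cell\<close>

lemma matrix_mult_3: "(A ** B) $ i $ j = A $ i $ 1 * B $ 1 $ j + A $ i $ 2 * B $ 2 $ j + A $ i $ 3 * B $ 3 $ j"
  for A B :: "'k::field mat3"
  by (simp add: matrix_matrix_mult_def sum_3)

abbreviation mat3_rows where
  "mat3_rows a11 a12 a13 a21 a22 a23 a31 a32 a33 \<equiv>
    (vector [vector [a11, a12, a13], vector [a21, a22, a23], vector [a31, a32, a33]] :: 'k::field mat3)"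

lemma mat3_mat_entries:
  "(mat c :: 'k::field mat3) $ 1 $ 1 = c" "(mat c :: 'k::field mat3) $ 1 $ 2 = 0" "(mat c :: 'k::field mat3) $ 1 $ 3 = 0"
  "(mat c :: 'k::field mat3) $ 2 $ 1 = 0" "(mat c :: 'k::field mat3) $ 2 $ 2 = c" "(mat c :: 'k::field mat3) $ 2 $ 3 = 0"
  "(mat c :: 'k::field mat3) $ 3 $ 1 = 0" "(mat c :: 'k::field mat3) $ 3 $ 2 = 0" "(mat c :: 'k::field mat3) $ 3 $ 3 = c"
  by (simp_all add: mat_def)

lemma borel3_iff: "b \<in> borel3 \<longleftrightarrow>
    b $ 1 $ 2 = 0 \<and> b $ 1 $ 3 = 0 \<and> b $ 2 $ 3 = 0 \<and> b $ 1 $ 1 * b $ 2 $ 2 * b $ 3 $ 3 = 1"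
  by (auto simp: borel3_def SL3_def det_3)

lemma borel3_mult: "a \<in> borel3 \<Longrightarrow> b \<in> borel3 \<Longrightarrow> a ** b \<in> borel3"
proof -
  assume a: "a \<in> borel3" and b: "b \<in> borel3"
  have "a $ 1 $ 1 * b $ 1 $ 1 * (a $ 2 $ 2 * b $ 2 $ 2) * (a $ 3 $ 3 * b $ 3 $ 3)
      = (a $ 1 $ 1 * a $ 2 $ 2 * a $ 3 $ 3) * (b $ 1 $ 1 * b $ 2 $ 2 * b $ 3 $ 3)"
    by (simp only: mult_ac)
  also have "\<dots> = 1" using a b by (simp add: borel3_iff)
  finally show ?thesis using a b by (simp add: borel3_iff matrix_mult_3)
qed

definition chart :: "'k::field \<Rightarrow> 'k \<Rightarrow> 'k mat3" where
  "chart x y = mat3_rows 0 0 1 (-1) 0 x 0 (-1) y"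

definition cell :: "'k::field mat3 set" where
  "cell = {a ** (s_alpha ** s_beta) ** b | a b. a \<in> borel3 \<and> b \<in> borel3}"

abbreviation "surface_cone \<equiv> schubert_cone (s_alpha ** s_beta)"

lemma surface_cone_eq: "surface_cone = zariski_closure cell"
  by (simp add: schubert_cone_def cell_def)

text \<open>
  The cell is \<open>U w B\<close> with \<open>U\<close> the lower unitriangular matrices.  The entry of \<open>U\<close> in position \<open>(3, 2)\<close> is
  absorbed by \<open>B\<close>, so two coordinates remain: the last column of the representative is \<open>(1, x, y)\<close>.
\<close>

lemma cell_eq: "cell = {chart x y ** b | x y b. b \<in> borel3}"
proof (intro subset_antisym subsetI)
  fix g :: "'a mat3" assume "g \<in> cell"
  then obtain a b where g: "g = a ** (s_alpha ** s_beta) ** b" and ab: "a \<in> borel3" "b \<in> borel3"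
    unfolding cell_def by blast
  define b' where "b' = mat3_rows (a $ 2 $ 2) 0 0 (a $ 3 $ 2) (a $ 3 $ 3) 0 0 0 (a $ 1 $ 1)"
  have nz: "a $ 1 $ 1 \<noteq> 0" using ab by (auto simp: borel3_iff)
  have "a ** (s_alpha ** s_beta) = chart (a $ 2 $ 1 / a $ 1 $ 1) (a $ 3 $ 1 / a $ 1 $ 1) ** b'"
    using ab nz
    by (simp add: vec_eq_iff forall_3 matrix_mult_3 chart_def b'_def s_alpha_def s_beta_def borel3_iff)
  then have "g = chart (a $ 2 $ 1 / a $ 1 $ 1) (a $ 3 $ 1 / a $ 1 $ 1) ** (b' ** b)"
    by (simp add: g matrix_mul_assoc)
  moreover have "b' ** b \<in> borel3"
    using ab by (intro borel3_mult) (auto simp: borel3_iff b'_def algebra_simps)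
  ultimately show "g \<in> {chart x y ** b | x y b. b \<in> borel3}" by blast
next
  fix g :: "'a mat3" assume "g \<in> {chart x y ** b | x y b. b \<in> borel3}"
  then obtain x y b where g: "g = chart x y ** b" and b: "b \<in> borel3" by blast
  define a where "a = mat3_rows 1 0 0 x 1 0 y 0 1"
  have "chart x y = a ** (s_alpha ** s_beta)"
    by (simp add: vec_eq_iff forall_3 matrix_mult_3 chart_def a_def s_alpha_def s_beta_def)
  moreover have "a \<in> borel3" by (simp add: borel3_iff a_def)
  ultimately have "g = a ** (s_alpha ** s_beta) ** b \<and> a \<in> borel3 \<and> b \<in> borel3"
    using b g by simp
  then show "g \<in> cell" unfolding cell_def by blast
qed

lemma poly_funs_sum: "(\<And>s. s \<in> S \<Longrightarrow> F s \<in> poly_funs) \<Longrightarrow> (\<lambda>g. \<Sum>s\<in>S. F s g) \<in> poly_funs"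
  by (induction S rule: infinite_finite_induct) (auto intro: poly_funs.intros)

lemma poly_funs_power: "F \<in> poly_funs \<Longrightarrow> (\<lambda>g. F g ^ n) \<in> poly_funs"
  by (induction n) (auto intro: poly_funs.intros)

lemma poly_funs_uminus: "F \<in> poly_funs \<Longrightarrow> (\<lambda>g. - F g) \<in> poly_funs"
  using poly_funs.mult[OF poly_funs.const[of "-1"], of F] by simp

lemma poly_funs_diff: "F \<in> poly_funs \<Longrightarrow> H \<in> poly_funs \<Longrightarrow> (\<lambda>g. F g - H g) \<in> poly_funs"
  using poly_funs.add[OF _ poly_funs_uminus, of F H] by simp

lemma poly_funs_translate: "F \<in> poly_funs \<Longrightarrow> (\<lambda>g. F (a ** g ** b)) \<in> poly_funs"
proof (induction rule: poly_funs.induct)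
  case (entry i j)
  show ?case unfolding matrix_mult_3 by (intro poly_funs.intros)
qed (auto intro: poly_funs.intros)

lemma cell_subset_cone: "cell \<subseteq> surface_cone"
  by (auto simp: surface_cone_eq zariski_closure_def)

text \<open>
  The cell is dense in its closure, so equality of regular functions may be checked on the cell.
\<close>

lemma eq_on_surface_cone:
  assumes "F \<in> poly_funs" "H \<in> poly_funs" "\<And>g. g \<in> cell \<Longrightarrow> F g = H g" "g \<in> surface_cone"
  shows "F g = H g"
  using assms(4) poly_funs_diff[OF assms(1,2)] assms(3)
  unfolding surface_cone_eq zariski_closure_def by fastforce

lemma surface_cone_translate:
  assumes "a \<in> borel3" "b \<in> borel3" "g \<in> surface_cone" shows "a ** g ** b \<in> surface_cone"
  unfolding surface_cone_eq zariski_closure_def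
proof (intro CollectI ballI impI)
  fix F :: "'a mat3 \<Rightarrow> 'a" assume F: "F \<in> poly_funs" "\<forall>s\<in>cell. F s = 0"
  have "a ** s ** b \<in> cell" if s: "s \<in> cell" for s
  proof -
    obtain a' b' where ab: "a' \<in> borel3" "b' \<in> borel3" "s = a' ** (s_alpha ** s_beta) ** b'"
      using s unfolding cell_def by blast
    have "a ** s ** b = (a ** a') ** (s_alpha ** s_beta) ** (b' ** b)"
      by (simp only: ab matrix_mul_assoc)
    then show ?thesis using borel3_mult assms ab unfolding cell_def by blast
  qed
  then show "F (a ** g ** b) = 0"
    using F(2) by (intro eq_on_surface_cone[OF poly_funs_translate[OF F(1)] poly_funs.const _ assms(3)]) simp
qed

lemma id_borel3: "mat 1 \<in> borel3"
  by (simp add: borel3_iff mat3_mat_entries)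

lemma surface_cone_right: "b \<in> borel3 \<Longrightarrow> g \<in> surface_cone \<Longrightarrow> g ** b \<in> surface_cone"
  using surface_cone_translate[OF id_borel3] by fastforce

lemma surface_cone_left: "a \<in> borel3 \<Longrightarrow> g \<in> surface_cone \<Longrightarrow> a ** g \<in> surface_cone"
  using surface_cone_translate[OF _ id_borel3] by fastforce

text \<open>
  The inverse of \<open>weight_char\<close>, written with nonnegative exponents by means of \<open>det b = 1\<close>.
\<close>

definition torus_factor :: "nat \<Rightarrow> nat \<Rightarrow> 'k::field mat3 \<Rightarrow> 'k" where
  "torus_factor l1 l2 b = b $ 3 $ 3 ^ l2 * (b $ 2 $ 2 * b $ 3 $ 3) ^ l1"

lemma inverse_weight_char:
  assumes "b \<in> borel3"
  shows "inverse (weight_char (int l1) (int l2) b) = torus_factor l1 l2 b"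
proof -
  have det: "b $ 1 $ 1 * b $ 2 $ 2 * b $ 3 $ 3 = 1" using assms by (simp add: borel3_iff)
  have w: "weight_char (int l1) (int l2) b = b $ 1 $ 1 ^ (l1 + l2) * b $ 2 $ 2 ^ l2"
    unfolding weight_char_def of_nat_add[symmetric] power_int_of_nat ..
  have "weight_char (int l1) (int l2) b * torus_factor l1 l2 b = (b $ 1 $ 1 * b $ 2 $ 2 * b $ 3 $ 3) ^ (l1 + l2)"
    unfolding w torus_factor_def by (simp add: power_add power_mult_distrib algebra_simps)
  then have "weight_char (int l1) (int l2) b * torus_factor l1 l2 b = 1" by (simp add: det)
  then show ?thesis by (metis inverse_unique)
qed

definition minor13 :: "'k::field mat3 \<Rightarrow> 'k" where
  "minor13 g = g $ 1 $ 2 * g $ 3 $ 3 - g $ 1 $ 3 * g $ 3 $ 2"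

definition minor23 :: "'k::field mat3 \<Rightarrow> 'k" where
  "minor23 g = g $ 2 $ 2 * g $ 3 $ 3 - g $ 2 $ 3 * g $ 3 $ 2"

text \<open>
  Under right multiplication by \<open>b\<close> in \<open>B\<close> the last column of \<open>g\<close> is multiplied by \<open>b\<^sub>3\<^sub>3\<close> and a minor of the last
  two columns by \<open>b\<^sub>2\<^sub>2 b\<^sub>3\<^sub>3\<close>, so a section is obtained from \<open>\<lambda>\<^sub>2\<close> entries and \<open>\<lambda>\<^sub>1\<close> minors.
  On the chart the entries are \<open>1\<close>, \<open>x\<close>, \<open>y\<close> and the minors are \<open>x\<close> and \<open>1\<close>.  To
  produce \<open>x\<^sup>i\<close> the minor is taken as often as possible and the entry for the rest;
  the condition \<open>i + n \<le> \<lambda>\<^sub>1 + \<lambda>\<^sub>2\<close> says that there are enough entries.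
\<close>

definition monomial_section :: "nat \<Rightarrow> nat \<Rightarrow> nat \<times> nat \<Rightarrow> 'k::field mat3 \<Rightarrow> 'k" where
  "monomial_section l1 l2 = (\<lambda>(i, n) g.
     g $ 1 $ 3 ^ (l2 - n - (i - l1)) * g $ 2 $ 3 ^ (i - l1) * g $ 3 $ 3 ^ n
     * minor23 g ^ min i l1 * minor13 g ^ (l1 - i))"

lemma monomial_section_poly: "monomial_section l1 l2 t \<in> poly_funs"
proof (cases t)
  case (Pair i n)
  have "minor13 \<in> poly_funs" "minor23 \<in> poly_funs"
    unfolding minor13_def[abs_def] minor23_def[abs_def] by (intro poly_funs_diff poly_funs.intros)+
  then show ?thesis
    unfolding Pair monomial_section_def prod.case by (intro poly_funs.intros poly_funs_power)
qed

lemma monomial_section_equivariant: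
  assumes t: "t \<in> trapezoid (l1 + l2) (Suc l2)" and b: "b \<in> borel3"
  shows "monomial_section l1 l2 t (g ** b) = torus_factor l1 l2 b * monomial_section l1 l2 t g"
proof -
  obtain i n where Pair: "t = (i, n)" by (cases t)
  have exps: "l2 = (l2 - n - (i - l1)) + (i - l1) + n" "l1 = min i l1 + (l1 - i)"
    using t by (auto simp: Pair trapezoid_def)
  have col: "(g ** b) $ j $ 3 = g $ j $ 3 * b $ 3 $ 3" for j
    using b by (simp add: matrix_mult_3 borel3_iff)
  have minors: "minor13 (g ** b) = minor13 g * (b $ 2 $ 2 * b $ 3 $ 3)"
    "minor23 (g ** b) = minor23 g * (b $ 2 $ 2 * b $ 3 $ 3)"
    using b by (simp_all add: minor13_def minor23_def matrix_mult_3 borel3_iff algebra_simps)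
  have "b $ 3 $ 3 ^ l2 = b $ 3 $ 3 ^ (l2 - n - (i - l1)) * b $ 3 $ 3 ^ (i - l1) * b $ 3 $ 3 ^ n"
    "(b $ 2 $ 2 * b $ 3 $ 3) ^ l1 = (b $ 2 $ 2 * b $ 3 $ 3) ^ min i l1 * (b $ 2 $ 2 * b $ 3 $ 3) ^ (l1 - i)"
    by (subst exps, simp only: power_add)+
  then show ?thesis
    unfolding torus_factor_def Pair monomial_section_def prod.case col minors power_mult_distrib
    by (simp only: mult_ac)
qed

section \<open>Sections as polynomials on the chart\<close>

lemma chart_in_cell: "chart x y \<in> cell"
proof -
  have "chart x y = chart x y ** mat 1" by simp
  then show ?thesis unfolding cell_eq using id_borel3 by blast
qed

lemma chart_in_surface_cone: "chart x y \<in> surface_cone"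
  using chart_in_cell cell_subset_cone by blast

lemma monomial_section_chart: "monomial_section l1 l2 (i, n) (chart x y) = x ^ i * y ^ n"
proof -
  have "i - l1 + min i l1 = i" by simp
  then have "x ^ i = x ^ (i - l1) * x ^ min i l1" by (metis power_add)
  then show ?thesis
    by (simp add: monomial_section_def chart_def minor13_def minor23_def mult_ac)
qed

text \<open>
  The section whose restriction to the chart has the coefficients \<open>v\<close>.
\<close>

definition section_of :: "nat \<Rightarrow> nat \<Rightarrow> (nat \<times> nat \<Rightarrow> 'k) \<Rightarrow> 'k::field mat3 \<Rightarrow> 'k" where
  "section_of l1 l2 v g = (if g \<in> surface_cone
     then \<Sum>t\<in>trapezoid (l1 + l2) (Suc l2). v t * monomial_section l1 l2 t g else 0)"

lemma section_of_chart:
  "section_of l1 l2 v (chart x y) = eval_trapezoid (l1 + l2) (Suc l2) v x y"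
  by (auto simp: section_of_def chart_in_surface_cone eval_trapezoid_def monomial_section_chart
      intro!: sum.cong)

lemma section_of_poly:
  "(\<lambda>g. \<Sum>t\<in>trapezoid (l1 + l2) (Suc l2). v t * monomial_section l1 l2 t g) \<in> poly_funs"
  by (intro poly_funs_sum poly_funs.intros monomial_section_poly)

lemma section_of_equivariant:
  assumes "b \<in> borel3" "g \<in> surface_cone"
  shows "section_of l1 l2 v (g ** b) = torus_factor l1 l2 b * section_of l1 l2 v g"
  using assms
  by (simp add: section_of_def surface_cone_right monomial_section_equivariant sum_distrib_left mult_ac)

lemma section_of_add: "section_of l1 l2 (v + w) = section_of l1 l2 v + section_of l1 l2 w"
  by (auto simp: section_of_def fun_eq_iff sum.distrib algebra_simps)

lemma section_of_scale: "section_of l1 l2 (x *f v) = x *f section_of l1 l2 v"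
  by (auto simp: section_of_def fun_eq_iff sum_distrib_left algebra_simps)

lemma section_of_in_H0: "section_of l1 l2 v \<in> H0 (s_alpha ** s_beta) (int l1) (int l2)"
  unfolding H0_def
proof (intro CollectI conjI ballI allI impI)
  show "\<exists>F\<in>poly_funs. \<forall>g\<in>surface_cone. section_of l1 l2 v g = F g"
    by (intro bexI[OF _ section_of_poly[of v l1 l2]]) (simp add: section_of_def)
  show "section_of l1 l2 v g = 0" if "g \<notin> surface_cone" for g
    using that by (simp add: section_of_def)
  show "section_of l1 l2 v (g ** b) = inverse (weight_char (int l1) (int l2) b) * section_of l1 l2 v g"
    if "g \<in> surface_cone" "b \<in> borel3" for g b
    using that by (simp add: inverse_weight_char section_of_equivariant)
qed

lemma poly_funs_poly2:
  assumes F: "F \<in> poly_funs"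
    and G: "\<And>i j. \<exists>P. \<forall>u v. G u v $ i $ j = poly2 P u v"
  shows "\<exists>P. \<forall>u v. F (G u v) = poly2 P u v"
  using F
proof (induction rule: poly_funs.induct)
  case (const c)
  have "c = poly2 [:[:c:]:] u v" for u v by (simp add: poly2_def)
  then show ?case by blast
next
  case (entry i j)
  show ?case by (rule G)
next
  case (add F H)
  then obtain P Q where "\<forall>u v. F (G u v) = poly2 P u v" "\<forall>u v. H (G u v) = poly2 Q u v" by blast
  then have "\<forall>u v. F (G u v) + H (G u v) = poly2 (P + Q) u v" by (simp add: poly2_def)
  then show ?case by blast
next
  case (mult F H)
  then obtain P Q where "\<forall>u v. F (G u v) = poly2 P u v" "\<forall>u v. H (G u v) = poly2 Q u v" by blast
  then have "\<forall>u v. F (G u v) * H (G u v) = poly2 (P * Q) u v" by (simp add: poly2_def)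
  then show ?case by blast
qed

lemma poly2_coordinates:
  "\<exists>P. \<forall>u v :: 'k. poly2 P u v = c" "\<exists>P. \<forall>u v :: 'k. poly2 P u v = u"
  "\<exists>P. \<forall>u v :: 'k. poly2 P u v = v" "\<exists>P. \<forall>u v :: 'k. poly2 P u v = v * u"
  for c :: "'k::field"
proof -
  have "poly2 [:[:c:]:] u v = c" "poly2 [:[:0, 1:]:] u v = u" "poly2 [:0, 1:] u v = v"
    "poly2 [:0, [:0, 1:]:] u v = v * u" for u v :: 'k
    by (simp_all add: poly2_def)
  then show "\<exists>P. \<forall>u v :: 'k. poly2 P u v = c" "\<exists>P. \<forall>u v :: 'k. poly2 P u v = u"
    "\<exists>P. \<forall>u v :: 'k. poly2 P u v = v" "\<exists>P. \<forall>u v :: 'k. poly2 P u v = v * u"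
    by meson+
qed

lemma H0_equivariant:
  assumes "f \<in> H0 (s_alpha ** s_beta) (int l1) (int l2)" "b \<in> borel3" "g \<in> surface_cone"
  shows "f (g ** b) = torus_factor l1 l2 b * f g"
  using assms by (simp add: H0_def inverse_weight_char)

lemma H0_eqI:
  assumes f: "f \<in> H0 (s_alpha ** s_beta) (int l1) (int l2)"
    and h: "h \<in> H0 (s_alpha ** s_beta) (int l1) (int l2)"
    and eq: "\<And>x y. f (chart x y) = h (chart x y)"
  shows "f = h"
proof
  fix g
  obtain F H where F: "F \<in> poly_funs" "\<forall>g\<in>surface_cone. f g = F g"
    and H: "H \<in> poly_funs" "\<forall>g\<in>surface_cone. h g = H g"
    using f h by (auto simp: H0_def)
  have cell: "F g = H g" if g: "g \<in> cell" for g
  proof -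
    obtain x y b where "g = chart x y ** b" "b \<in> borel3" using g unfolding cell_eq by blast
    then have "f g = h g"
      using H0_equivariant[OF f] H0_equivariant[OF h] chart_in_surface_cone eq by metis
    then show ?thesis using F H g cell_subset_cone by (metis subsetD)
  qed
  show "f g = h g"
  proof (cases "g \<in> surface_cone")
    case True
    then show ?thesis using eq_on_surface_cone[OF F(1) H(1) cell] F H by simp
  next
    case False
    then show ?thesis using f h by (simp add: H0_def)
  qed
qed

text \<open>
  The matrices \<open>G1\<close> and \<open>G2\<close> parametrize the neighbourhoods of the two curves at infinity: modulo \<open>B\<close>
  the point \<open>chart x y\<close> is \<open>G1 (1/y) x\<close> and also \<open>G2 (1/x) (y/x)\<close>.  Along them the section is
  polynomial, and the equivariance factor between the two representatives is the order of the pole that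
  is allowed.
\<close>

lemma H0_surjective:
  fixes f :: "'k::field mat3 \<Rightarrow> 'k"
  assumes inf: "infinite (UNIV :: 'k set)"
    and f: "f \<in> H0 (s_alpha ** s_beta) (int l1) (int l2)"
  shows "\<exists>v\<in>trapezoid_polys (l1 + l2) (Suc l2). f = section_of l1 l2 v"
proof -
  obtain F where F: "F \<in> poly_funs" "\<And>g. g \<in> surface_cone \<Longrightarrow> f g = F g"
    using f by (auto simp: H0_def)
  define G1 :: "'k \<Rightarrow> 'k \<Rightarrow> 'k mat3" where "G1 u x = mat3_rows 0 1 u (-1) x (x * u) 0 0 1" for u x
  define G2 :: "'k \<Rightarrow> 'k \<Rightarrow> 'k mat3" where "G2 u z = mat3_rows 1 0 u 0 0 1 0 (-1) z" for u z
  have entries: "\<exists>P. \<forall>u v. chart u v $ i $ j = poly2 P u v" "\<exists>P. \<forall>u v. G1 u v $ i $ j = poly2 P u v"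
    "\<exists>P. \<forall>u v. G2 u v $ i $ j = poly2 P u v" for i j
    using exhaust_3[of i] exhaust_3[of j]
    by (auto simp: chart_def G1_def G2_def eq_commute[of _ "poly2 _ _ _"] intro: poly2_coordinates)
  obtain P where P: "\<And>x y. F (chart x y) = poly2 P x y"
    using poly_funs_poly2[OF F(1), of chart] entries(1) by blast
  obtain Q1 where Q1: "\<And>x y. F (G1 x y) = poly2 Q1 x y"
    using poly_funs_poly2[OF F(1), of G1] entries(2) by blast
  obtain Q2 where Q2: "\<And>x y. F (G2 x y) = poly2 Q2 x y"
    using poly_funs_poly2[OF F(1), of G2] entries(3) by blast
  have translate: "F (chart x y ** b) = torus_factor l1 l2 b * poly2 P x y" if b: "b \<in> borel3" for x y b
    using H0_equivariant[OF f b chart_in_surface_cone] F(2) surface_cone_right[OF b] chart_in_surface_cone P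
    by metis
  have "poly2 P x y = y ^ l2 * poly2 Q1 (inverse y) x" if y: "y \<noteq> 0" for x y
  proof -
    define b where "b = mat3_rows 1 0 0 0 y 0 0 1 (inverse y)"
    have b: "b \<in> borel3" using y by (simp add: borel3_iff b_def)
    have "G1 (inverse y) x = chart x y ** b"
      using y by (simp add: vec_eq_iff forall_3 matrix_mult_3 G1_def chart_def b_def)
    then have "poly2 Q1 (inverse y) x = torus_factor l1 l2 b * poly2 P x y"
      using translate[OF b] Q1 by metis
    moreover have "torus_factor l1 l2 b = inverse y ^ l2"
      using y by (simp add: torus_factor_def b_def)
    ultimately show ?thesis using y by (simp add: field_simps)
  qed
  moreover have "poly2 P x y = x ^ (l1 + l2) * poly2 Q2 (inverse x) (y / x)" if x: "x \<noteq> 0" for x y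
  proof -
    define b where "b = mat3_rows x 0 0 y 1 0 1 0 (inverse x)"
    have b: "b \<in> borel3" using x by (simp add: borel3_iff b_def)
    have "G2 (inverse x) (y / x) = chart x y ** b"
      using x by (simp add: vec_eq_iff forall_3 matrix_mult_3 G2_def chart_def b_def field_simps)
    then have "poly2 Q2 (inverse x) (y / x) = torus_factor l1 l2 b * poly2 P x y"
      using translate[OF b] Q2 by metis
    moreover have "torus_factor l1 l2 b = inverse x ^ (l1 + l2)"
      using x by (simp add: torus_factor_def b_def power_add mult.commute)
    ultimately show ?thesis using x by (simp add: field_simps)
  qed
  ultimately obtain v where v: "v \<in> trapezoid_polys (l1 + l2) (Suc l2)"
    "\<And>x y. poly2 P x y = eval_trapezoid (l1 + l2) (Suc l2) v x y"
    using eval_trapezoid_of_pole_bounds[OF inf] by metis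
  have "f = section_of l1 l2 v"
    using v(2) P F(2)[OF chart_in_surface_cone]
    by (intro H0_eqI[OF f section_of_in_H0]) (simp add: section_of_chart)
  then show ?thesis using v(1) by blast
qed

lemma section_of_bij:
  assumes inf: "infinite (UNIV :: 'k::field set)"
  shows "bij_betw (section_of l1 l2) (trapezoid_polys (l1 + l2) (Suc l2) :: (_ \<Rightarrow> 'k) set)
    (H0 (s_alpha ** s_beta) (int l1) (int l2))"
proof (rule bij_betwI')
  fix v w :: "nat \<times> nat \<Rightarrow> 'k"
  assume vw: "v \<in> trapezoid_polys (l1 + l2) (Suc l2)" "w \<in> trapezoid_polys (l1 + l2) (Suc l2)"
  show "section_of l1 l2 v = section_of l1 l2 w \<longleftrightarrow> v = w"
    using eval_trapezoid_inject[OF inf vw] section_of_chart by metis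
next
  show "section_of l1 l2 v \<in> H0 (s_alpha ** s_beta) (int l1) (int l2)" for v :: "_ \<Rightarrow> 'k"
    by (rule section_of_in_H0)
next
  show "\<exists>v\<in>trapezoid_polys (l1 + l2) (Suc l2). f = section_of l1 l2 v"
    if "f \<in> H0 (s_alpha ** s_beta) (int l1) (int l2)" for f :: "'k mat3 \<Rightarrow> 'k"
    by (rule H0_surjective[OF inf that])
qed

section \<open>The action of the Lie algebra\<close>

text \<open>
  The inverse \<open>1 - t x + t\<^sup>2 x\<^sup>2\<close> of \<open>1 + t x\<close> for \<open>x\<close> in \<open>\<uu>\<close>.
\<close>

definition unipotent_inverse :: "'k::field mat3 \<Rightarrow> 'k \<Rightarrow> 'k mat3" where
  "unipotent_inverse x t = mat3_rows 1 0 0 (- t * x $ 2 $ 1) 1 0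
     (- t * x $ 3 $ 1 + t\<^sup>2 * (x $ 3 $ 2 * x $ 2 $ 1)) (- t * x $ 3 $ 2) 1"

lemma lie_u_zeros:
  assumes "x \<in> lie_u"
  shows "x $ 1 $ 1 = 0" "x $ 2 $ 2 = 0" "x $ 3 $ 3 = 0" "x $ 1 $ 2 = 0" "x $ 1 $ 3 = 0" "x $ 2 $ 3 = 0"
  using assms by (auto simp: lie_u_def)

lemma matrix_inv_unipotent:
  assumes x: "x \<in> lie_u"
  shows "matrix_inv (mat 1 + mat t ** x) = unipotent_inverse x t"
proof -
  let ?A = "mat 1 + mat t ** x" and ?B = "unipotent_inverse x t"
  have "?A ** ?B = mat 1" "?B ** ?A = mat 1"
    by (simp_all add: vec_eq_iff forall_3 matrix_mult_3 mat3_mat_entries unipotent_inverse_def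
        lie_u_zeros[OF x] algebra_simps power2_eq_square)
  then have "?A ** matrix_inv ?A = mat 1"
    by (metis (mono_tags, lifting) matrix_inv_def someI_ex)
  then have "?B ** (?A ** matrix_inv ?A) = ?B" by simp
  then show ?thesis using \<open>?B ** ?A = mat 1\<close> by (simp add: matrix_mul_assoc)
qed

lemma unipotent_inverse_borel: "unipotent_inverse x t \<in> borel3"
  by (simp add: borel3_iff unipotent_inverse_def)

lemma one_plus_unipotent:
  assumes "x \<in> lie_u"
  shows "(mat 1 + mat t ** x) ** unipotent_inverse x t = mat 1" "mat 1 + mat t ** x \<in> borel3"
  by (simp_all add: vec_eq_iff forall_3 matrix_mult_3 mat3_mat_entries unipotent_inverse_def
        lie_u_zeros[OF assms] algebra_simps power2_eq_square borel3_iff)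

text \<open>
  The coefficients with respect to \<open>t\<close> are again polynomial functions of \<open>g\<close>, so the action of \<open>\<uu>\<close>
  preserves regularity and can be computed on the cell.
\<close>

lemma poly_funs_along_curve:
  fixes F :: "'k::field mat3 \<Rightarrow> 'k"
  assumes x: "x \<in> lie_u" and F: "F \<in> poly_funs"
  shows "\<exists>Q. (\<forall>g t. poly (Q g) t = F (unipotent_inverse x t ** g)) \<and>
    (\<forall>i. (\<lambda>g. coeff (Q g) i) \<in> poly_funs)"
  using F
proof (induction rule: poly_funs.induct)
  case (const c)
  show ?case
    by (rule exI[of _ "\<lambda>_. [:c:]"]) (auto intro: poly_funs.intros)
next
  case (entry i j)
  define Q where "Q g = [:g $ i $ j, - (x ** g) $ i $ j, (x ** (x ** g)) $ i $ j:]" for g :: "'k mat3"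
  have "poly (Q g) t = (unipotent_inverse x t ** g) $ i $ j" for g t
    using exhaust_3[of i]
    by (auto simp: Q_def matrix_mult_3 unipotent_inverse_def lie_u_zeros[OF x] algebra_simps power2_eq_square)
  moreover have "(\<lambda>g. coeff (Q g) n) \<in> poly_funs" for n
  proof -
    have cases: "(\<lambda>g. coeff (Q g) n) = (\<lambda>g. g $ i $ j) \<or> (\<lambda>g. coeff (Q g) n) = (\<lambda>g. - (x ** g) $ i $ j)
      \<or> (\<lambda>g. coeff (Q g) n) = (\<lambda>g. (x ** (x ** g)) $ i $ j) \<or> (\<lambda>g. coeff (Q g) n) = (\<lambda>g. 0)"
      unfolding Q_def coeff_pCons by (cases n; cases "n - 1"; cases "n - 2") (auto split: nat.splits)
    have "(\<lambda>g. (x ** (x ** g)) $ i $ j) \<in> poly_funs" "(\<lambda>g. - (x ** g) $ i $ j) \<in> poly_funs"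
      unfolding matrix_mult_3 by (intro poly_funs_uminus poly_funs.intros)+
    then show ?thesis using cases poly_funs.intros(1,2) by metis
  qed
  ultimately show ?case by blast
next
  case (add F H)
  then obtain P Q where "\<forall>g t. poly (P g) t = F (unipotent_inverse x t ** g)" "\<forall>i. (\<lambda>g. coeff (P g) i) \<in> poly_funs"
    "\<forall>g t. poly (Q g) t = H (unipotent_inverse x t ** g)" "\<forall>i. (\<lambda>g. coeff (Q g) i) \<in> poly_funs" by blast
  then show ?case
    by (intro exI[of _ "\<lambda>g. P g + Q g"]) (auto intro: poly_funs.intros)
next
  case (mult F H)
  then obtain P Q where "\<forall>g t. poly (P g) t = F (unipotent_inverse x t ** g)" "\<forall>i. (\<lambda>g. coeff (P g) i) \<in> poly_funs"
    "\<forall>g t. poly (Q g) t = H (unipotent_inverse x t ** g)" "\<forall>i. (\<lambda>g. coeff (Q g) i) \<in> poly_funs" by blast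
  then show ?case
    by (intro exI[of _ "\<lambda>g. P g * Q g"]) (auto simp: coeff_mult intro!: poly_funs_sum poly_funs.intros)
qed

lemma lie_act_eqI:
  assumes inf: "infinite (UNIV :: 'k::field set)" and x: "x \<in> (lie_u :: 'k mat3 set)"
    and q: "\<And>t. poly q t = f (unipotent_inverse x t ** g)"
  shows "lie_act x f g = coeff q 1"
proof -
  have "(THE q. \<forall>t. poly q t = left_translate (mat 1 + mat t ** x) f g) = q"
  proof (rule the_equality)
    show "\<forall>t. poly q t = left_translate (mat 1 + mat t ** x) f g"
      using q by (simp add: left_translate_def matrix_inv_unipotent[OF x])
    show "r = q" if "\<forall>t. poly r t = left_translate (mat 1 + mat t ** x) f g" for r
      using that q by (intro poly_eqI_infinite[OF inf])
        (simp add: left_translate_def matrix_inv_unipotent[OF x])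
  qed
  then show ?thesis by (simp add: lie_act_def)
qed

lemma coeff_1_power: "coeff (q ^ n) 1 = of_nat n * coeff q 0 ^ (n - 1) * coeff q 1"
  for q :: "'k::field poly"
proof (induction n)
  case (Suc n)
  have "coeff (q ^ Suc n) 1 = coeff q 0 * coeff (q ^ n) 1 + coeff q 1 * coeff q 0 ^ n"
    by (simp add: coeff_mult coeff_0_power)
  then show ?case using Suc by (cases n) (simp_all add: algebra_simps)
qed simp

lemma plane_field_basis_monomial:
  "plane_field a b c (basis_monomial (i, n)) = (a * of_nat i) *f basis_monomial (i - 1, n)
     + (b * of_nat n) *f basis_monomial (Suc i, n - 1) + (c * of_nat n) *f basis_monomial (i, n - 1)"
proof
  fix t :: "nat \<times> nat"
  obtain j m where t: "t = (j, m)" by (cases t)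
  show "plane_field a b c (basis_monomial (i, n)) t = ((a * of_nat i) *f basis_monomial (i - 1, n)
     + (b * of_nat n) *f basis_monomial (Suc i, n - 1) + (c * of_nat n) *f basis_monomial (i, n - 1)) t"
    by (cases i; cases n; cases j) (auto simp: plane_field_def basis_monomial_def t)
qed

lemma eval_trapezoid_basis_monomial:
  "t \<in> trapezoid N r \<Longrightarrow> eval_trapezoid N r (basis_monomial t) x y = x ^ fst t * y ^ snd t"
proof -
  assume t: "t \<in> trapezoid N r"
  have "eval_trapezoid N r (basis_monomial t) x y
      = (\<Sum>s\<in>trapezoid N r. if s = t then x ^ fst s * y ^ snd s else 0)"
    unfolding eval_trapezoid_def by (intro sum.cong) (auto simp: basis_monomial_def)
  then show ?thesis using t by (simp add: finite_trapezoid)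
qed

lemma eval_trapezoid_add: "eval_trapezoid N r (v + w) x y = eval_trapezoid N r v x y + eval_trapezoid N r w x y"
  by (simp add: eval_trapezoid_def sum.distrib[symmetric] case_prod_unfold algebra_simps)

lemma eval_trapezoid_scale: "eval_trapezoid N r (a *f v) x y = a * eval_trapezoid N r v x y"
  by (simp add: eval_trapezoid_def sum_distrib_left case_prod_unfold algebra_simps)

lemma eval_plane_field_basis_monomial:
  assumes t: "(i, n) \<in> trapezoid N r"
  shows "eval_trapezoid N r (plane_field a b c (basis_monomial (i, n))) x y
    = a * of_nat i * x ^ (i - 1) * y ^ n + of_nat n * (b * x + c) * x ^ i * y ^ (n - 1)"
proof -
  have "(i - 1, n) \<in> trapezoid N r" "(i, n - 1) \<in> trapezoid N r"
    "n \<noteq> 0 \<Longrightarrow> (Suc i, n - 1) \<in> trapezoid N r"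
    using t by (auto simp: trapezoid_def)
  then show ?thesis
    unfolding plane_field_basis_monomial eval_trapezoid_add eval_trapezoid_scale
    by (cases "n = 0") (simp_all add: eval_trapezoid_basis_monomial algebra_simps)
qed

lemma section_of_0: "section_of l1 l2 0 = 0"
  by (auto simp: section_of_def fun_eq_iff)

lemma section_of_sum: "section_of l1 l2 (\<Sum>s\<in>S. f s) = (\<Sum>s\<in>S. section_of l1 l2 (f s))"
  by (induction S rule: infinite_finite_induct)
    (simp_all only: sum.infinite sum.empty sum.insert section_of_0 section_of_add simp_thms)

lemma eval_trapezoid_sum: "eval_trapezoid N r (\<Sum>s\<in>S. f s) x y = (\<Sum>s\<in>S. eval_trapezoid N r (f s) x y)"
proof (induction S rule: infinite_finite_induct)
  case (insert s S)
  then show ?case by (simp only: sum.insert eval_trapezoid_add simp_thms)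
qed (simp_all add: eval_trapezoid_def)

lemma (in plane_vector_field) eval_trapezoid_D:
  assumes "v \<in> trapezoid_polys N r"
  shows "eval_trapezoid N r (D v) x y = (\<Sum>(i, n)\<in>trapezoid N r. v (i, n) *
    (a * of_nat i * x ^ (i - 1) * y ^ n + of_nat n * (b * x + c) * x ^ i * y ^ (n - 1)))"
proof -
  have "D v = (\<Sum>t\<in>trapezoid N r. v t *f D (basis_monomial t))"
    using D_pow_sum[of 1 "\<lambda>t. v t *f basis_monomial t" "trapezoid N r"] expand_unit_polys[OF assms]
    by (simp add: D_scale)
  then have "eval_trapezoid N r (D v) x y = (\<Sum>t\<in>trapezoid N r. v t * eval_trapezoid N r (D (basis_monomial t)) x y)"
    by (simp only: eval_trapezoid_sum eval_trapezoid_scale)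
  also have "\<dots> = (\<Sum>(i, n)\<in>trapezoid N r. v (i, n) *
    (a * of_nat i * x ^ (i - 1) * y ^ n + of_nat n * (b * x + c) * x ^ i * y ^ (n - 1)))"
    by (intro sum.cong) (auto simp: eval_plane_field_basis_monomial)
  finally show ?thesis .
qed

lemma monomial_section_translate:
  "monomial_section l1 l2 (i, n) (unipotent_inverse x t ** chart u v)
    = (u - t * x $ 2 $ 1) ^ i * (v - t * (x $ 3 $ 2 * u + x $ 3 $ 1) + t\<^sup>2 * (x $ 3 $ 2 * x $ 2 $ 1)) ^ n"
proof -
  define u' where "u' = u - t * x $ 2 $ 1"
  define v' where "v' = v - t * (x $ 3 $ 2 * u + x $ 3 $ 1) + t\<^sup>2 * (x $ 3 $ 2 * x $ 2 $ 1)"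
  have "monomial_section l1 l2 (i, n) (unipotent_inverse x t ** chart u v)
      = monomial_section l1 l2 (i, n) (chart u' v')"
    unfolding monomial_section_def prod.case minor13_def minor23_def
    by (simp add: matrix_mult_3 unipotent_inverse_def chart_def u'_def v'_def algebra_simps)
  then show ?thesis by (simp only: monomial_section_chart u'_def v'_def)
qed

text \<open>
  Left multiplication by \<open>(1 + t x)\<^sup>-\<^sup>1\<close> moves the point \<open>(u, w)\<close> of the chart to
  \<open>(u - t x\<^sub>2\<^sub>1, w - t (x\<^sub>3\<^sub>2 u + x\<^sub>3\<^sub>1) + t\<^sup>2 x\<^sub>3\<^sub>2 x\<^sub>2\<^sub>1)\<close>, whose derivative at \<open>t = 0\<close> is the vector field.  Both
  sides are regular and equivariant, so it suffices to compare them there.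
\<close>

lemma lie_act_section_of:
  fixes x :: "'k::field mat3"
  assumes char: "CHAR('k) = p" "p \<ge> 3" and inf: "infinite (UNIV :: 'k set)"
    and x: "x \<in> lie_u" and v: "v \<in> trapezoid_polys (l1 + l2) (Suc l2)"
  shows "lie_act x (section_of l1 l2 v)
    = section_of l1 l2 (plane_field (- x $ 2 $ 1) (- x $ 3 $ 2) (- x $ 3 $ 1) v)"
proof
  fix g
  interpret plane_vector_field p "- x $ 2 $ 1" "- x $ 3 $ 2" "- x $ 3 $ 1"
    by unfold_locales (use char in auto)
  let ?T = "trapezoid (l1 + l2) (Suc l2)"
  define F where "F g = (\<Sum>t\<in>?T. v t * monomial_section l1 l2 t g)" for g
  define H where "H g = (\<Sum>t\<in>?T. D v t * monomial_section l1 l2 t g)" for g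
  have F: "F \<in> poly_funs" and H: "H \<in> poly_funs"
    unfolding F_def[abs_def] H_def[abs_def] by (rule section_of_poly)+
  have sF: "section_of l1 l2 v g = F g" and sH: "section_of l1 l2 (D v) g = H g" if "g \<in> surface_cone" for g
    using that by (simp_all add: section_of_def F_def H_def)
  obtain Q where Q: "\<And>g t. poly (Q g) t = F (unipotent_inverse x t ** g)"
    "\<And>i. (\<lambda>g. coeff (Q g) i) \<in> poly_funs"
    using poly_funs_along_curve[OF x F] by blast
  have lie: "lie_act x (section_of l1 l2 v) g = coeff (Q g) 1" if "g \<in> surface_cone" for g
    using that by (intro lie_act_eqI[OF inf x]) (simp add: Q sF surface_cone_left unipotent_inverse_borel)
  have chart_coeff: "coeff (Q (chart u w)) 1 = eval_trapezoid (l1 + l2) (Suc l2) (D v) u w" for u w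
  proof -
    let ?q1 = "[:u, - x $ 2 $ 1:]"
    let ?q2 = "[:w, - (x $ 3 $ 2 * u + x $ 3 $ 1), x $ 3 $ 2 * x $ 2 $ 1:]"
    have "Q (chart u w) = (\<Sum>(i, n)\<in>?T. Polynomial.smult (v (i, n)) (?q1 ^ i * ?q2 ^ n))"
    proof (rule poly_eqI_infinite[OF inf])
      fix t
      have "poly (Q (chart u w)) t = (\<Sum>(i, n)\<in>?T. v (i, n) *
          ((u - t * x $ 2 $ 1) ^ i * (w - t * (x $ 3 $ 2 * u + x $ 3 $ 1) + t\<^sup>2 * (x $ 3 $ 2 * x $ 2 $ 1)) ^ n))"
        unfolding Q F_def by (intro sum.cong) (auto simp: monomial_section_translate)
      also have "\<dots> = poly (\<Sum>(i, n)\<in>?T. Polynomial.smult (v (i, n)) (?q1 ^ i * ?q2 ^ n)) t"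
        by (simp add: poly_sum case_prod_unfold algebra_simps power2_eq_square)
      finally show "poly (Q (chart u w)) t = poly (\<Sum>(i, n)\<in>?T. Polynomial.smult (v (i, n)) (?q1 ^ i * ?q2 ^ n)) t" .
    qed
    moreover have "coeff (?q1 ^ i * ?q2 ^ n) 1 = - x $ 2 $ 1 * of_nat i * u ^ (i - 1) * w ^ n
        + of_nat n * (- x $ 3 $ 2 * u + - x $ 3 $ 1) * u ^ i * w ^ (n - 1)" for i n
    proof -
      have product: "coeff (f * g) 1 = coeff f 0 * coeff g 1 + coeff f 1 * coeff g 0" for f g :: "'k poly"
        by (simp add: coeff_mult)
      show ?thesis
        unfolding product coeff_1_power coeff_0_power by (simp add: algebra_simps)
    qed
    ultimately show ?thesis
      unfolding eval_trapezoid_D[OF v] by (simp add: coeff_sum case_prod_unfold)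
  qed
  have cell: "coeff (Q g) 1 = H g" if g: "g \<in> cell" for g
  proof -
    obtain u w b where g: "g = chart u w ** b" and b: "b \<in> borel3" using g unfolding cell_eq by blast
    have "Q g = Polynomial.smult (torus_factor l1 l2 b) (Q (chart u w))"
    proof (rule poly_eqI_infinite[OF inf])
      fix t
      let ?h = "unipotent_inverse x t ** chart u w"
      have h: "?h \<in> surface_cone" by (intro surface_cone_left unipotent_inverse_borel chart_in_surface_cone)
      have "poly (Q g) t = F (?h ** b)" by (simp add: Q g matrix_mul_assoc)
      also have "\<dots> = torus_factor l1 l2 b * F ?h"
        using section_of_equivariant[OF b h, of l1 l2 v] sF[OF h] sF[OF surface_cone_right[OF b h]] by simp
      finally show "poly (Q g) t = poly (Polynomial.smult (torus_factor l1 l2 b) (Q (chart u w))) t"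
        by (simp add: Q)
    qed
    then have "coeff (Q g) 1 = torus_factor l1 l2 b * eval_trapezoid (l1 + l2) (Suc l2) (D v) u w"
      by (simp only: coeff_smult chart_coeff)
    also have "\<dots> = section_of l1 l2 (D v) g"
      unfolding g section_of_equivariant[OF b chart_in_surface_cone] section_of_chart ..
    also have "\<dots> = H g"
      using that cell_subset_cone by (intro sH) blast
    finally show ?thesis .
  qed
  show "lie_act x (section_of l1 l2 v) g = section_of l1 l2 (D v) g"
  proof (cases "g \<in> surface_cone")
    case True
    then show ?thesis using lie sH eq_on_surface_cone[OF Q(2) H cell] by simp
  next
    case False
    have "unipotent_inverse x t ** g \<notin> surface_cone" for t
    proof
      assume "unipotent_inverse x t ** g \<in> surface_cone"
      then have "(mat 1 + mat t ** x) ** (unipotent_inverse x t ** g) \<in> surface_cone"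
        by (rule surface_cone_left[OF one_plus_unipotent(2)[OF x]])
      then show False
        using False by (simp add: matrix_mul_assoc one_plus_unipotent[OF x])
    qed
    then have "lie_act x (section_of l1 l2 v) g = coeff 0 1"
      by (intro lie_act_eqI[OF inf x]) (simp add: section_of_def)
    then show ?thesis using False by (simp add: section_of_def)
  qed
qed

section \<open>The module of sections over a line in the Lie algebra\<close>

text \<open>
  The module \<open>M(\<lambda>)\<close> over the restricted enveloping algebra of the line spanned by \<open>x\<close>.  The signs of
  the entries come from the inverse in \<open>left_translate\<close>.
\<close>

locale demazure_module =
  fixes p l1 l2 :: nat and x :: "'k::alg_closed_field mat3"
  assumes char: "CHAR('k) = p" and p3: "p \<ge> 3" and x: "x \<in> lie_u"
begin

sublocale plane_vector_field p "- x $ 2 $ 1" "- x $ 3 $ 2" "- x $ 3 $ 1"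
  by unfold_locales (rule char p3)+

abbreviation "W \<equiv> trapezoid_polys (l1 + l2) (Suc l2) :: (nat \<times> nat \<Rightarrow> 'k) set"
abbreviation "M \<equiv> H0 (s_alpha ** s_beta) (int l1) (int l2) :: ('k mat3 \<Rightarrow> 'k) set"
abbreviation "\<Phi> \<equiv> section_of l1 l2 :: _ \<Rightarrow> 'k mat3 \<Rightarrow> 'k"

lemma \<Phi>_bij: "bij_betw \<Phi> W M"
  by (rule section_of_bij[OF infinite_alg_closed])

lemma M_image: "M = \<Phi> ` W"
  using \<Phi>_bij by (simp add: bij_betw_def)

lemma \<Phi>_inj: "v \<in> W \<Longrightarrow> w \<in> W \<Longrightarrow> \<Phi> v = \<Phi> w \<Longrightarrow> v = w"
  using \<Phi>_bij by (auto simp: bij_betw_def inj_on_def)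

lemma lie_act_\<Phi>: "v \<in> W \<Longrightarrow> lie_act x (\<Phi> v) = \<Phi> (D v)"
  by (rule lie_act_section_of[OF char p3 infinite_alg_closed x])

lemma lie_act_pow_\<Phi>: "v \<in> W \<Longrightarrow> (lie_act x ^^ j) (\<Phi> v) = \<Phi> ((D ^^ j) v)"
  by (induction j) (simp_all only: funpow.simps id_apply comp_apply lie_act_\<Phi> D_pow_closed)

sublocale module: nilpotent_operator M "lie_act x" p
proof
  show "fun_space.subspace M"
  proof (rule fun_space.subspaceI)
    show "0 \<in> M" using section_of_in_H0[of l1 l2 0] unfolding section_of_0 .
    show "f + h \<in> M" if fh: "f \<in> M" "h \<in> M" for f h
    proof -
      obtain v w where "f = \<Phi> v" "h = \<Phi> w" using fh unfolding M_image by blast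
      then have "f + h = \<Phi> (v + w)" by (simp only: section_of_add)
      then show ?thesis using section_of_in_H0 by simp
    qed
    show "c *f f \<in> M" if f: "f \<in> M" for c f
    proof -
      obtain v where "f = \<Phi> v" using f unfolding M_image by blast
      then have "c *f f = \<Phi> (c *f v)" by (simp only: section_of_scale)
      then show ?thesis using section_of_in_H0 by simp
    qed
  qed
  show "\<exists>S. finite S \<and> S \<subseteq> M \<and> M \<subseteq> fun_space.span S"
  proof (intro exI conjI)
    let ?S = "\<Phi> ` basis_monomial ` trapezoid (l1 + l2) (Suc l2)"
    show "finite ?S" by (intro finite_imageI finite_trapezoid)
    show "?S \<subseteq> M" using section_of_in_H0 by blast
    show "M \<subseteq> fun_space.span ?S"
    proof
      fix f assume "f \<in> M"
      then obtain v where v: "v \<in> W" "f = \<Phi> v" unfolding M_image by blast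
      have "\<Phi> v = (\<Sum>t\<in>trapezoid (l1 + l2) (Suc l2). v t *f \<Phi> (basis_monomial t))"
        using arg_cong[OF expand_unit_polys[OF v(1)], of \<Phi>]
        by (simp only: section_of_sum section_of_scale)
      also have "\<dots> \<in> fun_space.span ?S"
        by (intro fun_space.span_sum fun_space.span_scale fun_space.span_base) blast
      finally show "f \<in> fun_space.span ?S" using v by simp
    qed
  qed
  show "lie_act x f \<in> M" if f: "f \<in> M" for f
  proof -
    obtain v where "v \<in> W" "f = \<Phi> v" using f unfolding M_image by blast
    then show ?thesis using section_of_in_H0 by (simp only: lie_act_\<Phi>)
  qed
  show "lie_act x (f + h) = lie_act x f + lie_act x h" if fh: "f \<in> M" "h \<in> M" for f h
  proof -
    obtain v w where vw: "v \<in> W" "w \<in> W" and f: "f = \<Phi> v" "h = \<Phi> w" using fh unfolding M_image by blast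
    have "lie_act x (\<Phi> v + \<Phi> w) = \<Phi> (D (v + w))"
      unfolding section_of_add[symmetric] by (rule lie_act_\<Phi>[OF trapezoid_polys_closed(1)[OF vw]])
    then show ?thesis unfolding f lie_act_\<Phi>[OF vw(1)] lie_act_\<Phi>[OF vw(2)] D_add section_of_add .
  qed
  show "lie_act x (c *f f) = c *f lie_act x f" if f: "f \<in> M" for c f
  proof -
    obtain v where v: "v \<in> W" "f = \<Phi> v" using f unfolding M_image by blast
    have "lie_act x (c *f \<Phi> v) = \<Phi> (D (c *f v))"
      unfolding section_of_scale[symmetric] by (rule lie_act_\<Phi>[OF trapezoid_polys_closed(3)[OF v(1)]])
    then show ?thesis unfolding v(2) lie_act_\<Phi>[OF v(1)] D_scale section_of_scale .
  qed
  show "(lie_act x ^^ p) f = 0" if f: "f \<in> M" for f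
  proof -
    obtain v where v: "v \<in> W" "f = \<Phi> v" using f unfolding M_image by blast
    show ?thesis unfolding v(2) lie_act_pow_\<Phi>[OF v(1)] D_nilpotent[OF v(1)] section_of_0 ..
  qed
  show "2 \<le> p" using p3 by simp
qed

abbreviation "is_projective \<equiv> projective_module (truncated_poly_ring p) (operator_module M (lie_act x))"

lemma kernel_lift_of_projective:
  assumes "is_projective" and v: "v \<in> W" "D v = 0"
  shows "\<exists>w\<in>W. (D ^^ (p - 1)) w = v"
proof -
  have "lie_act x (\<Phi> v) = 0" unfolding lie_act_\<Phi>[OF v(1)] v(2) by (rule section_of_0)
  then obtain f where f: "f \<in> M" "(lie_act x ^^ (p - 1)) f = \<Phi> v"
    using module.kernel_subset_image_of_projective[OF assms(1)] v(1) section_of_in_H0 by blast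
  then obtain w where w: "w \<in> W" "f = \<Phi> w" unfolding M_image by blast
  then have "\<Phi> ((D ^^ (p - 1)) w) = \<Phi> v" using f lie_act_pow_\<Phi> by metis
  then have "(D ^^ (p - 1)) w = v" using \<Phi>_inj D_pow_closed w v by metis
  then show ?thesis using w by blast
qed

lemma projective_of_kernel_exact:
  assumes "kernel_exact W {0}"
  shows "is_projective"
proof (rule module.projective_of_kernel_subset_image)
  fix f assume f: "f \<in> M" "lie_act x f = 0"
  then obtain v where v: "v \<in> W" "f = \<Phi> v" unfolding M_image by blast
  have "\<Phi> (D v) = \<Phi> 0" using f lie_act_\<Phi>[OF v(1)] v(2) section_of_0 by metis
  then have "D v \<in> {0}" using \<Phi>_inj[OF D_closed[OF v(1)] trapezoid_polys_closed(4)] by blast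
  then obtain w where w: "w \<in> W" "v - (D ^^ (p - 1)) w \<in> {0}"
    using assms v(1) unfolding kernel_exact_def by blast
  then have "(D ^^ (p - 1)) w = v" by simp
  then have "(lie_act x ^^ (p - 1)) (\<Phi> w) = f" using lie_act_pow_\<Phi>[OF w(1)] v(2) by simp
  then show "\<exists>h\<in>M. (lie_act x ^^ (p - 1)) h = f" using section_of_in_H0 by blast
qed

lemma higman_on_trapezoid:
  assumes "is_projective"
  obtains E where "linear_on_trapezoid (l1 + l2) (Suc l2) E"
    "\<And>v. v \<in> W \<Longrightarrow> v = (\<Sum>j<p. (D ^^ j) (E ((D ^^ (p - 1 - j)) v)))"
proof -
  obtain E where E: "\<And>f. f \<in> M \<Longrightarrow> E f \<in> M"
    "\<And>f h. f \<in> M \<Longrightarrow> h \<in> M \<Longrightarrow> E (f + h) = E f + E h"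
    "\<And>c f. f \<in> M \<Longrightarrow> E (c *f f) = c *f E f"
    "\<And>f. f \<in> M \<Longrightarrow> f = (\<Sum>j<p. (lie_act x ^^ j) (E ((lie_act x ^^ (p - 1 - j)) f)))"
    by (rule module.higman_of_projective[OF assms]) (rule that)
  define E' where "E' v = inv_into W \<Phi> (E (\<Phi> v))" for v
  have E': "E' v \<in> W" "\<Phi> (E' v) = E (\<Phi> v)" for v
  proof -
    have "E (\<Phi> v) \<in> \<Phi> ` W" using E(1)[OF section_of_in_H0] M_image by blast
    then show "E' v \<in> W" "\<Phi> (E' v) = E (\<Phi> v)"
      unfolding E'_def by (rule inv_into_into, rule f_inv_into_f)
  qed
  show ?thesis
  proof (rule that)
    show "linear_on_trapezoid (l1 + l2) (Suc l2) E'"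
      unfolding linear_on_trapezoid_def
    proof (intro conjI ballI allI)
      fix v w assume vw: "v \<in> W" "w \<in> W"
      have "\<Phi> (E' (v + w)) = \<Phi> (E' v + E' w)"
        unfolding E' section_of_add by (rule E(2)[OF section_of_in_H0 section_of_in_H0])
      then show "E' (v + w) = E' v + E' w"
        by (rule \<Phi>_inj[OF E'(1) trapezoid_polys_closed(1)[OF E'(1) E'(1)]])
    next
      fix c v assume v: "v \<in> W"
      have "\<Phi> (E' (c *f v)) = \<Phi> (c *f E' v)"
        unfolding E' section_of_scale by (rule E(3)[OF section_of_in_H0])
      then show "E' (c *f v) = c *f E' v"
        by (rule \<Phi>_inj[OF E'(1) trapezoid_polys_closed(3)[OF E'(1)]])
    qed (rule E'(1))
    fix v assume v: "v \<in> W"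
    have "\<Phi> v = (\<Sum>j<p. \<Phi> ((D ^^ j) (E' ((D ^^ (p - 1 - j)) v))))"
      by (subst E(4)[OF section_of_in_H0])
        (simp add: lie_act_pow_\<Phi>[OF v] E'(2)[symmetric] lie_act_pow_\<Phi>[OF E'(1)])
    also have "\<dots> = \<Phi> (\<Sum>j<p. (D ^^ j) (E' ((D ^^ (p - 1 - j)) v)))"
      by (rule section_of_sum[symmetric])
    finally show "v = (\<Sum>j<p. (D ^^ j) (E' ((D ^^ (p - 1 - j)) v)))"
      by (rule \<Phi>_inj[OF v trapezoid_polys_closed(5)[OF D_pow_closed[OF E'(1)]]])
  qed
qed

lemma not_projective_horizontal:
  assumes "x $ 2 $ 1 = 0" "x \<noteq> 0" shows "\<not> is_projective"
proof
  assume proj: is_projective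
  have "x $ 3 $ 2 \<noteq> 0 \<or> x $ 3 $ 1 \<noteq> 0"
    using assms x by (auto simp: lie_u_def vec_eq_iff forall_3)
  then obtain v where v: "v \<in> W" "D v = 0" "\<And>u. u \<in> W \<Longrightarrow> D u \<noteq> v"
    using kernel_not_image_horizontal[of "Suc l2" "l1 + l2"] assms by auto
  obtain w where w: "w \<in> W" "(D ^^ (p - 1)) w = v"
    using kernel_lift_of_projective[OF proj v(1,2)] by blast
  have "p - 1 = Suc (p - 2)" using p3 by simp
  then have "D ((D ^^ (p - 2)) w) = v" using w(2) by simp
  then show False using v(3)[OF D_pow_closed[OF w(1)]] by blast
qed

lemma projective_constant_iff:
  assumes "x $ 2 $ 1 \<noteq> 0" "x $ 3 $ 2 = 0"
  shows "is_projective \<longleftrightarrow> l2 = 0 \<and> p dvd l1 + 1"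
proof
  assume proj: is_projective
  show "l2 = 0 \<and> p dvd l1 + 1"
  proof (rule ccontr)
    assume "\<not> (l2 = 0 \<and> p dvd l1 + 1)"
    then have "\<not> (Suc l2 = 1 \<and> p dvd l1 + l2 + 1)" by (cases "l2 = 0") simp_all
    then obtain v where v: "v \<in> W" "D v = 0" "\<nexists>u. u \<in> W \<and> (D ^^ (p - 1)) u = v"
      using kernel_not_image_constant[of "Suc l2" "l1 + l2"] assms by auto
    then show False using kernel_lift_of_projective[OF proj v(1,2)] by blast
  qed
next
  assume "l2 = 0 \<and> p dvd l1 + 1"
  then show is_projective
    using single_row_kernel_exact[of "l1 + l2"] assms by (intro projective_of_kernel_exact) simp
qed

text \<open>
  For these \<open>x\<close>, the regular nilpotent elements of \<open>\<uu>\<close>, the criterion is the failure of both (A) and (B).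
\<close>

lemma projective_regular_iff:
  assumes "x $ 2 $ 1 \<noteq> 0" "x $ 3 $ 2 \<noteq> 0"
  shows "is_projective \<longleftrightarrow>
    p dvd l2 + 1 \<or> p dvd 2 * l1 + l2 + 2 \<and> (p dvd l1 + 1 \<or> p dvd l1 + l2 + 2)"
proof
  assume is_projective
  then obtain E where E: "linear_on_trapezoid (l1 + l2) (Suc l2) E"
    "\<And>v. v \<in> W \<Longrightarrow> v = (\<Sum>j<p. (D ^^ j) (E ((D ^^ (p - 1 - j)) v)))"
    by (rule higman_on_trapezoid) (rule that)
  have "- x $ 3 $ 2 \<noteq> 0" using assms by simp
  from higman_divisibility[OF this E]
  show "p dvd l2 + 1 \<or> p dvd 2 * l1 + l2 + 2 \<and> (p dvd l1 + 1 \<or> p dvd l1 + l2 + 2)"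
    by (intro weight_condition_of_divisibility prime_p p3) simp_all
next
  assume "p dvd l2 + 1 \<or> p dvd 2 * l1 + l2 + 2 \<and> (p dvd l1 + 1 \<or> p dvd l1 + l2 + 2)"
  from weight_condition_cases[OF prime_p p3 this]
  show is_projective
    using trapezoid_kernel_exact[of l2 l1] assms by (intro projective_of_kernel_exact) simp
qed

end

section \<open>The support variety\<close>

lemma restricted_nullcone_eq:
  assumes "CHAR('k::field) \<ge> 3" shows "restricted_nullcone = (lie_u :: 'k mat3 set)"
proof -
  have "((**) x ^^ CHAR('k)) (mat 1) = 0" if x: "x \<in> lie_u" for x :: "'k mat3"
  proof -
    obtain m where m: "CHAR('k) = Suc (Suc (Suc m))"
      using assms by (metis add.commute le_iff_add numeral_3_eq_3 add_Suc_right add_0_right)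
    have "x ** (x ** (x ** y)) = 0" for y :: "'k mat3"
      by (simp add: vec_eq_iff forall_3 matrix_mult_3 lie_u_zeros[OF x])
    then show ?thesis by (simp add: m)
  qed
  then show ?thesis by (auto simp: restricted_nullcone_def)
qed

lemma zariski_closure_zero_set:
  assumes "S \<subseteq> poly_funs" "V = {x. \<forall>F\<in>S. F x = 0}"
  shows "zariski_closure V = V"
  using assms unfolding zariski_closure_def by blast

definition lie_u_equations :: "('k::field mat3 \<Rightarrow> 'k) set" where
  "lie_u_equations = {\<lambda>x. x $ 1 $ 1, \<lambda>x. x $ 2 $ 2, \<lambda>x. x $ 3 $ 3,
     \<lambda>x. x $ 1 $ 2, \<lambda>x. x $ 1 $ 3, \<lambda>x. x $ 2 $ 3}"

lemma zariski_closure_lie_u_alpha: "zariski_closure lie_u_alpha = lie_u_alpha"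
  by (rule zariski_closure_zero_set[of "insert (\<lambda>x. x $ 2 $ 1) lie_u_equations"])
    (auto simp: lie_u_equations_def lie_u_alpha_def lie_u_def intro: poly_funs.intros)

lemma zariski_closure_lie_u_alpha_beta:
  "zariski_closure (lie_u_alpha \<union> lie_u_beta) = lie_u_alpha \<union> lie_u_beta"
  by (rule zariski_closure_zero_set[of "insert (\<lambda>x. x $ 2 $ 1 * x $ 3 $ 2) lie_u_equations"])
    (auto simp: lie_u_equations_def lie_u_alpha_def lie_u_beta_def lie_u_def intro: poly_funs.intros)

theorem theorem6p1p1:
  fixes p :: nat and l1 l2 :: int
    and M :: "('k::alg_closed_field mat3 \<Rightarrow> 'k) set"
    and A B :: bool
    and V :: "'k mat3 set"
  assumes char: "CHAR('k) = p" and p3: "p \<ge> 3"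
    and dominant: "l1 \<ge> 0" "l2 \<ge> 0"
  defines "M \<equiv> H0 (s_alpha ** s_beta) l1 l2"
    and "A \<equiv> \<not> int p dvd l1 + 1 \<and> \<not> int p dvd l2 + 1 \<and> \<not> int p dvd l1 + l2 + 2"
    and "B \<equiv> \<not> int p dvd l2 + 1 \<and> \<not> int p dvd 2 * l1 + l2 + 2"
    and "V \<equiv> support_variety lie_act M"
  shows "(A \<or> B \<longrightarrow> V = lie_u) \<and>
    (\<not> (A \<or> B) \<longrightarrow>
       V \<subset> lie_u \<and> zariski_closure V = V \<and>
       ((\<exists>n::nat. n \<ge> 1 \<and> l1 = int n * int p - 1 \<and> l2 = 0) \<and> V = lie_u_alpha \<or>
        l2 \<noteq> 0 \<and> V = lie_u_alpha \<union> lie_u_beta))"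
proof -
  obtain n1 n2 where l: "l1 = int n1" "l2 = int n2"
    using dominant nonneg_int_cases by metis
  define free_at_regular where "free_at_regular \<longleftrightarrow> p dvd n2 + 1 \<or>
    p dvd 2 * n1 + n2 + 2 \<and> (p dvd n1 + 1 \<or> p dvd n1 + n2 + 2)"
  have "int (n1 + 1) = l1 + 1" "int (n2 + 1) = l2 + 1" "int (n1 + n2 + 2) = l1 + l2 + 2"
    "int (2 * n1 + n2 + 2) = 2 * l1 + l2 + 2" by (simp_all add: l)
  then have AB: "\<not> (A \<or> B) \<longleftrightarrow> free_at_regular"
    unfolding A_def B_def free_at_regular_def by (metis int_dvd_int_iff)
  define proj where "proj x \<longleftrightarrow> projective_module (truncated_poly_ring p) (operator_module M (lie_act x))"
    for x :: "'k mat3"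
  have V: "V = {x \<in> lie_u. \<not> proj x} \<union> {0}"
    using restricted_nullcone_eq[where ?'k = 'k] char p3
    by (simp add: V_def support_variety_def proj_def)
  have zero: "0 \<in> lie_u_alpha" "0 \<in> lie_u_beta" "lie_u_alpha \<subseteq> lie_u" "lie_u_beta \<subseteq> lie_u"
    by (auto simp: lie_u_alpha_def lie_u_beta_def lie_u_def)
  have proj: "x $ 2 $ 1 = 0 \<Longrightarrow> x \<noteq> 0 \<Longrightarrow> \<not> proj x"
    "x $ 2 $ 1 \<noteq> 0 \<Longrightarrow> x $ 3 $ 2 = 0 \<Longrightarrow> proj x \<longleftrightarrow> n2 = 0 \<and> p dvd n1 + 1"
    "x $ 2 $ 1 \<noteq> 0 \<Longrightarrow> x $ 3 $ 2 \<noteq> 0 \<Longrightarrow> proj x \<longleftrightarrow> free_at_regular" if x: "x \<in> lie_u" for x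
  proof -
    interpret demazure_module p n1 n2 x by unfold_locales (rule char p3 x)+
    show "x $ 2 $ 1 = 0 \<Longrightarrow> x \<noteq> 0 \<Longrightarrow> \<not> proj x"
      "x $ 2 $ 1 \<noteq> 0 \<Longrightarrow> x $ 3 $ 2 = 0 \<Longrightarrow> proj x \<longleftrightarrow> n2 = 0 \<and> p dvd n1 + 1"
      "x $ 2 $ 1 \<noteq> 0 \<Longrightarrow> x $ 3 $ 2 \<noteq> 0 \<Longrightarrow> proj x \<longleftrightarrow> free_at_regular"
      unfolding proj_def M_def l free_at_regular_def
      by (rule not_projective_horizontal projective_constant_iff projective_regular_iff; assumption)+
  qed
  \<comment> \<open>The exceptional weights for \<open>x\<^sub>3\<^sub>2 = 0\<close> are among those for which (A) and (B) fail.\<close>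
  have regular_of_exception: "free_at_regular" if "n2 = 0" "p dvd n1 + 1"
  proof -
    have "2 * n1 + n2 + 2 = 2 * (n1 + 1)" using that by simp
    then show ?thesis using that unfolding free_at_regular_def by (metis dvd_mult)
  qed
  have "V = lie_u" if "\<not> free_at_regular"
    using that regular_of_exception proj zero unfolding V by (auto simp: lie_u_def)
  moreover have "V \<subset> lie_u \<and> zariski_closure V = V \<and>
       ((\<exists>n::nat. n \<ge> 1 \<and> l1 = int n * int p - 1 \<and> l2 = 0) \<and> V = lie_u_alpha \<or>
        l2 \<noteq> 0 \<and> V = lie_u_alpha \<union> lie_u_beta)" if free_at_regular
  proof -
    \<comment> \<open>A regular nilpotent element shows that \<open>V\<close> is proper.\<close>
    let ?y = "mat3_rows 0 0 0 1 0 0 0 1 0 :: 'k mat3"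
    have "?y \<in> lie_u" "?y \<notin> V"
      using proj[of ?y] that by (auto simp: V lie_u_def vec_eq_iff forall_3)
    moreover have "V \<subseteq> lie_u" using zero by (auto simp: V)
    ultimately have proper: "V \<subset> lie_u" by blast
    show ?thesis
    proof (cases "n2 = 0")
      case True
      have "\<not> p dvd 1" using p3 by auto
      moreover have "p dvd n1 + 1" if "p dvd n1 + 0 + 2" "p dvd 2 * n1 + 0 + 2"
      proof -
        have "p dvd (2 * n1 + 2) - (n1 + 2)" using that by (intro dvd_diff_nat) simp_all
        then have "p dvd n1" by simp
        then have "p dvd 2" using that(1) dvd_add_right_iff[of p n1 2] by simp
        then show ?thesis using p3 by (auto dest!: dvd_imp_le)
      qed
      ultimately have n1: "p dvd n1 + 1" using that True unfolding free_at_regular_def by auto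
      then obtain m where m: "n1 + 1 = p * m" by (rule dvdE)
      then have "m \<ge> 1" by (cases m) auto
      moreover have "l1 = int m * int p - 1"
        using arg_cong[OF m, of int] by (simp add: l algebra_simps)
      ultimately have "\<exists>n::nat. n \<ge> 1 \<and> l1 = int n * int p - 1 \<and> l2 = 0" using l True by auto
      moreover have "V = lie_u_alpha"
        using proj that True n1 zero unfolding V lie_u_alpha_def by blast
      ultimately show ?thesis using proper zariski_closure_lie_u_alpha by simp
    next
      case False
      have "V = lie_u_alpha \<union> lie_u_beta"
        using proj that False zero unfolding V lie_u_alpha_def lie_u_beta_def by blast
      then show ?thesis using proper zariski_closure_lie_u_alpha_beta False l by simp
    qed
  qed
  ultimately show ?thesis using AB by blast
qed

end
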